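(* Let $\mathscr{D}$ be a Krull--Schmidt triangulated category and let $t$ be a non-degenerate t-structure on $\mathscr{D}$ with finite-length heart $\heartsuit_t$. Let $\mathcal{L}$ be a full set of isomorphism representatives of the simple objects in $\heartsuit_t$ and let $\mathcal{P}$ be a full set of isomorphism representatives of the indecomposable derived projective objects with respect to $t$. Then the following are equivalent: (I) $t$ is silting, i.e. $t$ is the silting t-structure associated with some silting collection in $\mathscr{D}$. (II) There is a bijection $\phi\colon\mathcal{P}\to\mathcal{L}$ such that for all $P\in\mathcal{P}$, $L\in\mathcal{L}$, $m\in\mathbb{Z}$ there is an isomorphism of left $\mathrm{End}_{\mathscr{D}}(L)$-modules $$\mathrm{Hom}_{\mathscr{D}}(P,L[m])\cong\begin{cases}\mathrm{End}_{\mathscr{D}}(L)&\text{if } L=\phi(P),\ m=0,\\ 0&\text{otherwise.}\end{cases}$$ (III) Every $L\in\mathcal{L}$ admits a derived projective cover with respect to $t$. (IV) $\mathscr{D}$ has enough derived projectives with respect to $t$. Moreover, when these conditions hold, the silting collection in (I) is (up to isomorphism of its members) $\mathcal{P}$, and $\mathcal{P}$ is (up to isomorphism) the set of the derived projective covers in (III).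
   Context: All categories are linear over a fixed field. A t-structure on a triangulated category $\mathscr{D}$ is a pair $t=(\mathscr{D}^{t\le 0},\mathscr{D}^{t\ge 0})$ of strict full subcategories with $\mathscr{D}^{t\le0}[1]\subseteq\mathscr{D}^{t\le0}$, $\mathscr{D}^{t\ge0}[-1]\subseteq\mathscr{D}^{t\ge0}$, $\mathrm{Hom}(\mathscr{D}^{t\le 0},\mathscr{D}^{t\ge0}[-1])=0$, and such that every $X$ sits in a triangle $t_{\le0}X\to X\to t_{>0}X\to t_{\le 0}X[1]$ with $t_{\le0}X\in\mathscr{D}^{t\le0}$, $t_{>0}X\in\mathscr{D}^{t\ge0}[-1]$. Write $\mathscr{D}^{t\le n}=\mathscr{D}^{t\le0}[-n]$, $\mathscr{D}^{t\ge n}=\mathscr{D}^{t\ge0}[-n]$, $\mathscr{D}^{t<0}=\mathscr{D}^{t\le0}[1]$, $\mathscr{D}^{t>0}=\mathscr{D}^{t\ge0}[-1]$. The heart is $\heartsuit_t=\mathscr{D}^{t\le0}\cap\mathscr{D}^{t\ge0}$; $t_{\le 0},t_{\ge 0}$ are the truncation functors and $H^0_t=t_{\ge0}t_{\le0}\colon\mathscr{D}\to\heartsuit_t$. $t$ is non-degenerate if $\bigcap_n\mathscr{D}^{t\le n}=\{0\}=\bigcap_n\mathscr{D}^{t\ge n}$. An abelian category is finite-length if all its objects have finite length. For a set of objects $\mathcal{X}$, $\mathcal{X}^{\perp_{>0}}=\{D\in\mathscr{D}\mid\mathrm{Hom}(X,D[m])=0\ \forall m>0,X\in\mathcal{X}\}$,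 and $\mathcal{X}^{\perp_{<0}}$ is defined analogously. $\mathrm{Kar}_{\mathscr{D}}(\mathcal{X})$ is the full subcategory of direct summands of finite coproducts of objects in $\mathcal{X}$. A silting collection in $\mathscr{D}$ is a (not necessarily finite) set $\mathcal{P}$ of indecomposable, pairwise non-isomorphic objects such that $\mathrm{Kar}_{\mathscr{D}}(\mathcal{P})$ is Krull--Schmidt and $t_{\mathcal{P}}=(\mathcal{P}^{\perp_{>0}},\mathcal{P}^{\perp_{<0}})$ is a t-structure on $\mathscr{D}$, called the silting t-structure associated with $\mathcal{P}$. An object $P$ is derived projective (with respect to $t$) if $P\in\mathscr{D}^{t\le0}$ and $\mathrm{Hom}(P,X[1])=0$ for all $X\in\mathscr{D}^{t\le0}$. A derived projective cover of $X\in\mathscr{D}$ is a morphism $\pi\colon P\to X$ (also the object $P$) with $P$ derived projective such that $H^0_t(\pi)\colon H^0_t(P)\to H^0_t(X)$ is a projective cover in $\heartsuit_t$. $\mathscr{D}$ has derived projectives if for each projective $P\in\heartsuit_t$ there is a derived projective $\hat P$ with $H^0_t(\hat P)\cong P$; it has enough derived projectives if moreover $\heartsuit_t$ has enough projectives. *)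

theory Defs
  imports "HOL-Algebra.Module"
begin

section \<open>Linear categories\<close>

text \<open>
  Hom-spaces are modules in the sense of HOL-Algebra (the multiplicative fields of the record
  are irrelevant).  Composition is not indexed by objects; this costs no generality, since the
  hom-sets of any category can be made pairwise disjoint by tagging arrows.  Disjointness
  itself is not required.
\<close>

record ('k, 'o, 'm) lin_cat =
  Obj :: "'o set"
  Hom :: "'o \<Rightarrow> 'o \<Rightarrow> ('k, 'm) module"
  Idn :: "'o \<Rightarrow> 'm"
  Comp :: "'m \<Rightarrow> 'm \<Rightarrow> 'm" (infixl \<open>\<cdot>\<index>\<close> 70)

abbreviation hom_set :: "('k, 'o, 'm, 'z) lin_cat_scheme \<Rightarrow> 'o \<Rightarrow> 'o \<Rightarrow> 'm set" where
  "hom_set C X Y \<equiv> carrier (Hom C X Y)"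

abbreviation zero_mor :: "('k, 'o, 'm, 'z) lin_cat_scheme \<Rightarrow> 'o \<Rightarrow> 'o \<Rightarrow> 'm" where
  "zero_mor C X Y \<equiv> \<zero>\<^bsub>Hom C X Y\<^esub>"

definition hom_vanishes :: "('k, 'o, 'm, 'z) lin_cat_scheme \<Rightarrow> 'o \<Rightarrow> 'o \<Rightarrow> bool" where
  "hom_vanishes C X Y \<longleftrightarrow> hom_set C X Y = {zero_mor C X Y}"

definition zero_object :: "('k, 'o, 'm, 'z) lin_cat_scheme \<Rightarrow> 'o \<Rightarrow> bool" where
  "zero_object C X \<longleftrightarrow>
     X \<in> Obj C \<and> (\<forall>Y\<in>Obj C. hom_vanishes C X Y \<and> hom_vanishes C Y X)"

definition is_mono :: "('k, 'o, 'm, 'z) lin_cat_scheme \<Rightarrow> 'o \<Rightarrow> 'o \<Rightarrow> 'm \<Rightarrow> bool" where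
  "is_mono C X Y f \<longleftrightarrow> X \<in> Obj C \<and> Y \<in> Obj C \<and> f \<in> hom_set C X Y \<and>
     (\<forall>Z\<in>Obj C. \<forall>g\<in>hom_set C Z X. \<forall>h\<in>hom_set C Z X. f \<cdot>\<^bsub>C\<^esub> g = f \<cdot>\<^bsub>C\<^esub> h \<longrightarrow> g = h)"

definition is_epi :: "('k, 'o, 'm, 'z) lin_cat_scheme \<Rightarrow> 'o \<Rightarrow> 'o \<Rightarrow> 'm \<Rightarrow> bool" where
  "is_epi C X Y f \<longleftrightarrow> X \<in> Obj C \<and> Y \<in> Obj C \<and> f \<in> hom_set C X Y \<and>
     (\<forall>Z\<in>Obj C. \<forall>g\<in>hom_set C Y Z. \<forall>h\<in>hom_set C Y Z. g \<cdot>\<^bsub>C\<^esub> f = h \<cdot>\<^bsub>C\<^esub> f \<longrightarrow> g = h)"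

definition is_iso :: "('k, 'o, 'm, 'z) lin_cat_scheme \<Rightarrow> 'o \<Rightarrow> 'o \<Rightarrow> 'm \<Rightarrow> bool" where
  "is_iso C X Y f \<longleftrightarrow> X \<in> Obj C \<and> Y \<in> Obj C \<and> f \<in> hom_set C X Y \<and>
     (\<exists>g\<in>hom_set C Y X. g \<cdot>\<^bsub>C\<^esub> f = Idn C X \<and> f \<cdot>\<^bsub>C\<^esub> g = Idn C Y)"

definition isomorphic :: "('k, 'o, 'm, 'z) lin_cat_scheme \<Rightarrow> 'o \<Rightarrow> 'o \<Rightarrow> bool" where
  "isomorphic C X Y \<longleftrightarrow> (\<exists>f. is_iso C X Y f)"

definition is_cokernel ::
    "('k, 'o, 'm, 'z) lin_cat_scheme \<Rightarrow> 'o \<Rightarrow> 'o \<Rightarrow> 'm \<Rightarrow> 'o \<Rightarrow> 'm \<Rightarrow> bool" where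
  "is_cokernel C X Y f Q q \<longleftrightarrow>
     X \<in> Obj C \<and> Y \<in> Obj C \<and> Q \<in> Obj C \<and> f \<in> hom_set C X Y \<and> q \<in> hom_set C Y Q \<and>
     q \<cdot>\<^bsub>C\<^esub> f = zero_mor C X Q \<and>
     (\<forall>Z\<in>Obj C. \<forall>g\<in>hom_set C Y Z. g \<cdot>\<^bsub>C\<^esub> f = zero_mor C X Z \<longrightarrow>
        (\<exists>!u. u \<in> hom_set C Q Z \<and> u \<cdot>\<^bsub>C\<^esub> q = g))"

definition is_coproduct ::
    "('k, 'o, 'm, 'z) lin_cat_scheme \<Rightarrow> 'i set \<Rightarrow> ('i \<Rightarrow> 'o) \<Rightarrow> 'o \<Rightarrow> ('i \<Rightarrow> 'm) \<Rightarrow> bool" where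
  "is_coproduct C I X Y \<iota> \<longleftrightarrow>
     Y \<in> Obj C \<and> (\<forall>j\<in>I. X j \<in> Obj C \<and> \<iota> j \<in> hom_set C (X j) Y) \<and>
     (\<forall>Z\<in>Obj C. \<forall>f. (\<forall>j\<in>I. f j \<in> hom_set C (X j) Z) \<longrightarrow>
        (\<exists>!g. g \<in> hom_set C Y Z \<and> (\<forall>j\<in>I. g \<cdot>\<^bsub>C\<^esub> \<iota> j = f j)))"

text \<open>\<open>Y\<close> is a coproduct of the two objects \<open>A\<close> and \<open>B\<close>.\<close>

definition is_direct_sum :: "('k, 'o, 'm, 'z) lin_cat_scheme \<Rightarrow> 'o \<Rightarrow> 'o \<Rightarrow> 'o \<Rightarrow> bool" where
  "is_direct_sum C A B Y \<longleftrightarrow> (\<exists>\<iota>. is_coproduct C (UNIV :: bool set) (case_bool A B) Y \<iota>)"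

definition direct_summand :: "('k, 'o, 'm, 'z) lin_cat_scheme \<Rightarrow> 'o \<Rightarrow> 'o \<Rightarrow> bool" where
  "direct_summand C X Y \<longleftrightarrow> (\<exists>X'. is_direct_sum C X X' Y)"

definition indecomposable :: "('k, 'o, 'm, 'z) lin_cat_scheme \<Rightarrow> 'o \<Rightarrow> bool" where
  "indecomposable C X \<longleftrightarrow> X \<in> Obj C \<and> \<not> zero_object C X \<and>
     (\<forall>A B. is_direct_sum C A B X \<longrightarrow> zero_object C A \<or> zero_object C B)"

definition full_subcategory ::
    "('k, 'o, 'm, 'z) lin_cat_scheme \<Rightarrow> 'o set \<Rightarrow> ('k, 'o, 'm, 'z) lin_cat_scheme" where
  "full_subcategory C S = C\<lparr>Obj := S\<rparr>"

definition iso_closed :: "('k, 'o, 'm, 'z) lin_cat_scheme \<Rightarrow> 'o set \<Rightarrow> bool" where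
  "iso_closed C S \<longleftrightarrow> (\<forall>X\<in>S. \<forall>Y\<in>Obj C. isomorphic C X Y \<longrightarrow> Y \<in> S)"

definition iso_representatives ::
    "('k, 'o, 'm, 'z) lin_cat_scheme \<Rightarrow> 'o set \<Rightarrow> 'o set \<Rightarrow> bool" where
  "iso_representatives C S R \<longleftrightarrow> R \<subseteq> S \<and> (\<forall>X\<in>S. \<exists>!Y. Y \<in> R \<and> isomorphic C X Y)"

definition same_up_to_iso ::
    "('k, 'o, 'm, 'z) lin_cat_scheme \<Rightarrow> 'o set \<Rightarrow> 'o set \<Rightarrow> bool" where
  "same_up_to_iso C S T \<longleftrightarrow>
     (\<forall>X\<in>S. \<exists>Y\<in>T. isomorphic C X Y) \<and> (\<forall>Y\<in>T. \<exists>X\<in>S. isomorphic C X Y)"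

locale linear_category = K: field K
  for K :: "'k ring" and C :: "('k, 'o, 'm, 'z) lin_cat_scheme" (structure) +
  assumes hom_module: "\<lbrakk>X \<in> Obj C; Y \<in> Obj C\<rbrakk> \<Longrightarrow> module K (Hom C X Y)"
    and Idn_closed: "X \<in> Obj C \<Longrightarrow> Idn C X \<in> hom_set C X X"
    and comp_closed:
      "\<lbrakk>X \<in> Obj C; Y \<in> Obj C; Z \<in> Obj C; f \<in> hom_set C X Y; g \<in> hom_set C Y Z\<rbrakk>
       \<Longrightarrow> g \<cdot> f \<in> hom_set C X Z"
    and comp_assoc:
      "\<lbrakk>W \<in> Obj C; X \<in> Obj C; Y \<in> Obj C; Z \<in> Obj C;
        f \<in> hom_set C W X; g \<in> hom_set C X Y; h \<in> hom_set C Y Z\<rbrakk>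
       \<Longrightarrow> (h \<cdot> g) \<cdot> f = h \<cdot> (g \<cdot> f)"
    and comp_Idn_left:
      "\<lbrakk>X \<in> Obj C; Y \<in> Obj C; f \<in> hom_set C X Y\<rbrakk> \<Longrightarrow> Idn C Y \<cdot> f = f"
    and comp_Idn_right:
      "\<lbrakk>X \<in> Obj C; Y \<in> Obj C; f \<in> hom_set C X Y\<rbrakk> \<Longrightarrow> f \<cdot> Idn C X = f"
    and comp_add_left:
      "\<lbrakk>X \<in> Obj C; Y \<in> Obj C; Z \<in> Obj C;
        f \<in> hom_set C X Y; g \<in> hom_set C Y Z; h \<in> hom_set C Y Z\<rbrakk>
       \<Longrightarrow> (g \<oplus>\<^bsub>Hom C Y Z\<^esub> h) \<cdot> f = g \<cdot> f \<oplus>\<^bsub>Hom C X Z\<^esub> h \<cdot> f"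
    and comp_add_right:
      "\<lbrakk>X \<in> Obj C; Y \<in> Obj C; Z \<in> Obj C;
        f \<in> hom_set C X Y; g \<in> hom_set C X Y; h \<in> hom_set C Y Z\<rbrakk>
       \<Longrightarrow> h \<cdot> (f \<oplus>\<^bsub>Hom C X Y\<^esub> g) = h \<cdot> f \<oplus>\<^bsub>Hom C X Z\<^esub> h \<cdot> g"
    and comp_smult_left:
      "\<lbrakk>X \<in> Obj C; Y \<in> Obj C; Z \<in> Obj C; a \<in> carrier K;
        f \<in> hom_set C X Y; g \<in> hom_set C Y Z\<rbrakk>
       \<Longrightarrow> (a \<odot>\<^bsub>Hom C Y Z\<^esub> g) \<cdot> f = a \<odot>\<^bsub>Hom C X Z\<^esub> (g \<cdot> f)"
    and comp_smult_right:
      "\<lbrakk>X \<in> Obj C; Y \<in> Obj C; Z \<in> Obj C; a \<in> carrier K;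
        f \<in> hom_set C X Y; g \<in> hom_set C Y Z\<rbrakk>
       \<Longrightarrow> g \<cdot> (a \<odot>\<^bsub>Hom C X Y\<^esub> f) = a \<odot>\<^bsub>Hom C X Z\<^esub> (g \<cdot> f)"

locale additive_category = linear_category +
  assumes ex_zero_object: "\<exists>X. zero_object C X"
    and ex_direct_sum: "\<lbrakk>A \<in> Obj C; B \<in> Obj C\<rbrakk> \<Longrightarrow> \<exists>Y. is_direct_sum C A B Y"


section \<open>Endomorphism rings and left modules over them\<close>

definition endo_ring :: "('k, 'o, 'm, 'z) lin_cat_scheme \<Rightarrow> 'o \<Rightarrow> 'm ring" where
  "endo_ring C X = \<lparr>carrier = hom_set C X X, mult = Comp C, one = Idn C X,
     zero = zero_mor C X X, add = add (Hom C X X)\<rparr>"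

text \<open>Local rings, not necessarily commutative.\<close>

definition local_ring :: "('a, 'b) ring_scheme \<Rightarrow> bool" where
  "local_ring R \<longleftrightarrow> ring R \<and> \<one>\<^bsub>R\<^esub> \<noteq> \<zero>\<^bsub>R\<^esub> \<and>
     (\<forall>a\<in>carrier R. \<forall>b\<in>carrier R. a \<notin> Units R \<and> b \<notin> Units R \<longrightarrow> a \<oplus>\<^bsub>R\<^esub> b \<notin> Units R)"

text \<open>
  HOL-Algebra's locale \<open>module\<close> covers commutative base rings only.  A left module over a
  noncommutative ring is represented by the same record type; isomorphisms are the
  isomorphisms of additive groups compatible with the action.
\<close>

definition left_modules_isomorphic ::
    "('r, 'b) ring_scheme \<Rightarrow> ('r, 'm) module \<Rightarrow> ('r, 'n) module \<Rightarrow> bool" where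
  "left_modules_isomorphic R M N \<longleftrightarrow>
     (\<exists>h \<in> iso (add_monoid M) (add_monoid N).
        \<forall>r\<in>carrier R. \<forall>x\<in>carrier M. h (r \<odot>\<^bsub>M\<^esub> x) = r \<odot>\<^bsub>N\<^esub> h x)"

definition regular_module :: "'r ring \<Rightarrow> ('r, 'r) module" where
  "regular_module R = \<lparr>carrier = carrier R, mult = mult R, one = one R,
     zero = zero R, add = add R, smult = mult R\<rparr>"

definition zero_module :: "'r ring \<Rightarrow> ('r, 'r) module" where
  "zero_module R = \<lparr>carrier = {\<zero>\<^bsub>R\<^esub>}, mult = mult R, one = one R,
     zero = zero R, add = add R, smult = mult R\<rparr>"


section \<open>Krull--Schmidt categories and finite length\<close>

definition krull_schmidt :: "'k ring \<Rightarrow> ('k, 'o, 'm, 'z) lin_cat_scheme \<Rightarrow> bool" where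
  "krull_schmidt K C \<longleftrightarrow> additive_category K C \<and>
     (\<forall>X\<in>Obj C. \<exists>(n::nat) Y \<iota>. is_coproduct C {..<n} Y X \<iota> \<and>
        (\<forall>j<n. local_ring (endo_ring C (Y j))))"

definition Kar :: "('k, 'o, 'm, 'z) lin_cat_scheme \<Rightarrow> 'o set \<Rightarrow> 'o set" where
  "Kar C S = {X \<in> Obj C. \<exists>(n::nat) Y Z \<iota>. (\<forall>j<n. Y j \<in> S) \<and>
     is_coproduct C {..<n} Y Z \<iota> \<and> direct_summand C X Z}"

definition simple_object :: "('k, 'o, 'm, 'z) lin_cat_scheme \<Rightarrow> 'o \<Rightarrow> bool" where
  "simple_object C X \<longleftrightarrow> X \<in> Obj C \<and> \<not> zero_object C X \<and>
     (\<forall>Y f. is_mono C Y X f \<longrightarrow> zero_object C Y \<or> is_iso C Y X f)"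

text \<open>Existence of a composition series \<open>0 = F 0 \<subseteq> \<dots> \<subseteq> F n = X\<close> with simple subquotients.\<close>

definition finite_length :: "('k, 'o, 'm, 'z) lin_cat_scheme \<Rightarrow> 'o \<Rightarrow> bool" where
  "finite_length C X \<longleftrightarrow> (\<exists>(n::nat) F i. zero_object C (F 0) \<and> F n = X \<and>
     (\<forall>k<n. is_mono C (F k) (F (Suc k)) (i k) \<and>
        (\<exists>Q q. is_cokernel C (F k) (F (Suc k)) (i k) Q q \<and> simple_object C Q)))"

definition finite_length_category :: "('k, 'o, 'm, 'z) lin_cat_scheme \<Rightarrow> bool" where
  "finite_length_category C \<longleftrightarrow> (\<forall>X\<in>Obj C. finite_length C X)"

definition projective_object :: "('k, 'o, 'm, 'z) lin_cat_scheme \<Rightarrow> 'o \<Rightarrow> bool" where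
  "projective_object C P \<longleftrightarrow> P \<in> Obj C \<and>
     (\<forall>X Y e. is_epi C X Y e \<longrightarrow>
        (\<forall>f\<in>hom_set C P Y. \<exists>g\<in>hom_set C P X. e \<cdot>\<^bsub>C\<^esub> g = f))"

text \<open>Projective cover: an essential epimorphism from a projective object.\<close>

definition projective_cover ::
    "('k, 'o, 'm, 'z) lin_cat_scheme \<Rightarrow> 'o \<Rightarrow> 'o \<Rightarrow> 'm \<Rightarrow> bool" where
  "projective_cover C P X p \<longleftrightarrow> projective_object C P \<and> is_epi C P X p \<and>
     (\<forall>Y\<in>Obj C. \<forall>g\<in>hom_set C Y P. is_epi C Y X (p \<cdot>\<^bsub>C\<^esub> g) \<longrightarrow> is_epi C Y P g)"

definition enough_projectives :: "('k, 'o, 'm, 'z) lin_cat_scheme \<Rightarrow> bool" where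
  "enough_projectives C \<longleftrightarrow>
     (\<forall>X\<in>Obj C. \<exists>P p. projective_object C P \<and> is_epi C P X p)"


section \<open>Triangulated categories\<close>

text \<open>
  The translation is a strict automorphism, given with its integer powers \<open>[n]\<close>:
  \<open>shO D n X\<close> is \<open>X[n]\<close>, and \<open>shM D n f\<close> is \<open>f[n]\<close>.
  \<open>tri D X Y Z f g h\<close> says that \<open>X \<rightarrow> Y \<rightarrow> Z \<rightarrow> X[1]\<close> (with arrows \<open>f, g, h\<close>) is distinguished.
\<close>

record ('k, 'o, 'm) tri_cat = "('k, 'o, 'm) lin_cat" +
  shO :: "int \<Rightarrow> 'o \<Rightarrow> 'o"
  shM :: "int \<Rightarrow> 'm \<Rightarrow> 'm"
  tri :: "'o \<Rightarrow> 'o \<Rightarrow> 'o \<Rightarrow> 'm \<Rightarrow> 'm \<Rightarrow> 'm \<Rightarrow> bool"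

locale triangulated_category = additive_category K D
  for K :: "'k ring" and D :: "('k, 'o, 'm, 'z) tri_cat_scheme" (structure) +
  assumes shO_closed: "X \<in> Obj D \<Longrightarrow> shO D n X \<in> Obj D"
    and shO_0: "X \<in> Obj D \<Longrightarrow> shO D 0 X = X"
    and shO_add: "X \<in> Obj D \<Longrightarrow> shO D (m + n) X = shO D m (shO D n X)"
    and shM_closed:
      "\<lbrakk>X \<in> Obj D; Y \<in> Obj D; f \<in> hom_set D X Y\<rbrakk>
       \<Longrightarrow> shM D n f \<in> hom_set D (shO D n X) (shO D n Y)"
    and shM_0: "\<lbrakk>X \<in> Obj D; Y \<in> Obj D; f \<in> hom_set D X Y\<rbrakk> \<Longrightarrow> shM D 0 f = f"
    and shM_add:
      "\<lbrakk>X \<in> Obj D; Y \<in> Obj D; f \<in> hom_set D X Y\<rbrakk>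
       \<Longrightarrow> shM D (m + n) f = shM D m (shM D n f)"
    and shM_Idn: "X \<in> Obj D \<Longrightarrow> shM D n (Idn D X) = Idn D (shO D n X)"
    and shM_comp:
      "\<lbrakk>X \<in> Obj D; Y \<in> Obj D; Z \<in> Obj D; f \<in> hom_set D X Y; g \<in> hom_set D Y Z\<rbrakk>
       \<Longrightarrow> shM D n (g \<cdot> f) = shM D n g \<cdot> shM D n f"
    and shM_plus:
      "\<lbrakk>X \<in> Obj D; Y \<in> Obj D; f \<in> hom_set D X Y; g \<in> hom_set D X Y\<rbrakk>
       \<Longrightarrow> shM D n (f \<oplus>\<^bsub>Hom D X Y\<^esub> g)
           = shM D n f \<oplus>\<^bsub>Hom D (shO D n X) (shO D n Y)\<^esub> shM D n g"
    and shM_smult: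
      "\<lbrakk>X \<in> Obj D; Y \<in> Obj D; a \<in> carrier K; f \<in> hom_set D X Y\<rbrakk>
       \<Longrightarrow> shM D n (a \<odot>\<^bsub>Hom D X Y\<^esub> f) = a \<odot>\<^bsub>Hom D (shO D n X) (shO D n Y)\<^esub> shM D n f"
    and tri_closed:
      "tri D X Y Z f g h \<Longrightarrow> X \<in> Obj D \<and> Y \<in> Obj D \<and> Z \<in> Obj D \<and>
         f \<in> hom_set D X Y \<and> g \<in> hom_set D Y Z \<and> h \<in> hom_set D Z (shO D 1 X)"
    and TR1_iso:
      "\<lbrakk>tri D X Y Z f g h;
        f' \<in> hom_set D X' Y'; g' \<in> hom_set D Y' Z'; h' \<in> hom_set D Z' (shO D 1 X');
        is_iso D X X' \<alpha>; is_iso D Y Y' \<beta>; is_iso D Z Z' \<gamma>;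
        \<beta> \<cdot> f = f' \<cdot> \<alpha>; \<gamma> \<cdot> g = g' \<cdot> \<beta>; shM D 1 \<alpha> \<cdot> h = h' \<cdot> \<gamma>\<rbrakk>
       \<Longrightarrow> tri D X' Y' Z' f' g' h'"
    and TR1_Idn:
      "\<lbrakk>X \<in> Obj D; zero_object D Z\<rbrakk>
       \<Longrightarrow> tri D X X Z (Idn D X) (zero_mor D X Z) (zero_mor D Z (shO D 1 X))"
    and TR1_cone:
      "\<lbrakk>X \<in> Obj D; Y \<in> Obj D; f \<in> hom_set D X Y\<rbrakk> \<Longrightarrow> \<exists>Z g h. tri D X Y Z f g h"
    and TR2:
      "\<lbrakk>X \<in> Obj D; Y \<in> Obj D; Z \<in> Obj D;
        f \<in> hom_set D X Y; g \<in> hom_set D Y Z; h \<in> hom_set D Z (shO D 1 X)\<rbrakk>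
       \<Longrightarrow> tri D X Y Z f g h \<longleftrightarrow>
           tri D Y Z (shO D 1 X) g h (\<ominus>\<^bsub>Hom D (shO D 1 X) (shO D 1 Y)\<^esub> (shM D 1 f))"
    and TR3:
      "\<lbrakk>tri D X Y Z f g h; tri D X' Y' Z' f' g' h';
        \<alpha> \<in> hom_set D X X'; \<beta> \<in> hom_set D Y Y'; \<beta> \<cdot> f = f' \<cdot> \<alpha>\<rbrakk>
       \<Longrightarrow> \<exists>\<gamma>\<in>hom_set D Z Z'. \<gamma> \<cdot> g = g' \<cdot> \<beta> \<and> shM D 1 \<alpha> \<cdot> h = h' \<cdot> \<gamma>"
    and TR4:
      "\<lbrakk>tri D X Y Z' f i j; tri D Y Z X' g k l; tri D X Z Y' (g \<cdot> f) p q\<rbrakk>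
       \<Longrightarrow> \<exists>u v. tri D Z' Y' X' u v (shM D 1 i \<cdot> l) \<and>
             u \<cdot> i = p \<cdot> g \<and> q \<cdot> u = j \<and> v \<cdot> p = k \<and> l \<cdot> v = shM D 1 f \<cdot> q"

text \<open>\<open>Hom(P, L[m])\<close> as a left \<open>End(L)\<close>-module: \<open>e\<close> acts by composition with \<open>e[m]\<close>.\<close>

definition hom_left_module ::
    "('k, 'o, 'm, 'z) tri_cat_scheme \<Rightarrow> 'o \<Rightarrow> 'o \<Rightarrow> int \<Rightarrow> ('m, 'm) module" where
  "hom_left_module D P L m =
     \<lparr>carrier = hom_set D P (shO D m L), mult = mult (Hom D P (shO D m L)),
      one = one (Hom D P (shO D m L)), zero = zero_mor D P (shO D m L),
      add = add (Hom D P (shO D m L)), smult = (\<lambda>e f. shM D m e \<cdot>\<^bsub>D\<^esub> f)\<rparr>"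


section \<open>t-structures\<close>

text \<open>A pair of full subcategories is represented by a pair of sets of objects.\<close>

definition t_le :: "('k, 'o, 'm, 'z) tri_cat_scheme \<Rightarrow> 'o set \<times> 'o set \<Rightarrow> int \<Rightarrow> 'o set" where
  "t_le D t n = shO D (- n) ` fst t"

definition t_ge :: "('k, 'o, 'm, 'z) tri_cat_scheme \<Rightarrow> 'o set \<times> 'o set \<Rightarrow> int \<Rightarrow> 'o set" where
  "t_ge D t n = shO D (- n) ` snd t"

definition t_structure :: "('k, 'o, 'm, 'z) tri_cat_scheme \<Rightarrow> 'o set \<times> 'o set \<Rightarrow> bool" where
  "t_structure D t \<longleftrightarrow>
     fst t \<subseteq> Obj D \<and> snd t \<subseteq> Obj D \<and> iso_closed D (fst t) \<and> iso_closed D (snd t) \<and>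
     shO D 1 ` fst t \<subseteq> fst t \<and> shO D (- 1) ` snd t \<subseteq> snd t \<and>
     (\<forall>X\<in>fst t. \<forall>Y\<in>shO D (- 1) ` snd t. hom_vanishes D X Y) \<and>
     (\<forall>X\<in>Obj D. \<exists>A B i p h. A \<in> fst t \<and> B \<in> shO D (- 1) ` snd t \<and> tri D A X B i p h)"

definition nondegenerate :: "('k, 'o, 'm, 'z) tri_cat_scheme \<Rightarrow> 'o set \<times> 'o set \<Rightarrow> bool" where
  "nondegenerate D t \<longleftrightarrow>
     (\<Inter>n. t_le D t n) = {X. zero_object D X} \<and> (\<Inter>n. t_ge D t n) = {X. zero_object D X}"

definition heart ::
    "('k, 'o, 'm, 'z) tri_cat_scheme \<Rightarrow> 'o set \<times> 'o set \<Rightarrow> ('k, 'o, 'm, 'z) tri_cat_scheme" where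
  "heart D t = full_subcategory D (fst t \<inter> snd t)"

text \<open>
  Truncation functors, from a choice of triangles \<open>A \<rightarrow> X \<rightarrow> B \<rightarrow> A[1]\<close> with \<open>A\<close> in degrees
  \<open>\<le> n\<close> and \<open>B\<close> in degrees \<open>> n\<close>; they are unique up to unique isomorphism.
\<close>

definition trunc_triangle ::
    "('k, 'o, 'm, 'z) tri_cat_scheme \<Rightarrow> 'o set \<times> 'o set \<Rightarrow> int \<Rightarrow> 'o \<Rightarrow> 'o \<times> 'o \<times> 'm \<times> 'm \<times> 'm"
  where
  "trunc_triangle D t n X =
     (SOME (A, B, i, p, h). A \<in> t_le D t n \<and> B \<in> t_ge D t (n + 1) \<and> tri D A X B i p h)"

definition trunc_le ::
    "('k, 'o, 'm, 'z) tri_cat_scheme \<Rightarrow> 'o set \<times> 'o set \<Rightarrow> int \<Rightarrow> 'o \<Rightarrow> 'o" where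
  "trunc_le D t n X = (case trunc_triangle D t n X of (A, B, i, p, h) \<Rightarrow> A)"

definition trunc_le_incl ::
    "('k, 'o, 'm, 'z) tri_cat_scheme \<Rightarrow> 'o set \<times> 'o set \<Rightarrow> int \<Rightarrow> 'o \<Rightarrow> 'm" where
  "trunc_le_incl D t n X = (case trunc_triangle D t n X of (A, B, i, p, h) \<Rightarrow> i)"

definition trunc_ge ::
    "('k, 'o, 'm, 'z) tri_cat_scheme \<Rightarrow> 'o set \<times> 'o set \<Rightarrow> int \<Rightarrow> 'o \<Rightarrow> 'o" where
  "trunc_ge D t n X = (case trunc_triangle D t (n - 1) X of (A, B, i, p, h) \<Rightarrow> B)"

definition trunc_ge_proj ::
    "('k, 'o, 'm, 'z) tri_cat_scheme \<Rightarrow> 'o set \<times> 'o set \<Rightarrow> int \<Rightarrow> 'o \<Rightarrow> 'm" where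
  "trunc_ge_proj D t n X = (case trunc_triangle D t (n - 1) X of (A, B, i, p, h) \<Rightarrow> p)"

definition trunc_le_mor ::
    "('k, 'o, 'm, 'z) tri_cat_scheme \<Rightarrow> 'o set \<times> 'o set \<Rightarrow> int \<Rightarrow> 'o \<Rightarrow> 'o \<Rightarrow> 'm \<Rightarrow> 'm" where
  "trunc_le_mor D t n X Y f =
     (THE g. g \<in> hom_set D (trunc_le D t n X) (trunc_le D t n Y) \<and>
        trunc_le_incl D t n Y \<cdot>\<^bsub>D\<^esub> g = f \<cdot>\<^bsub>D\<^esub> trunc_le_incl D t n X)"

definition trunc_ge_mor ::
    "('k, 'o, 'm, 'z) tri_cat_scheme \<Rightarrow> 'o set \<times> 'o set \<Rightarrow> int \<Rightarrow> 'o \<Rightarrow> 'o \<Rightarrow> 'm \<Rightarrow> 'm" where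
  "trunc_ge_mor D t n X Y f =
     (THE g. g \<in> hom_set D (trunc_ge D t n X) (trunc_ge D t n Y) \<and>
        g \<cdot>\<^bsub>D\<^esub> trunc_ge_proj D t n X = trunc_ge_proj D t n Y \<cdot>\<^bsub>D\<^esub> f)"

definition H0 ::
    "('k, 'o, 'm, 'z) tri_cat_scheme \<Rightarrow> 'o set \<times> 'o set \<Rightarrow> 'o \<Rightarrow> 'o" where
  "H0 D t X = trunc_ge D t 0 (trunc_le D t 0 X)"

definition H0_mor ::
    "('k, 'o, 'm, 'z) tri_cat_scheme \<Rightarrow> 'o set \<times> 'o set \<Rightarrow> 'o \<Rightarrow> 'o \<Rightarrow> 'm \<Rightarrow> 'm" where
  "H0_mor D t X Y f =
     trunc_ge_mor D t 0 (trunc_le D t 0 X) (trunc_le D t 0 Y) (trunc_le_mor D t 0 X Y f)"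


section \<open>Silting collections and derived projectives\<close>

definition perp_pos :: "('k, 'o, 'm, 'z) tri_cat_scheme \<Rightarrow> 'o set \<Rightarrow> 'o set" where
  "perp_pos D S = {Y \<in> Obj D. \<forall>m>0. \<forall>X\<in>S. hom_vanishes D X (shO D m Y)}"

definition perp_neg :: "('k, 'o, 'm, 'z) tri_cat_scheme \<Rightarrow> 'o set \<Rightarrow> 'o set" where
  "perp_neg D S = {Y \<in> Obj D. \<forall>m<0. \<forall>X\<in>S. hom_vanishes D X (shO D m Y)}"

definition silting_t :: "('k, 'o, 'm, 'z) tri_cat_scheme \<Rightarrow> 'o set \<Rightarrow> 'o set \<times> 'o set" where
  "silting_t D S = (perp_pos D S, perp_neg D S)"

definition silting_collection ::
    "'k ring \<Rightarrow> ('k, 'o, 'm, 'z) tri_cat_scheme \<Rightarrow> 'o set \<Rightarrow> bool" where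
  "silting_collection K D S \<longleftrightarrow>
     (\<forall>X\<in>S. indecomposable D X) \<and>
     (\<forall>X\<in>S. \<forall>Y\<in>S. isomorphic D X Y \<longrightarrow> X = Y) \<and>
     krull_schmidt K (full_subcategory D (Kar D S)) \<and>
     t_structure D (silting_t D S)"

definition is_silting ::
    "'k ring \<Rightarrow> ('k, 'o, 'm, 'z) tri_cat_scheme \<Rightarrow> 'o set \<times> 'o set \<Rightarrow> bool" where
  "is_silting K D t \<longleftrightarrow> (\<exists>S. silting_collection K D S \<and> t = silting_t D S)"

definition derived_projective ::
    "('k, 'o, 'm, 'z) tri_cat_scheme \<Rightarrow> 'o set \<times> 'o set \<Rightarrow> 'o \<Rightarrow> bool" where
  "derived_projective D t P \<longleftrightarrow>
     P \<in> fst t \<and> (\<forall>X\<in>fst t. hom_vanishes D P (shO D 1 X))"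

definition derived_projective_cover ::
    "('k, 'o, 'm, 'z) tri_cat_scheme \<Rightarrow> 'o set \<times> 'o set \<Rightarrow> 'o \<Rightarrow> 'o \<Rightarrow> 'm \<Rightarrow> bool" where
  "derived_projective_cover D t P X \<pi> \<longleftrightarrow>
     X \<in> Obj D \<and> derived_projective D t P \<and> \<pi> \<in> hom_set D P X \<and>
     projective_cover (heart D t) (H0 D t P) (H0 D t X) (H0_mor D t P X \<pi>)"

definition has_derived_projectives ::
    "('k, 'o, 'm, 'z) tri_cat_scheme \<Rightarrow> 'o set \<times> 'o set \<Rightarrow> bool" where
  "has_derived_projectives D t \<longleftrightarrow>
     (\<forall>Q. projective_object (heart D t) Q \<longrightarrow>
        (\<exists>P. derived_projective D t P \<and> isomorphic (heart D t) (H0 D t P) Q))"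

definition enough_derived_projectives ::
    "('k, 'o, 'm, 'z) tri_cat_scheme \<Rightarrow> 'o set \<times> 'o set \<Rightarrow> bool" where
  "enough_derived_projectives D t \<longleftrightarrow>
     has_derived_projectives D t \<and> enough_projectives (heart D t)"

end

(* All four conditions are equivalent to the weaker "detection" condition: every simple object L
   of the heart receives a nonzero morphism from some derived projective P.

   A nonzero morphism to a simple L from an object in nonpositive degrees has its cone in degrees
   below 0, so morphisms from derived projectives lift along it. If P has local endomorphism ring
   and f : P -> L is nonzero, an endomorphism a with f a = f is invertible, because f kills 1 - a.
   Hence P is determined by L and determines L, Hom(P, L) is free of rank one over End(L), and f
   is a derived projective cover; Krull-Schmidt allows P to be chosen local.

   Detection implies t = silting_t P: for an object Y of the perpendicular class, the truncation
   of Y that should vanish receives no morphism from any shift of a derived projective. Its lowest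
   (or highest) cohomology object has a simple quotient unless it is zero, so it is zero by
   detection, and nondegeneracy finishes the argument. Conversely the members of a silting
   collection are derived projective, and a simple object L orthogonal to all of them would have
   L[-1] in nonpositive degrees, hence be zero. *)

theory Submission
  imports Defs
begin

section \<open>Linear categories\<close>

context linear_category
begin

definition arr :: "'m \<Rightarrow> 'o \<Rightarrow> 'o \<Rightarrow> bool" where
  "arr f X Y \<longleftrightarrow> X \<in> Obj C \<and> Y \<in> Obj C \<and> f \<in> hom_set C X Y"

lemma arr_objs: "arr f X Y \<Longrightarrow> X \<in> Obj C" "arr f X Y \<Longrightarrow> Y \<in> Obj C"
  by (auto simp: arr_def)

lemma hom_abelian_group: "X \<in> Obj C \<Longrightarrow> Y \<in> Obj C \<Longrightarrow> abelian_group (Hom C X Y)"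
  using hom_module by (auto simp: module_def)

lemma arr_zero: "X \<in> Obj C \<Longrightarrow> Y \<in> Obj C \<Longrightarrow> arr (zero_mor C X Y) X Y"
  unfolding arr_def using abelian_group.a_inv_closed hom_abelian_group
  by (simp add: abelian_group.axioms(1) abelian_monoid.zero_closed)

lemma arr_id: "X \<in> Obj C \<Longrightarrow> arr (Idn C X) X X"
  by (simp add: arr_def Idn_closed)

lemma arr_comp: "arr f X Y \<Longrightarrow> arr g Y Z \<Longrightarrow> arr (g \<cdot> f) X Z"
  by (auto simp: arr_def comp_closed)

lemma assoc: "arr f W X \<Longrightarrow> arr g X Y \<Longrightarrow> arr h Y Z \<Longrightarrow> (h \<cdot> g) \<cdot> f = h \<cdot> (g \<cdot> f)"
  by (auto simp: arr_def comp_assoc)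

lemma id_left: "arr f X Y \<Longrightarrow> Idn C Y \<cdot> f = f"
  by (auto simp: arr_def comp_Idn_left)

lemma id_right: "arr f X Y \<Longrightarrow> f \<cdot> Idn C X = f"
  by (auto simp: arr_def comp_Idn_right)

lemma arr_add: "arr f X Y \<Longrightarrow> arr g X Y \<Longrightarrow> arr (f \<oplus>\<^bsub>Hom C X Y\<^esub> g) X Y"
  unfolding arr_def using hom_abelian_group
  by (auto intro: abelian_monoid.a_closed abelian_group.axioms(1))

lemma arr_neg: "arr f X Y \<Longrightarrow> arr (\<ominus>\<^bsub>Hom C X Y\<^esub> f) X Y"
  unfolding arr_def using hom_abelian_group by (auto intro: abelian_group.a_inv_closed)

lemma add_comp:
  "arr f X Y \<Longrightarrow> arr g Y Z \<Longrightarrow> arr h Y Z \<Longrightarrow>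
    (g \<oplus>\<^bsub>Hom C Y Z\<^esub> h) \<cdot> f = g \<cdot> f \<oplus>\<^bsub>Hom C X Z\<^esub> h \<cdot> f"
  by (auto simp: arr_def comp_add_left)

lemma comp_add:
  "arr f X Y \<Longrightarrow> arr g X Y \<Longrightarrow> arr h Y Z \<Longrightarrow>
    h \<cdot> (f \<oplus>\<^bsub>Hom C X Y\<^esub> g) = h \<cdot> f \<oplus>\<^bsub>Hom C X Z\<^esub> h \<cdot> g"
  by (auto simp: arr_def comp_add_right)

lemma add_zero: "arr f X Y \<Longrightarrow> f \<oplus>\<^bsub>Hom C X Y\<^esub> zero_mor C X Y = f"
  "arr f X Y \<Longrightarrow> zero_mor C X Y \<oplus>\<^bsub>Hom C X Y\<^esub> f = f"
  unfolding arr_def using hom_abelian_group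
  by (auto intro!: abelian_monoid.r_zero abelian_monoid.l_zero abelian_group.axioms(1))

lemma add_neg: "arr f X Y \<Longrightarrow> f \<oplus>\<^bsub>Hom C X Y\<^esub> (\<ominus>\<^bsub>Hom C X Y\<^esub> f) = zero_mor C X Y"
  unfolding arr_def using hom_abelian_group by (auto intro!: abelian_group.r_neg)

lemma add_cancel:
  "arr f X Y \<Longrightarrow> arr g X Y \<Longrightarrow> arr h X Y \<Longrightarrow>
    f \<oplus>\<^bsub>Hom C X Y\<^esub> g = f \<oplus>\<^bsub>Hom C X Y\<^esub> h \<longleftrightarrow> g = h"
proof -
  assume *: "arr f X Y" "arr g X Y" "arr h X Y"
  interpret abelian_group "Hom C X Y" using * hom_abelian_group arr_objs by blast
  show ?thesis using * by (auto simp: arr_def)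
qed

lemma add_assoc:
  "arr f X Y \<Longrightarrow> arr g X Y \<Longrightarrow> arr h X Y \<Longrightarrow>
    (f \<oplus>\<^bsub>Hom C X Y\<^esub> g) \<oplus>\<^bsub>Hom C X Y\<^esub> h = f \<oplus>\<^bsub>Hom C X Y\<^esub> (g \<oplus>\<^bsub>Hom C X Y\<^esub> h)"
  unfolding arr_def using hom_abelian_group
  by (auto intro!: abelian_monoid.a_assoc abelian_group.axioms(1))

lemma add_comm:
  "arr f X Y \<Longrightarrow> arr g X Y \<Longrightarrow> f \<oplus>\<^bsub>Hom C X Y\<^esub> g = g \<oplus>\<^bsub>Hom C X Y\<^esub> f"
  unfolding arr_def using hom_abelian_group
  by (auto intro!: abelian_monoid.a_comm abelian_group.axioms(1))

lemma neg_neg: "arr f X Y \<Longrightarrow> \<ominus>\<^bsub>Hom C X Y\<^esub> (\<ominus>\<^bsub>Hom C X Y\<^esub> f) = f"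
  unfolding arr_def using hom_abelian_group by (auto intro!: abelian_group.minus_minus)

lemma neg_zero: "X \<in> Obj C \<Longrightarrow> Y \<in> Obj C \<Longrightarrow> \<ominus>\<^bsub>Hom C X Y\<^esub> (zero_mor C X Y) = zero_mor C X Y"
  by (metis add_neg add_zero(2) arr_neg arr_zero)

lemma add_idem_zero: "arr f X Y \<Longrightarrow> f \<oplus>\<^bsub>Hom C X Y\<^esub> f = f \<Longrightarrow> f = zero_mor C X Y"
  by (metis add_cancel add_zero(1) arr_objs arr_zero)

lemma comp_zero:
  assumes "arr g Y Z" "X \<in> Obj C"
  shows "g \<cdot> zero_mor C X Y = zero_mor C X Z"
proof (rule add_idem_zero)
  have z: "arr (zero_mor C X Y) X Y" using assms arr_zero arr_objs by blast
  show "arr (g \<cdot> zero_mor C X Y) X Z" using z assms arr_comp by blast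
  show "(g \<cdot> zero_mor C X Y) \<oplus>\<^bsub>Hom C X Z\<^esub> (g \<cdot> zero_mor C X Y) = g \<cdot> zero_mor C X Y"
    using comp_add[OF z z assms(1)] add_zero(1)[OF z] by simp
qed

lemma zero_comp:
  assumes "arr f X Y" "Z \<in> Obj C"
  shows "zero_mor C Y Z \<cdot> f = zero_mor C X Z"
proof (rule add_idem_zero)
  have z: "arr (zero_mor C Y Z) Y Z" using assms arr_zero arr_objs by blast
  show "arr (zero_mor C Y Z \<cdot> f) X Z" using z assms arr_comp by blast
  show "(zero_mor C Y Z \<cdot> f) \<oplus>\<^bsub>Hom C X Z\<^esub> (zero_mor C Y Z \<cdot> f) = zero_mor C Y Z \<cdot> f"
    using add_comp[OF assms(1) z z] add_zero(1)[OF z] by simp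
qed

lemma neg_unique: "arr f X Y \<Longrightarrow> arr g X Y \<Longrightarrow> f \<oplus>\<^bsub>Hom C X Y\<^esub> g = zero_mor C X Y \<Longrightarrow> g = \<ominus>\<^bsub>Hom C X Y\<^esub> f"
  by (metis add_cancel add_neg arr_neg)

lemma neg_comp:
  assumes "arr f X Y" "arr g Y Z"
  shows "(\<ominus>\<^bsub>Hom C Y Z\<^esub> g) \<cdot> f = \<ominus>\<^bsub>Hom C X Z\<^esub> (g \<cdot> f)"
  using add_comp[OF assms arr_neg[OF assms(2)]] assms
  by (intro neg_unique) (auto simp: add_neg zero_comp arr_objs intro: arr_comp arr_neg)

lemma comp_neg:
  assumes "arr f X Y" "arr g Y Z"
  shows "g \<cdot> (\<ominus>\<^bsub>Hom C X Y\<^esub> f) = \<ominus>\<^bsub>Hom C X Z\<^esub> (g \<cdot> f)"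
  using comp_add[OF assms(1) arr_neg[OF assms(1)] assms(2)] assms
  by (intro neg_unique) (auto simp: add_neg comp_zero arr_objs intro: arr_comp arr_neg)

lemma eq_of_diff_zero:
  assumes "arr f X Y" "arr g X Y" "f \<oplus>\<^bsub>Hom C X Y\<^esub> (\<ominus>\<^bsub>Hom C X Y\<^esub> g) = zero_mor C X Y"
  shows "f = g"
  by (metis assms add_cancel add_comm add_neg arr_neg)

lemma epi_of_zero:
  assumes "arr f X Y" "arr g Y Z" "arr h Y Z" "g \<cdot> f = h \<cdot> f"
    and z: "\<And>k. arr k Y Z \<Longrightarrow> k \<cdot> f = zero_mor C X Z \<Longrightarrow> k = zero_mor C Y Z"
  shows "g = h"
proof (rule eq_of_diff_zero[OF assms(2,3)], rule z)
  show "arr (g \<oplus>\<^bsub>Hom C Y Z\<^esub> (\<ominus>\<^bsub>Hom C Y Z\<^esub> h)) Y Z" using assms arr_add arr_neg by blast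
  show "(g \<oplus>\<^bsub>Hom C Y Z\<^esub> (\<ominus>\<^bsub>Hom C Y Z\<^esub> h)) \<cdot> f = zero_mor C X Z"
    using assms by (simp add: add_comp[OF assms(1,2) arr_neg[OF assms(3)]] neg_comp
        add_neg[OF arr_comp[OF assms(1,3)]])
qed

lemma mono_of_zero:
  assumes "arr f X Y" "arr g W X" "arr h W X" "f \<cdot> g = f \<cdot> h"
    and z: "\<And>k. arr k W X \<Longrightarrow> f \<cdot> k = zero_mor C W Y \<Longrightarrow> k = zero_mor C W X"
  shows "g = h"
proof (rule eq_of_diff_zero[OF assms(2,3)], rule z)
  show "arr (g \<oplus>\<^bsub>Hom C W X\<^esub> (\<ominus>\<^bsub>Hom C W X\<^esub> h)) W X" using assms arr_add arr_neg by blast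
  show "f \<cdot> (g \<oplus>\<^bsub>Hom C W X\<^esub> (\<ominus>\<^bsub>Hom C W X\<^esub> h)) = zero_mor C W Y"
    using assms by (simp add: comp_add[OF assms(2) arr_neg[OF assms(3)] assms(1)] comp_neg
        add_neg[OF arr_comp[OF assms(3,1)]])
qed

lemma vanishD: "hom_vanishes C X Y \<Longrightarrow> arr f X Y \<Longrightarrow> f = zero_mor C X Y"
  by (auto simp: hom_vanishes_def arr_def)

lemma vanishI:
  "X \<in> Obj C \<Longrightarrow> Y \<in> Obj C \<Longrightarrow> (\<And>f. arr f X Y \<Longrightarrow> f = zero_mor C X Y) \<Longrightarrow> hom_vanishes C X Y"
  unfolding hom_vanishes_def using arr_zero[of X Y] unfolding arr_def by blast

lemma zero_objectI:
  assumes "X \<in> Obj C" "Idn C X = zero_mor C X X"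
  shows "zero_object C X"
  unfolding zero_object_def
proof (intro conjI ballI assms(1))
  fix Y assume Y: "Y \<in> Obj C"
  show "hom_vanishes C X Y"
    using assms Y by (intro vanishI) (metis id_right comp_zero)+
  show "hom_vanishes C Y X"
    using assms Y by (intro vanishI) (metis id_left zero_comp)+
qed

lemma zero_object_vanish:
  "zero_object C X \<Longrightarrow> Y \<in> Obj C \<Longrightarrow> hom_vanishes C X Y"
  "zero_object C X \<Longrightarrow> Y \<in> Obj C \<Longrightarrow> hom_vanishes C Y X"
  by (auto simp: zero_object_def)

lemma zero_object_id: "zero_object C X \<Longrightarrow> Idn C X = zero_mor C X X"
  using arr_id vanishD by (auto simp: zero_object_def)

lemma iso_iff: "is_iso C X Y f \<longleftrightarrow> arr f X Y \<and> (\<exists>g. arr g Y X \<and> g \<cdot> f = Idn C X \<and> f \<cdot> g = Idn C Y)"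
  by (auto simp: is_iso_def arr_def)

lemma iso_inv_unique:
  assumes "arr f X Y" "arr g Y X" "arr h Y X" "g \<cdot> f = Idn C X" "f \<cdot> h = Idn C Y"
  shows "g = h"
  using assoc[OF assms(3,1,2)] assms(4,5) id_left[OF assms(3)] id_right[OF assms(2)] by simp

lemma isoI_sections:
  assumes "arr f X Y" "arr g Y X" "arr h Y X" "g \<cdot> f = Idn C X" "f \<cdot> h = Idn C Y"
  shows "is_iso C X Y f"
  using iso_inv_unique[OF assms] assms by (auto simp: iso_iff)

lemma isomorphic_refl: "X \<in> Obj C \<Longrightarrow> isomorphic C X X"
  unfolding isomorphic_def iso_iff using arr_id id_left by blast

lemma isomorphic_sym: "isomorphic C X Y \<Longrightarrow> isomorphic C Y X"
  unfolding isomorphic_def iso_iff by blast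

lemma comp_cancel:
  "arr f W X \<Longrightarrow> arr g X Y \<Longrightarrow> arr h Y X \<Longrightarrow> h \<cdot> g = Idn C X \<Longrightarrow> h \<cdot> (g \<cdot> f) = f"
  using assoc[of f W X g Y h X] id_left[of f W X] by simp

lemma sandwich:
  assumes "arr f W X" "arr g X Y" "arr g' Y X" "arr f' X Z" "g' \<cdot> g = Idn C X"
  shows "(f' \<cdot> g') \<cdot> (g \<cdot> f) = f' \<cdot> f"
  by (simp add: assoc[OF arr_comp[OF assms(1,2)] assms(3,4)] comp_cancel[OF assms(1-3,5)])

lemma isomorphic_objs: "isomorphic C X Y \<Longrightarrow> X \<in> Obj C" "isomorphic C X Y \<Longrightarrow> Y \<in> Obj C"
  by (auto simp: isomorphic_def is_iso_def)

definition retract :: "'o \<Rightarrow> 'o \<Rightarrow> bool" where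
  "retract X Y \<longleftrightarrow> (\<exists>i r. arr i X Y \<and> arr r Y X \<and> r \<cdot> i = Idn C X)"

lemma retract_trans:
  assumes "retract X Y" "retract Y Z"
  shows "retract X Z"
proof -
  obtain i r where f: "arr i X Y" "arr r Y X" "r \<cdot> i = Idn C X"
    using assms(1) by (auto simp: retract_def)
  obtain i' r' where g: "arr i' Y Z" "arr r' Z Y" "r' \<cdot> i' = Idn C Y"
    using assms(2) by (auto simp: retract_def)
  have "(r \<cdot> r') \<cdot> (i' \<cdot> i) = Idn C X"
    using sandwich[OF f(1) g(1,2) f(2)] f g by simp
  then show ?thesis unfolding retract_def using f g arr_comp by blast
qed

lemma retract_refl: "X \<in> Obj C \<Longrightarrow> retract X X"
  unfolding retract_def using arr_id id_left by blast

lemma retract_vanish: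
  assumes "retract X Y"
  shows "hom_vanishes C Y Z \<Longrightarrow> Z \<in> Obj C \<Longrightarrow> hom_vanishes C X Z"
    and "hom_vanishes C Z Y \<Longrightarrow> Z \<in> Obj C \<Longrightarrow> hom_vanishes C Z X"
proof -
  obtain i r where f: "arr i X Y" "arr r Y X" "r \<cdot> i = Idn C X"
    using assms by (auto simp: retract_def)
  show "hom_vanishes C X Z" if "hom_vanishes C Y Z" "Z \<in> Obj C"
  proof (rule vanishI)
    fix u assume u: "arr u X Z"
    have "u \<cdot> r = zero_mor C Y Z" using that u f arr_comp vanishD by blast
    then show "u = zero_mor C X Z" using assoc[OF f(1,2) u] id_right[OF u] zero_comp[OF f(1) that(2)] f(3) by simp
  qed (use f that arr_objs in auto)
  show "hom_vanishes C Z X" if "hom_vanishes C Z Y" "Z \<in> Obj C"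
  proof (rule vanishI)
    fix u assume u: "arr u Z X"
    have "i \<cdot> u = zero_mor C Z Y" using that u f arr_comp vanishD by blast
    then show "u = zero_mor C Z X" using assoc[OF u f(1,2)] id_left[OF u] comp_zero[OF f(2) that(2)] f(3) by simp
  qed (use f that arr_objs in auto)
qed

lemma iso_retract: "isomorphic C X Y \<Longrightarrow> retract X Y"
  by (auto simp: isomorphic_def iso_iff retract_def)

lemma coproduct_iff:
  "is_coproduct C I X Y \<iota> \<longleftrightarrow> Y \<in> Obj C \<and> (\<forall>j\<in>I. arr (\<iota> j) (X j) Y) \<and>
    (\<forall>Z f. Z \<in> Obj C \<longrightarrow> (\<forall>j\<in>I. arr (f j) (X j) Z) \<longrightarrow>
       (\<exists>!g. arr g Y Z \<and> (\<forall>j\<in>I. g \<cdot> \<iota> j = f j)))"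
  unfolding is_coproduct_def arr_def by (safe; simp; metis)

lemma coproductI:
  assumes "Y \<in> Obj C" "\<And>j. j \<in> I \<Longrightarrow> arr (\<iota> j) (X j) Y"
    and "\<And>Z f. Z \<in> Obj C \<Longrightarrow> (\<And>j. j \<in> I \<Longrightarrow> arr (f j) (X j) Z) \<Longrightarrow> \<exists>g. arr g Y Z \<and> (\<forall>j\<in>I. g \<cdot> \<iota> j = f j)"
    and "\<And>Z g h. arr g Y Z \<Longrightarrow> arr h Y Z \<Longrightarrow> (\<And>j. j \<in> I \<Longrightarrow> g \<cdot> \<iota> j = h \<cdot> \<iota> j) \<Longrightarrow> g = h"
  shows "is_coproduct C I X Y \<iota>"
  unfolding coproduct_iff
proof (intro conjI ballI allI impI)
  fix Z f assume *: "Z \<in> Obj C" "\<forall>j\<in>I. arr (f j) (X j) Z"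
  then obtain g where g: "arr g Y Z" "\<forall>j\<in>I. g \<cdot> \<iota> j = f j" using assms(3)[of Z f] by auto
  show "\<exists>!g. arr g Y Z \<and> (\<forall>j\<in>I. g \<cdot> \<iota> j = f j)"
  proof (rule ex1I[of _ g])
    show "arr g Y Z \<and> (\<forall>j\<in>I. g \<cdot> \<iota> j = f j)" using g by blast
    show "h = g" if "arr h Y Z \<and> (\<forall>j\<in>I. h \<cdot> \<iota> j = f j)" for h
      by (rule assms(4)) (use that g in auto)
  qed
qed (use assms in auto)

lemma coproduct_arr: "is_coproduct C I X Y \<iota> \<Longrightarrow> j \<in> I \<Longrightarrow> arr (\<iota> j) (X j) Y"
  by (auto simp: coproduct_iff)

lemma coproduct_map:
  assumes "is_coproduct C I X Y \<iota>" "Z \<in> Obj C" "\<And>j. j \<in> I \<Longrightarrow> arr (f j) (X j) Z"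
  obtains g where "arr g Y Z" "\<And>j. j \<in> I \<Longrightarrow> g \<cdot> \<iota> j = f j"
  using assms unfolding coproduct_iff by metis

lemma coproduct_eq:
  assumes "is_coproduct C I X Y \<iota>" "arr g Y Z" "arr h Y Z" "\<And>j. j \<in> I \<Longrightarrow> g \<cdot> \<iota> j = h \<cdot> \<iota> j"
  shows "g = h"
proof -
  have "\<exists>!k. arr k Y Z \<and> (\<forall>j\<in>I. k \<cdot> \<iota> j = g \<cdot> \<iota> j)"
  proof -
    have "\<forall>j\<in>I. arr (g \<cdot> \<iota> j) (X j) Z" using arr_comp[OF coproduct_arr[OF assms(1)] assms(2)] by blast
    then show ?thesis
      using assms(1)[unfolded coproduct_iff, THEN conjunct2, THEN conjunct2, rule_format,
          OF arr_objs(2)[OF assms(2)], of "\<lambda>j. g \<cdot> \<iota> j"] by simp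
  qed
  then obtain k where "\<forall>u. arr u Y Z \<and> (\<forall>j\<in>I. u \<cdot> \<iota> j = g \<cdot> \<iota> j) \<longrightarrow> u = k"
    by (elim ex1E) (rule that)
  from this[rule_format, of g] this[rule_format, of h] assms(2-4) show ?thesis by simp
qed

lemma coproduct_retract:
  assumes "is_coproduct C I X Y \<iota>" "j \<in> I"
  obtains p where "arr p Y (X j)" "p \<cdot> \<iota> j = Idn C (X j)"
proof -
  have o: "k \<in> I \<Longrightarrow> X k \<in> Obj C" for k by (rule arr_objs(1)[OF coproduct_arr[OF assms(1)]])
  obtain g where "arr g Y (X j)"
    "\<And>k. k \<in> I \<Longrightarrow> g \<cdot> \<iota> k = (if k = j then Idn C (X j) else zero_mor C (X k) (X j))"
    by (rule coproduct_map[OF assms(1), of "X j"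
          "\<lambda>k. if k = j then Idn C (X j) else zero_mor C (X k) (X j)"])
       (use o assms(2) arr_id arr_zero in auto)
  then show ?thesis using that assms(2) by auto
qed

lemma coproduct_component_retract:
  "is_coproduct C I X Y \<iota> \<Longrightarrow> j \<in> I \<Longrightarrow> retract (X j) Y"
  unfolding retract_def by (meson coproduct_arr coproduct_retract)

lemma coproduct_vanish:
  assumes "is_coproduct C I X Y \<iota>" "Z \<in> Obj C" "\<And>j. j \<in> I \<Longrightarrow> hom_vanishes C (X j) Z"
  shows "hom_vanishes C Y Z"
proof (rule vanishI)
  show Y: "Y \<in> Obj C" using assms by (simp add: coproduct_iff)
  fix f assume f: "arr f Y Z"
  show "f = zero_mor C Y Z"
  proof (rule coproduct_eq[OF assms(1) f])
    show "arr (zero_mor C Y Z) Y Z" using Y assms arr_zero by blast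
    fix j assume j: "j \<in> I"
    then have "arr (\<iota> j) (X j) Y" using coproduct_arr[OF assms(1)] by blast
    then show "f \<cdot> \<iota> j = zero_mor C Y Z \<cdot> \<iota> j"
      using vanishD[OF assms(3)[OF j]] f arr_comp zero_comp assms(2) by metis
  qed
qed (rule assms)

lemma direct_sum_iff:
  "is_direct_sum C A B Y \<longleftrightarrow> (\<exists>i j. arr i A Y \<and> arr j B Y \<and>
     (\<forall>Z f g. arr f A Z \<longrightarrow> arr g B Z \<longrightarrow> (\<exists>h. arr h Y Z \<and> h \<cdot> i = f \<and> h \<cdot> j = g)) \<and>
     (\<forall>Z g h. arr g Y Z \<longrightarrow> arr h Y Z \<longrightarrow> g \<cdot> i = h \<cdot> i \<longrightarrow> g \<cdot> j = h \<cdot> j \<longrightarrow> g = h))"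
  (is "?L \<longleftrightarrow> ?R")
proof
  assume ?L
  then obtain \<iota> where c: "is_coproduct C (UNIV :: bool set) (case_bool A B) Y \<iota>"
    by (auto simp: is_direct_sum_def)
  have "\<exists>h. arr h Y Z \<and> h \<cdot> \<iota> True = f \<and> h \<cdot> \<iota> False = g" if fg: "arr f A Z" "arr g B Z" for Z f g
  proof -
    obtain h where "arr h Y Z" "\<And>j. j \<in> UNIV \<Longrightarrow> h \<cdot> \<iota> j = (case_bool f g) j"
      by (rule coproduct_map[OF c, of Z "case_bool f g"]) (use fg arr_objs in \<open>auto split: bool.split\<close>)
    then show ?thesis by (metis (full_types) UNIV_I bool.case)
  qed
  moreover have "g = h" if "arr g Y Z" "arr h Y Z" "g \<cdot> \<iota> True = h \<cdot> \<iota> True" "g \<cdot> \<iota> False = h \<cdot> \<iota> False" for Z g h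
    by (rule coproduct_eq[OF c that(1,2)]) (use that in \<open>metis (full_types)\<close>)
  moreover have "arr (\<iota> True) A Y" "arr (\<iota> False) B Y"
    using coproduct_arr[OF c, of True] coproduct_arr[OF c, of False] by auto
  ultimately show ?R by blast
next
  assume ?R
  then obtain i j where a: "arr i A Y" "arr j B Y"
    and m: "\<And>Z f g. arr f A Z \<Longrightarrow> arr g B Z \<Longrightarrow> \<exists>h. arr h Y Z \<and> h \<cdot> i = f \<and> h \<cdot> j = g"
    and e: "\<And>Z g h. arr g Y Z \<Longrightarrow> arr h Y Z \<Longrightarrow> g \<cdot> i = h \<cdot> i \<Longrightarrow> g \<cdot> j = h \<cdot> j \<Longrightarrow> g = h"
    by blast
  have "is_coproduct C (UNIV :: bool set) (case_bool A B) Y (case_bool i j)"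
  proof (rule coproductI)
    show "Y \<in> Obj C" using a arr_objs by blast
    show "arr (case_bool i j k) (case_bool A B k) Y" for k using a by (cases k) auto
    fix Z f assume "\<And>k. k \<in> (UNIV :: bool set) \<Longrightarrow> arr (f k) (case_bool A B k) Z"
    from this[of True] this[of False] have "arr (f True) A Z" "arr (f False) B Z" by auto
    from m[OF this] show "\<exists>g. arr g Y Z \<and> (\<forall>k\<in>UNIV. g \<cdot> case_bool i j k = f k)"
      by (metis (full_types) bool.case)
  next
    fix Z g h assume "arr g Y Z" "arr h Y Z"
      "\<And>k. k \<in> (UNIV :: bool set) \<Longrightarrow> g \<cdot> case_bool i j k = h \<cdot> case_bool i j k"
    from this(1,2) this(3)[of True] this(3)[of False] show "g = h" using e by auto
  qed
  then show ?L unfolding is_direct_sum_def by blast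
qed

lemma direct_sum_retracts:
  assumes "is_direct_sum C A B Y"
  shows "retract A Y" "retract B Y"
proof -
  obtain \<iota> where c: "is_coproduct C (UNIV :: bool set) (case_bool A B) Y \<iota>"
    using assms by (auto simp: is_direct_sum_def)
  show "retract A Y" "retract B Y"
    using coproduct_component_retract[OF c, of True] coproduct_component_retract[OF c, of False] by auto
qed

text \<open>The endomorphism \<open>Idn P - a\<close> kills \<open>f\<close>, so it cannot be a unit.\<close>

lemma local_endo_iso:
  assumes loc: "local_ring (endo_ring C P)" and f: "arr f P Y" "f \<noteq> zero_mor C P Y"
    and a: "arr a P P" "f \<cdot> a = f"
  shows "is_iso C P P a"
proof -
  let ?R = "endo_ring C P"
  let ?b = "Idn C P \<oplus>\<^bsub>Hom C P P\<^esub> (\<ominus>\<^bsub>Hom C P P\<^esub> a)"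
  have P: "P \<in> Obj C" using f arr_objs by blast
  have id: "arr (Idn C P) P P" using P arr_id by blast
  have b: "arr ?b P P" using id a arr_add arr_neg by blast
  have U: "c \<in> Units ?R \<longleftrightarrow> is_iso C P P c" for c
    using P by (simp add: Units_def iso_iff endo_ring_def arr_def Bex_def conj_ac)
  have ab: "a \<oplus>\<^bsub>Hom C P P\<^esub> ?b = Idn C P"
    unfolding add_comm[OF id arr_neg[OF a(1)]] add_assoc[OF a(1) arr_neg[OF a(1)] id, symmetric]
      add_neg[OF a(1)] by (rule add_zero(2)[OF id])
  have "Idn C P \<in> Units ?R" unfolding U iso_iff using id id_left by blast
  then have "a \<in> Units ?R \<or> ?b \<in> Units ?R"
    using loc[unfolded local_ring_def, THEN conjunct2, THEN conjunct2, rule_format, of a ?b] ab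
      a(1)[unfolded arr_def] b[unfolded arr_def]
    unfolding endo_ring_def by (simp only: partial_object.select_convs ring_record_simps) blast
  moreover have "\<not> is_iso C P P ?b"
  proof
    assume "is_iso C P P ?b"
    then obtain c where c: "arr c P P" "?b \<cdot> c = Idn C P" by (auto simp: iso_iff)
    have "f \<cdot> ?b = zero_mor C P Y"
      using comp_add[OF id arr_neg[OF a(1)] f(1)] comp_neg[OF a(1) f(1)] a id_right[OF f(1)]
        add_neg[OF f(1)] by simp
    then have "f = zero_mor C P Y"
      using assoc[OF c(1) b f(1)] c(2) zero_comp[OF c(1) arr_objs(2)[OF f(1)]] id_right[OF f(1)] by simp
    then show False using f by blast
  qed
  ultimately show ?thesis unfolding U by blast
qed

lemma local_nonzero:
  assumes "local_ring (endo_ring C P)" "P \<in> Obj C"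
  shows "\<not> zero_object C P"
  using assms zero_object_id by (auto simp: local_ring_def endo_ring_def)

text \<open>The only consequence of locality of the endomorphism ring that is needed; unlike locality
  itself it is evidently invariant under isomorphism of objects.\<close>

definition loc :: "'o \<Rightarrow> bool" where
  "loc P \<longleftrightarrow> (\<forall>Y f a. arr f P Y \<longrightarrow> f \<noteq> zero_mor C P Y \<longrightarrow> arr a P P \<longrightarrow> f \<cdot> a = f \<longrightarrow> is_iso C P P a)"

lemma locD:
  "loc P \<Longrightarrow> arr f P Y \<Longrightarrow> f \<noteq> zero_mor C P Y \<Longrightarrow> arr a P P \<Longrightarrow> f \<cdot> a = f \<Longrightarrow> is_iso C P P a"
  unfolding loc_def by blast

lemma local_ring_loc: "local_ring (endo_ring C P) \<Longrightarrow> loc P"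
  unfolding loc_def using local_endo_iso by blast

lemma loc_iso:
  assumes "isomorphic C P Q" "loc P"
  shows "loc Q"
  unfolding loc_def
proof (intro allI impI)
  fix Y f a assume f: "arr f Q Y" "f \<noteq> zero_mor C Q Y" and a: "arr a Q Q" "f \<cdot> a = f"
  obtain u v where u: "arr u P Q" "arr v Q P" "v \<cdot> u = Idn C P" "u \<cdot> v = Idn C Q"
    using assms(1) unfolding isomorphic_def iso_iff by blast
  have fu: "arr (f \<cdot> u) P Y" and vau: "arr (v \<cdot> (a \<cdot> u)) P P"
    using arr_comp[OF u(1) f(1)] arr_comp[OF arr_comp[OF u(1) a(1)] u(2)] by auto
  have au: "arr (a \<cdot> u) P Q" and fua: "arr (v \<cdot> a) Q P" using arr_comp[OF u(1) a(1)] arr_comp[OF a(1) u(2)] by auto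
  have "f \<cdot> u \<noteq> zero_mor C P Y"
  proof
    assume z: "f \<cdot> u = zero_mor C P Y"
    have "f = f \<cdot> u \<cdot> v" using assoc[OF u(2,1) f(1)] u(4) id_right[OF f(1)] by simp
    then show False using z zero_comp[OF u(2) arr_objs(2)[OF f(1)]] f(2) by simp
  qed
  moreover have "f \<cdot> u \<cdot> (v \<cdot> (a \<cdot> u)) = f \<cdot> u"
    using sandwich[OF au u(2) u(1) f(1) u(4)] assoc[OF u(1) a(1) f(1)] a(2) by simp
  ultimately obtain w where w: "arr w P P" "w \<cdot> (v \<cdot> (a \<cdot> u)) = Idn C P" "v \<cdot> (a \<cdot> u) \<cdot> w = Idn C P"
    using locD[OF assms(2) fu _ vau] unfolding iso_iff by blast
  have wv: "arr (w \<cdot> v) Q P" and uw: "arr (u \<cdot> w) P Q"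
    using arr_comp[OF u(2) w(1)] arr_comp[OF w(1) u(1)] by auto
  have "u \<cdot> (w \<cdot> v) \<cdot> a = Idn C Q"
  proof -
    have "w \<cdot> v \<cdot> a \<cdot> u = Idn C P"
      using assoc[OF u(1) a(1) wv] assoc[OF au u(2) w(1)] w(2) by simp
    then have "w \<cdot> v \<cdot> a = v"
      using assoc[OF u(2,1) arr_comp[OF a(1) wv]] u(4) id_right[OF arr_comp[OF a(1) wv]] id_left[OF u(2)] by simp
    then show ?thesis using assoc[OF a(1) wv u(1)] u(4) by simp
  qed
  moreover have "a \<cdot> (u \<cdot> w \<cdot> v) = Idn C Q"
  proof -
    have "v \<cdot> (a \<cdot> (u \<cdot> w)) = Idn C P"
      using assoc[OF w(1) au u(2)] assoc[OF w(1) u(1) a(1)] w(3) by simp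
    then have "a \<cdot> (u \<cdot> w) = u"
      using assoc[OF arr_comp[OF uw a(1)] u(2,1)] u(4) id_left[OF arr_comp[OF uw a(1)]] id_right[OF u(1)] by simp
    then show ?thesis using assoc[OF u(2) uw a(1)] u(4) by simp
  qed
  ultimately show "is_iso C Q Q a"
    using isoI_sections[OF a(1) arr_comp[OF wv u(1)] arr_comp[OF u(2) uw]] by blast
qed

lemma loc_indecomposable:
  assumes loc: "loc P" and P: "P \<in> Obj C" "\<not> zero_object C P"
  shows "indecomposable C P"
  unfolding indecomposable_def
proof (intro conjI allI impI P)
  fix A B assume "is_direct_sum C A B P"
  then obtain i j where a: "arr i A P" "arr j B P"
    and m: "\<And>Z f g. arr f A Z \<Longrightarrow> arr g B Z \<Longrightarrow> \<exists>h. arr h P Z \<and> h \<cdot> i = f \<and> h \<cdot> j = g"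
    and e: "\<And>Z g h. arr g P Z \<Longrightarrow> arr h P Z \<Longrightarrow> g \<cdot> i = h \<cdot> i \<Longrightarrow> g \<cdot> j = h \<cdot> j \<Longrightarrow> g = h"
    unfolding direct_sum_iff by blast
  have AB: "A \<in> Obj C" "B \<in> Obj C" using a arr_objs by auto
  obtain p where p: "arr p P A" "p \<cdot> i = Idn C A" "p \<cdot> j = zero_mor C B A"
    using m[OF arr_id arr_zero] AB by blast
  show "zero_object C A \<or> zero_object C B"
  proof (cases "p = zero_mor C P A")
    case True
    then have "Idn C A = zero_mor C A A" using p a AB zero_comp by metis
    then show ?thesis using AB zero_objectI by blast
  next
    case False
    have ip: "arr (i \<cdot> p) P P" using p a arr_comp by blast
    have "p \<cdot> (i \<cdot> p) = p" using assoc[OF p(1) a(1) p(1)] id_left[OF p(1)] p(2) by simp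
    from locD[OF loc p(1) False ip this]
    obtain w where w: "arr w P P" "w \<cdot> (i \<cdot> p) = Idn C P" by (auto simp: iso_iff)
    have "j = (w \<cdot> (i \<cdot> p)) \<cdot> j" using w(2) id_left[OF a(2)] by simp
    also have "\<dots> = w \<cdot> (i \<cdot> (p \<cdot> j))"
      using assoc[OF a(2) ip w(1)] assoc[OF a(2) p(1) a(1)] by simp
    also have "\<dots> = zero_mor C B P"
      using p(3) comp_zero[OF a(1) AB(2)] comp_zero[OF w(1) AB(2)] by simp
    finally have j0: "j = zero_mor C B P" .
    obtain q where q: "arr q P B" "q \<cdot> j = Idn C B"
      using m[OF arr_zero arr_id] AB by blast
    then have "Idn C B = zero_mor C B B" using j0 AB comp_zero by metis
    then show ?thesis using AB zero_objectI by blast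
  qed
qed

lemma coproduct_cong:
  assumes "\<And>j. j \<in> I \<Longrightarrow> X j = X' j"
  shows "is_coproduct C I X Y \<iota> \<longleftrightarrow> is_coproduct C I X' Y \<iota>"
  using assms unfolding is_coproduct_def by (simp cong: ball_cong)

lemma coproduct_empty:
  assumes "zero_object C Z"
  shows "is_coproduct C {} X Z \<iota>"
proof (rule coproductI)
  show Z: "Z \<in> Obj C" using assms by (simp add: zero_object_def)
  show "\<exists>g. arr g Z W \<and> (\<forall>j\<in>{}. g \<cdot> \<iota> j = f j)" if "W \<in> Obj C" for W f
    using arr_zero[OF Z that] by blast
  show "g = h" if "arr g Z W" "arr h Z W" for W g h
    using vanishD[OF zero_object_vanish(1)[OF assms arr_objs(2)[OF that(1)]]] that by metis
qed auto

lemma coproduct_append: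
  fixes m n :: nat
  assumes c: "is_coproduct C {..<m} X Y \<iota>" and c': "is_coproduct C {..<n} X' Y' \<iota>'"
    and s: "is_direct_sum C Y Y' W"
  obtains \<kappa> where "is_coproduct C {..<m + n} (\<lambda>j. if j < m then X j else X' (j - m)) W \<kappa>"
proof -
  obtain i j where a: "arr i Y W" "arr j Y' W"
    and ex: "\<And>Z f g. arr f Y Z \<Longrightarrow> arr g Y' Z \<Longrightarrow> \<exists>h. arr h W Z \<and> h \<cdot> i = f \<and> h \<cdot> j = g"
    and un: "\<And>Z g h. arr g W Z \<Longrightarrow> arr h W Z \<Longrightarrow> g \<cdot> i = h \<cdot> i \<Longrightarrow> g \<cdot> j = h \<cdot> j \<Longrightarrow> g = h"
    using s unfolding direct_sum_iff by blast
  let ?X = "\<lambda>j. if j < m then X j else X' (j - m)"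
  let ?k = "\<lambda>k. if k < m then i \<cdot> \<iota> k else j \<cdot> \<iota>' (k - m)"
  have 1: "arr (\<iota> k) (X k) Y" if "k < m" for k using coproduct_arr[OF c] that by simp
  have 2: "arr (\<iota>' k) (X' k) Y'" if "k < n" for k using coproduct_arr[OF c'] that by simp
  have "is_coproduct C {..<m + n} ?X W ?k"
  proof (rule coproductI)
    show "W \<in> Obj C" using a arr_objs by blast
    show "arr (?k k) (?X k) W" if "k \<in> {..<m + n}" for k
    proof (cases "k < m")
      case False
      then have "k - m < n" using that by auto
      then show ?thesis using False arr_comp[OF 2 a(2)] by simp
    qed (use arr_comp[OF 1 a(1), of k] in simp)
  next
    fix Z f assume Z: "Z \<in> Obj C" and f: "\<And>k. k \<in> {..<m + n} \<Longrightarrow> arr (f k) (?X k) Z"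
    have f1: "arr (f k) (X k) Z" if "k \<in> {..<m}" for k using f[of k] that by simp
    have f2: "arr (f (m + k)) (X' k) Z" if "k \<in> {..<n}" for k using f[of "m + k"] that by simp
    obtain g1 where g1: "arr g1 Y Z" "\<And>k. k \<in> {..<m} \<Longrightarrow> g1 \<cdot> \<iota> k = f k"
      using coproduct_map[OF c Z f1] by metis
    obtain g2 where g2: "arr g2 Y' Z" "\<And>k. k \<in> {..<n} \<Longrightarrow> g2 \<cdot> \<iota>' k = f (m + k)"
      using coproduct_map[OF c' Z f2] by metis
    obtain g where g: "arr g W Z" "g \<cdot> i = g1" "g \<cdot> j = g2" using ex[OF g1(1) g2(1)] by blast
    have "g \<cdot> ?k k = f k" if "k \<in> {..<m + n}" for k
    proof (cases "k < m")
      case False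
      then have "k - m < n" using that by auto
      then show ?thesis using False assoc[OF 2 a(2) g(1), of "k - m"] g(3) g2(2)[of "k - m"] by simp
    qed (use assoc[OF 1 a(1) g(1), of k] g(2) g1(2)[of k] in simp)
    then show "\<exists>g. arr g W Z \<and> (\<forall>k\<in>{..<m + n}. g \<cdot> ?k k = f k)" using g(1) by blast
  next
    fix Z g h assume g: "arr g W Z" and h: "arr h W Z"
      and e: "\<And>k. k \<in> {..<m + n} \<Longrightarrow> g \<cdot> ?k k = h \<cdot> ?k k"
    show "g = h"
    proof (rule un[OF g h])
      show "g \<cdot> i = h \<cdot> i"
      proof (rule coproduct_eq[OF c arr_comp[OF a(1) g] arr_comp[OF a(1) h]])
        fix k assume "k \<in> {..<m}"
        then show "g \<cdot> i \<cdot> \<iota> k = h \<cdot> i \<cdot> \<iota> k"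
          using e[of k] assoc[OF 1 a(1) g, of k] assoc[OF 1 a(1) h, of k] by simp
      qed
      show "g \<cdot> j = h \<cdot> j"
      proof (rule coproduct_eq[OF c' arr_comp[OF a(2) g] arr_comp[OF a(2) h]])
        fix k assume "k \<in> {..<n}"
        then show "g \<cdot> j \<cdot> \<iota>' k = h \<cdot> j \<cdot> \<iota>' k"
          using e[of "m + k"] assoc[OF 2 a(2) g, of k] assoc[OF 2 a(2) h, of k] by simp
      qed
    qed
  qed
  then show ?thesis using that by blast
qed

lemma coproduct_single:
  assumes "X \<in> Obj C"
  shows "is_coproduct C {..<1::nat} (\<lambda>_. X) X (\<lambda>_. Idn C X)"
  using assms by (intro coproductI) (auto simp: id_right intro: arr_id)

lemma direct_sum_zero_iso:
  assumes "is_direct_sum C A B Y" "zero_object C B"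
  shows "isomorphic C A Y"
proof -
  obtain i j where a: "arr i A Y" "arr j B Y"
    and m: "\<And>Z f g. arr f A Z \<Longrightarrow> arr g B Z \<Longrightarrow> \<exists>h. arr h Y Z \<and> h \<cdot> i = f \<and> h \<cdot> j = g"
    and e: "\<And>Z g h. arr g Y Z \<Longrightarrow> arr h Y Z \<Longrightarrow> g \<cdot> i = h \<cdot> i \<Longrightarrow> g \<cdot> j = h \<cdot> j \<Longrightarrow> g = h"
    using assms(1) unfolding direct_sum_iff by blast
  have o: "A \<in> Obj C" "B \<in> Obj C" "Y \<in> Obj C" using a arr_objs by auto
  obtain p where p: "arr p Y A" "p \<cdot> i = Idn C A" using m[OF arr_id[OF o(1)] arr_zero[OF o(2,1)]] by blast
  have ip: "arr (i \<cdot> p) Y Y" using p(1) a(1) by (rule arr_comp)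
  have "i \<cdot> p = Idn C Y"
  proof (rule e[OF ip arr_id[OF o(3)]])
    show "i \<cdot> p \<cdot> i = Idn C Y \<cdot> i" using assoc[OF a(1) p(1) a(1)] p(2) id_right[OF a(1)] id_left[OF a(1)] by simp
    show "i \<cdot> p \<cdot> j = Idn C Y \<cdot> j"
      using vanishD[OF zero_object_vanish(1)[OF assms(2) o(3)]] arr_comp[OF a(2) ip]
        arr_comp[OF a(2) arr_id[OF o(3)]] by metis
  qed
  then show ?thesis using a p unfolding isomorphic_def iso_iff by blast
qed

end

lemma (in additive_category) finite_coproduct_exists:
  assumes "\<And>j. j < n \<Longrightarrow> X j \<in> Obj C"
  shows "\<exists>Y \<iota>. is_coproduct C {..<n::nat} X Y \<iota>"
  using assms
proof (induction n)
  case 0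
  then show ?case using ex_zero_object coproduct_empty by (metis lessThan_0)
next
  case (Suc n)
  then obtain Y \<iota> where c: "is_coproduct C {..<n} X Y \<iota>" by auto
  have X: "X n \<in> Obj C" and Y: "Y \<in> Obj C" using Suc c by (auto simp: coproduct_iff)
  obtain W where W: "is_direct_sum C Y (X n) W" using ex_direct_sum[OF Y X] by blast
  obtain \<kappa> where k: "is_coproduct C {..<n + 1} (\<lambda>j. if j < n then X j else X n) W \<kappa>"
    using coproduct_append[OF c coproduct_single[OF X] W] .
  have "is_coproduct C {..<Suc n} X W \<kappa>"
    using k by (subst coproduct_cong[of _ _ "\<lambda>j. if j < n then X j else X n"]) (auto simp: less_Suc_eq)
  then show ?case by blast
qed

section \<open>Triangulated categories\<close>

context triangulated_category
begin

lemma arr_shift: "arr f X Y \<Longrightarrow> arr (shM D n f) (shO D n X) (shO D n Y)"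
  by (auto simp: arr_def shO_closed shM_closed)

lemma shift_comp: "arr f X Y \<Longrightarrow> arr g Y Z \<Longrightarrow> shM D n (g \<cdot> f) = shM D n g \<cdot> shM D n f"
  by (auto simp: arr_def shM_comp)

lemma shift_zero:
  assumes "X \<in> Obj D" "Y \<in> Obj D"
  shows "shM D n (zero_mor D X Y) = zero_mor D (shO D n X) (shO D n Y)"
proof (rule add_idem_zero)
  have z: "arr (zero_mor D X Y) X Y" using assms by (rule arr_zero)
  then show "arr (shM D n (zero_mor D X Y)) (shO D n X) (shO D n Y)" by (rule arr_shift)
  show "shM D n (zero_mor D X Y) \<oplus>\<^bsub>Hom D (shO D n X) (shO D n Y)\<^esub> shM D n (zero_mor D X Y)
      = shM D n (zero_mor D X Y)"
    using z shM_plus[of X Y "zero_mor D X Y" "zero_mor D X Y" n] add_zero(1)[OF z]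
    by (simp add: arr_def)
qed

lemma shift_shift_obj: "X \<in> Obj D \<Longrightarrow> shO D m (shO D n X) = shO D (m + n) X"
  by (simp add: shO_add)

lemma shift_shift_arr: "arr f X Y \<Longrightarrow> shM D m (shM D n f) = shM D (m + n) f"
  by (auto simp: arr_def shM_add)

lemma shift_0: "arr f X Y \<Longrightarrow> shM D 0 f = f"
  by (auto simp: arr_def intro: shM_0)

lemma unshift_arr:
  assumes "arr f (shO D n X) (shO D n Y)" "X \<in> Obj D" "Y \<in> Obj D"
  shows "arr (shM D (- n) f) X Y" "shM D n (shM D (- n) f) = f"
  using arr_shift[OF assms(1), of "- n"] shift_shift_arr[OF assms(1), of n "- n"] assms
    shift_0[OF assms(1)]
  by (simp_all add: shift_shift_obj shO_0)

lemma shift_unshift_arr: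
  assumes "arr f X Y"
  shows "shM D (- n) (shM D n f) = f"
  using shift_shift_arr[OF assms, of "- n" n] shift_0[OF assms] by simp

lemma vanish_shift:
  assumes "X \<in> Obj D" "Y \<in> Obj D"
  shows "hom_vanishes D (shO D n X) (shO D n Y) \<longleftrightarrow> hom_vanishes D X Y"
proof
  assume v: "hom_vanishes D (shO D n X) (shO D n Y)"
  show "hom_vanishes D X Y"
  proof (rule vanishI[OF assms])
    fix f assume f: "arr f X Y"
    then have "shM D n f = shM D n (zero_mor D X Y)"
      using vanishD[OF v arr_shift] shift_zero[OF assms] by simp
    then show "f = zero_mor D X Y"
      using shift_unshift_arr[OF f] shift_unshift_arr[OF arr_zero[OF assms]] by metis
  qed
next
  assume v: "hom_vanishes D X Y"
  show "hom_vanishes D (shO D n X) (shO D n Y)"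
  proof (rule vanishI)
    fix f assume "arr f (shO D n X) (shO D n Y)"
    from unshift_arr[OF this assms] vanishD[OF v]
    have "f = shM D n (zero_mor D X Y)" by metis
    then show "f = zero_mor D (shO D n X) (shO D n Y)" using shift_zero[OF assms] by simp
  qed (use assms shO_closed in auto)
qed

lemma zero_object_shift:
  assumes "zero_object D X"
  shows "zero_object D (shO D n X)"
proof -
  have X: "X \<in> Obj D" using assms by (simp add: zero_object_def)
  have "hom_vanishes D (shO D n X) (shO D n X)"
    using zero_object_vanish(1)[OF assms X] vanish_shift[OF X X] by simp
  then show ?thesis
    using vanishD[OF _ arr_id] X shO_closed by (intro zero_objectI) auto
qed

lemma tri_arr:
  assumes "tri D X Y Z f g h"
  shows "arr f X Y" "arr g Y Z" "arr h Z (shO D 1 X)"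
  using tri_closed[OF assms] by (auto simp: arr_def shO_closed)

lemma tri_rotate:
  assumes "tri D X Y Z f g h"
  shows "tri D Y Z (shO D 1 X) g h (\<ominus>\<^bsub>Hom D (shO D 1 X) (shO D 1 Y)\<^esub> (shM D 1 f))"
  using tri_closed[OF assms] TR2 assms by blast

lemma tri_rotate_back:
  assumes "tri D X Y Z f g h"
  obtains w where "tri D (shO D (- 1) Z) X Y w f g"
proof -
  note a = tri_arr[OF assms]
  have o: "X \<in> Obj D" "Y \<in> Obj D" "Z \<in> Obj D" using a arr_objs by blast+
  let ?Z = "shO D (- 1) Z"
  let ?n = "\<ominus>\<^bsub>Hom D Z (shO D 1 X)\<^esub> h"
  have Z: "?Z \<in> Obj D" "shO D 1 ?Z = Z" using o by (simp_all add: shO_closed shift_shift_obj shO_0)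
  have n: "arr ?n (shO D 1 ?Z) (shO D 1 X)" using arr_neg[OF a(3)] Z by simp
  define w where "w = shM D (- 1) ?n"
  have w: "arr w ?Z X" "shM D 1 w = ?n"
    using unshift_arr[OF n Z(1) o(1)] unfolding w_def by auto
  have "\<ominus>\<^bsub>Hom D (shO D 1 ?Z) (shO D 1 X)\<^esub> (shM D 1 w) = h"
    using w(2) Z(2) neg_neg[OF a(3)] by simp
  then have "tri D ?Z X Y w f g"
    using TR2[of ?Z X Y w f g] w(1) a Z assms by (simp add: arr_def)
  then show ?thesis using that by blast
qed

lemma tri_id:
  assumes "X \<in> Obj D" "zero_object D Z"
  shows "tri D X X Z (Idn D X) (zero_mor D X Z) (zero_mor D Z (shO D 1 X))"
    "tri D Z X X (zero_mor D Z X) (Idn D X) (zero_mor D X (shO D 1 Z))"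
proof -
  show "tri D X X Z (Idn D X) (zero_mor D X Z) (zero_mor D Z (shO D 1 X))"
    using assms by (rule TR1_Idn)
  have Z: "Z \<in> Obj D" "zero_object D (shO D 1 Z)" "shO D 1 Z \<in> Obj D" "shO D 1 X \<in> Obj D"
    using assms zero_object_shift shO_closed by (auto simp: zero_object_def)
  have *: "tri D X X (shO D 1 Z) (Idn D X) (zero_mor D X (shO D 1 Z))
      (\<ominus>\<^bsub>Hom D (shO D 1 Z) (shO D 1 X)\<^esub> (shM D 1 (zero_mor D Z X)))"
    using TR1_Idn[OF assms(1) Z(2)] by (simp add: shift_zero Z assms neg_zero)
  show "tri D Z X X (zero_mor D Z X) (Idn D X) (zero_mor D X (shO D 1 Z))"
    using TR2[of Z X X "zero_mor D Z X" "Idn D X" "zero_mor D X (shO D 1 Z)"] *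
      arr_zero[OF Z(1) assms(1)] arr_id[OF assms(1)] arr_zero[OF assms(1) Z(3)]
    by (simp add: arr_def)
qed

lemma TR3_arr:
  assumes "tri D X Y Z f g h" "tri D X' Y' Z' f' g' h'"
    "arr a X X'" "arr b Y Y'" "b \<cdot> f = f' \<cdot> a"
  obtains c where "arr c Z Z'" "c \<cdot> g = g' \<cdot> b" "shM D 1 a \<cdot> h = h' \<cdot> c"
proof -
  have "\<exists>c\<in>hom_set D Z Z'. c \<cdot> g = g' \<cdot> b \<and> shM D 1 a \<cdot> h = h' \<cdot> c"
    using assms(3-5) by (intro TR3[OF assms(1,2)]) (auto simp: arr_def)
  moreover have "Z \<in> Obj D" "Z' \<in> Obj D" using assms tri_closed by blast+
  ultimately show ?thesis using that by (auto simp: arr_def)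
qed

lemma factor_third:
  assumes t: "tri D X Y Z f g h" and u: "arr u Y W" "u \<cdot> f = zero_mor D X W"
  obtains v where "arr v Z W" "v \<cdot> g = u"
proof -
  note a = tri_arr[OF t]
  obtain N where N: "zero_object D N" using ex_zero_object by blast
  have W: "W \<in> Obj D" "X \<in> Obj D" using a u arr_objs by blast+
  have No: "N \<in> Obj D" using N by (simp add: zero_object_def)
  have z: "arr (zero_mor D X N) X N" using arr_zero No W by blast
  have "u \<cdot> f = zero_mor D N W \<cdot> zero_mor D X N"
    using u(2) zero_comp[OF z W(1)] by simp
  from TR3_arr[OF t tri_id(2)[OF W(1) N] z u(1) this]
  obtain c where "arr c Z W" "c \<cdot> g = Idn D W \<cdot> u" by metis
  then show ?thesis using that id_left[OF u(1)] by simp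
qed

lemma factor_first:
  assumes t: "tri D X Y Z f g h" and u: "arr u W Y" "g \<cdot> u = zero_mor D W Z"
  obtains v where "arr v W X" "f \<cdot> v = u"
proof -
  note a = tri_arr[OF t]
  obtain N where N: "zero_object D N" using ex_zero_object by blast
  have W: "W \<in> Obj D" "X \<in> Obj D" "Z \<in> Obj D" "Y \<in> Obj D" "shO D 1 W \<in> Obj D" "shO D 1 Y \<in> Obj D"
    using a u arr_objs shO_closed by blast+
  have No: "N \<in> Obj D" using N by (simp add: zero_object_def)
  have z: "arr (zero_mor D N Z) N Z" using arr_zero No W by blast
  note t1 = tri_rotate[OF tri_id(1)[OF W(1) N]]
  note t2 = tri_rotate[OF t]
  have e: "zero_mor D N Z \<cdot> zero_mor D W N = g \<cdot> u"
    using u(2) zero_comp[OF arr_zero[OF W(1) No] W(3)] by simp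
  obtain c where c: "arr c (shO D 1 W) (shO D 1 X)"
     and c2: "shM D 1 u \<cdot> \<ominus>\<^bsub>Hom D (shO D 1 W) (shO D 1 W)\<^esub> (shM D 1 (Idn D W))
      = (\<ominus>\<^bsub>Hom D (shO D 1 X) (shO D 1 Y)\<^esub> (shM D 1 f)) \<cdot> c"
    using TR3_arr[OF t1 t2 u(1) z e] by metis
  note v = unshift_arr[OF c W(1,2)]
  let ?v = "shM D (- 1) c"
  note su = arr_shift[OF u(1), of 1] and sf = arr_shift[OF a(1), of 1]
  have fc: "arr (shM D 1 f \<cdot> c) (shO D 1 W) (shO D 1 Y)" using c sf by (rule arr_comp)
  have "\<ominus>\<^bsub>Hom D (shO D 1 W) (shO D 1 Y)\<^esub> (shM D 1 u) = \<ominus>\<^bsub>Hom D (shO D 1 W) (shO D 1 Y)\<^esub> (shM D 1 f \<cdot> c)"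
    using c2 comp_neg[OF arr_id[OF W(5)] su] neg_comp[OF c sf] id_right[OF su] shM_Idn[OF W(1)] by simp
  then have "shM D 1 u = shM D 1 f \<cdot> c"
    using neg_neg[OF su] neg_neg[OF fc] by metis
  also have "\<dots> = shM D 1 (f \<cdot> ?v)" using shift_comp[OF v(1) a(1)] v(2) by simp
  finally have "u = f \<cdot> ?v"
    using shift_unshift_arr[OF u(1), of 1] shift_unshift_arr[OF arr_comp[OF v(1) a(1)], of 1] by metis
  then show ?thesis using that v(1) by simp
qed

lemma tri_comp_zero:
  assumes t: "tri D X Y Z f g h"
  shows "g \<cdot> f = zero_mor D X Z" "h \<cdot> g = zero_mor D Y (shO D 1 X)"
proof -
  have *: "g \<cdot> f = zero_mor D X Z" if t: "tri D X Y Z f g h" for X Y Z f g h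
  proof -
    note a = tri_arr[OF t]
    obtain N where N: "zero_object D N" using ex_zero_object by blast
    have X: "X \<in> Obj D" "Z \<in> Obj D" using a arr_objs by blast+
    have No: "N \<in> Obj D" using N by (simp add: zero_object_def)
    have "f \<cdot> Idn D X = f \<cdot> Idn D X" ..
    from TR3_arr[OF tri_id(1)[OF X(1) N] t arr_id[OF X(1)] a(1) this]
    obtain c where "arr c N Z" "c \<cdot> zero_mor D X N = g \<cdot> f" by metis
    then show ?thesis using comp_zero X by metis
  qed
  show "g \<cdot> f = zero_mor D X Z" using *[OF t] .
  show "h \<cdot> g = zero_mor D Y (shO D 1 X)" using *[OF tri_rotate[OF t]] .
qed

lemma factor_second:
  assumes t: "tri D X Y Z f g h" and u: "arr u W Z" "h \<cdot> u = zero_mor D W (shO D 1 X)"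
  obtains v where "arr v W Y" "g \<cdot> v = u"
  using factor_first[OF tri_rotate[OF t] u] by metis

lemma factor_shift:
  assumes t: "tri D X Y Z f g h" and u: "arr u Z W" "u \<cdot> g = zero_mor D Y W"
  obtains v where "arr v (shO D 1 X) W" "v \<cdot> h = u"
  using factor_third[OF tri_rotate[OF t] u] by metis

lemma tri_vanish_into:
  assumes t: "tri D X Y Z f g h" and "W \<in> Obj D" "hom_vanishes D W X" "hom_vanishes D W Z"
  shows "hom_vanishes D W Y"
proof (rule vanishI)
  note a = tri_arr[OF t]
  show "Y \<in> Obj D" using a arr_objs by blast
  fix u assume u: "arr u W Y"
  have "g \<cdot> u = zero_mor D W Z" using vanishD[OF assms(4) arr_comp[OF u a(2)]] .
  from factor_first[OF t u this] obtain v where v: "arr v W X" "f \<cdot> v = u" by metis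
  then show "u = zero_mor D W Y" using vanishD[OF assms(3) v(1)] comp_zero[OF a(1) assms(2)] by simp
qed (rule assms)

lemma tri_vanish_from:
  assumes t: "tri D X Y Z f g h" and "W \<in> Obj D" "hom_vanishes D X W" "hom_vanishes D Z W"
  shows "hom_vanishes D Y W"
proof (rule vanishI)
  note a = tri_arr[OF t]
  show "Y \<in> Obj D" using a arr_objs by blast
  fix u assume u: "arr u Y W"
  have "u \<cdot> f = zero_mor D X W" using vanishD[OF assms(3) arr_comp[OF a(1) u]] .
  from factor_third[OF t u this] obtain v where v: "arr v Z W" "v \<cdot> g = u" by metis
  then show "u = zero_mor D Y W" using vanishD[OF assms(4) v(1)] zero_comp[OF a(2) assms(2)] by simp
qed (rule assms)

lemma tri_zero_third_is_iso:
  assumes t: "tri D X Y Z f g h" and z: "zero_object D Z"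
  shows "is_iso D X Y f"
proof -
  note a = tri_arr[OF t]
  have o: "X \<in> Obj D" "Y \<in> Obj D" using a arr_objs by blast+
  have "g \<cdot> Idn D Y = zero_mor D Y Z"
    using vanishD[OF zero_object_vanish(2)[OF z o(2)]] a(2) id_right[OF a(2)] by simp
  from factor_first[OF t arr_id[OF o(2)] this] obtain s where s: "arr s Y X" "f \<cdot> s = Idn D Y" by metis
  obtain w where w: "tri D (shO D (- 1) Z) X Y w f g" using tri_rotate_back[OF t] .
  have "Idn D X = s \<cdot> f"
  proof (rule mono_of_zero[OF a(1) arr_id[OF o(1)] arr_comp[OF a(1) s(1)]])
    show "f \<cdot> Idn D X = f \<cdot> (s \<cdot> f)"
      using id_right[OF a(1)] id_left[OF a(1)] assoc[OF a(1) s(1) a(1)] s(2) by simp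
    fix k assume k: "arr k X X" "f \<cdot> k = zero_mor D X Y"
    from factor_first[OF w k] obtain v where v: "arr v X (shO D (- 1) Z)" "w \<cdot> v = k" by metis
    then have "v = zero_mor D X (shO D (- 1) Z)"
      using zero_object_shift[OF z] zero_object_vanish(2) vanishD o(1) by blast
    then show "k = zero_mor D X X" using v tri_arr(1)[OF w] comp_zero o(1) by metis
  qed
  then show ?thesis using s a unfolding iso_iff by metis
qed

lemma tri_zero_third_iso:
  "tri D X Y Z f g h \<Longrightarrow> zero_object D Z \<Longrightarrow> isomorphic D X Y"
  using tri_zero_third_is_iso unfolding isomorphic_def by blast

lemma tri_zero_first_iso:
  assumes t: "tri D X Y Z f g h" and z: "zero_object D X"
  shows "isomorphic D Y Z"
  using tri_zero_third_iso[OF tri_rotate[OF t] zero_object_shift[OF z]] .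

text \<open>Only the existence of some triangle on the shifted objects is claimed, so the signs of its
  maps do not matter.\<close>

lemma tri_shift_exists:
  assumes "tri D X Y Z f g h"
  shows "\<exists>f g h. tri D (shO D n X) (shO D n Y) (shO D n Z) f g h"
proof (induction n rule: int_induct[where k = 0])
  case base
  then show ?case using assms tri_closed[OF assms] by (auto simp: shO_0)
next
  case (step1 n)
  then obtain f g h where "tri D (shO D n X) (shO D n Y) (shO D n Z) f g h" by blast
  from tri_rotate[OF tri_rotate[OF tri_rotate[OF this]]]
  show ?case using tri_closed[OF assms] by (auto simp: shift_shift_obj add.commute)
next
  case (step2 n)
  then obtain f g h where "tri D (shO D n X) (shO D n Y) (shO D n Z) f g h" by blast
  then obtain w w' w'' where "tri D (shO D (- 1) (shO D n X)) (shO D (- 1) (shO D n Y))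
      (shO D (- 1) (shO D n Z)) w w' w''" by (metis tri_rotate_back)
  then show ?case using tri_closed[OF assms] by (auto simp: shift_shift_obj)
qed

lemma cone_exists:
  assumes "arr f X Y"
  obtains Z g h where "tri D X Y Z f g h"
  using TR1_cone assms unfolding arr_def by blast

lemma cocone_exists:
  assumes "arr g Y Z"
  obtains X f h where "tri D X Y Z f g h"
proof -
  obtain W p q where "tri D Y Z W g p q" using cone_exists[OF assms] .
  from tri_rotate_back[OF this] show ?thesis using that by metis
qed

text \<open>The complement of a retract is the cone of the inclusion.\<close>

lemma retract_direct_summand: "direct_summand D X Y \<longleftrightarrow> retract X Y"
proof
  assume "direct_summand D X Y"
  then show "retract X Y" unfolding direct_summand_def using direct_sum_retracts by blast
next
  assume "retract X Y"
  then obtain i r where i: "arr i X Y" and r: "arr r Y X" and ri: "r \<cdot> i = Idn D X"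
    unfolding retract_def by blast
  obtain Z g h where t: "tri D X Y Z i g h" using cone_exists[OF i] .
  note a = tri_arr[OF t]
  have o: "X \<in> Obj D" "Y \<in> Obj D" "Z \<in> Obj D" using a arr_objs by blast+
  note sh = shO_closed[OF o(1), of 1]
  have "shM D 1 i \<cdot> h = zero_mor D Z (shO D 1 Y)"
    using tri_comp_zero(2)[OF tri_rotate[OF t]] neg_comp[OF a(3) arr_shift[OF i, of 1]]
      neg_neg[OF arr_comp[OF a(3) arr_shift[OF i, of 1]]] neg_zero[OF o(3) shO_closed[OF o(2)]]
    by metis
  then have "h = zero_mor D Z (shO D 1 X)"
    using assoc[OF a(3) arr_shift[OF i, of 1] arr_shift[OF r, of 1]] shift_comp[OF i r, of 1] ri
      shM_Idn[OF o(1), of 1] id_left[OF a(3)] comp_zero[OF arr_shift[OF r, of 1] o(3)] by simp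
  then have "h \<cdot> Idn D Z = zero_mor D Z (shO D 1 X)" using id_right[OF a(3)] by simp
  from factor_second[OF t arr_id[OF o(3)] this]
  obtain s where s: "arr s Z Y" "g \<cdot> s = Idn D Z" by metis
  have gi: "g \<cdot> i = zero_mor D X Z" using tri_comp_zero(1)[OF t] .
  have "is_direct_sum D X Z Y"
    unfolding direct_sum_iff
  proof (rule exI[of _ i], rule exI[of _ s], intro conjI allI impI i s(1))
    fix W u v assume u: "arr u X W" and v: "arr v Z W"
    have W: "W \<in> Obj D" using u arr_objs by blast
    have ur: "arr (u \<cdot> r) Y W" using r u by (rule arr_comp)
    have urs: "arr (u \<cdot> r \<cdot> s) Z W" using s(1) ur by (rule arr_comp)
    let ?d = "v \<oplus>\<^bsub>Hom D Z W\<^esub> (\<ominus>\<^bsub>Hom D Z W\<^esub> (u \<cdot> r \<cdot> s))"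
    have d: "arr ?d Z W" using v urs arr_add arr_neg by blast
    have dg: "arr (?d \<cdot> g) Y W" using a(2) d by (rule arr_comp)
    let ?w = "u \<cdot> r \<oplus>\<^bsub>Hom D Y W\<^esub> ?d \<cdot> g"
    have "?w \<cdot> i = u"
      using add_comp[OF i ur dg] assoc[OF i r u] ri id_right[OF u] assoc[OF i a(2) d] gi
        comp_zero[OF d o(1)] add_zero(1)[OF u] by simp
    moreover have "?w \<cdot> s = v"
    proof -
      have "?w \<cdot> s = u \<cdot> r \<cdot> s \<oplus>\<^bsub>Hom D Z W\<^esub> ?d"
        using add_comp[OF s(1) ur dg] assoc[OF s(1) a(2) d] s(2) id_right[OF d] by simp
      also have "\<dots> = u \<cdot> r \<cdot> s \<oplus>\<^bsub>Hom D Z W\<^esub> (\<ominus>\<^bsub>Hom D Z W\<^esub> (u \<cdot> r \<cdot> s) \<oplus>\<^bsub>Hom D Z W\<^esub> v)"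
        using add_comm[OF v arr_neg[OF urs]] by simp
      also have "\<dots> = v"
        using add_assoc[OF urs arr_neg[OF urs] v] add_neg[OF urs] add_zero(2)[OF v] by simp
      finally show ?thesis .
    qed
    ultimately show "\<exists>w. arr w Y W \<and> w \<cdot> i = u \<and> w \<cdot> s = v" using arr_add[OF ur dg] by blast
  next
    fix W u v assume uv: "arr u Y W" "arr v Y W" "u \<cdot> i = v \<cdot> i" "u \<cdot> s = v \<cdot> s"
    let ?d = "u \<oplus>\<^bsub>Hom D Y W\<^esub> (\<ominus>\<^bsub>Hom D Y W\<^esub> v)"
    have W: "W \<in> Obj D" using uv arr_objs by blast
    have d: "arr ?d Y W" using uv arr_add arr_neg by blast
    have "?d \<cdot> i = zero_mor D X W"
      using add_comp[OF i uv(1) arr_neg[OF uv(2)]] neg_comp[OF i uv(2)] uv(3)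
        add_neg[OF arr_comp[OF i uv(2)]] by simp
    from factor_third[OF t d this] obtain e where e: "arr e Z W" "e \<cdot> g = ?d" by metis
    have "?d \<cdot> s = zero_mor D Z W"
      using add_comp[OF s(1) uv(1) arr_neg[OF uv(2)]] neg_comp[OF s(1) uv(2)] uv(4)
        add_neg[OF arr_comp[OF s(1) uv(2)]] by simp
    then have "e = zero_mor D Z W"
      using assoc[OF s(1) a(2) e(1)] e(2) s(2) id_right[OF e(1)] by simp
    then have "?d = zero_mor D Y W" using e(2) zero_comp[OF a(2) W] by simp
    then show "u = v" using eq_of_diff_zero[OF uv(1,2)] by blast
  qed
  then show "direct_summand D X Y" unfolding direct_summand_def by blast
qed

end

section \<open>t-structures\<close>

lemma full_subcategory_simps [simp]:
  "Obj (full_subcategory C S) = S"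
  "Hom (full_subcategory C S) = Hom C"
  "Idn (full_subcategory C S) = Idn C"
  "Comp (full_subcategory C S) = Comp C"
  by (simp_all add: full_subcategory_def)

lemma (in triangulated_category) isomorphic_shift:
  assumes "isomorphic D X Y"
  shows "isomorphic D (shO D n X) (shO D n Y)"
proof -
  obtain f g where f: "arr f X Y" "arr g Y X" "g \<cdot> f = Idn D X" "f \<cdot> g = Idn D Y"
    using assms unfolding isomorphic_def iso_iff by blast
  have "shM D n g \<cdot> shM D n f = Idn D (shO D n X)" "shM D n f \<cdot> shM D n g = Idn D (shO D n Y)"
    using shift_comp[OF f(1,2)] shift_comp[OF f(2,1)] f shM_Idn arr_objs(1)[OF f(1)] arr_objs(2)[OF f(1)]
    by metis+
  then show ?thesis unfolding isomorphic_def iso_iff using arr_shift[OF f(1)] arr_shift[OF f(2)] by blast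
qed

locale t_category = triangulated_category K D
  for K :: "'k ring" and D :: "('k, 'o, 'm, 'z) tri_cat_scheme" (structure) +
  fixes t :: "'o set \<times> 'o set"
  assumes t_structure: "t_structure D t"
begin

definition le :: "int \<Rightarrow> 'o \<Rightarrow> bool" where
  "le n X \<longleftrightarrow> X \<in> Obj D \<and> shO D n X \<in> fst t"

definition ge :: "int \<Rightarrow> 'o \<Rightarrow> bool" where
  "ge n X \<longleftrightarrow> X \<in> Obj D \<and> shO D n X \<in> snd t"

lemma le_obj: "le n X \<Longrightarrow> X \<in> Obj D" and ge_obj: "ge n X \<Longrightarrow> X \<in> Obj D"
  by (auto simp: le_def ge_def)

lemma fst_t_iff: "X \<in> fst t \<longleftrightarrow> le 0 X" and snd_t_iff: "X \<in> snd t \<longleftrightarrow> ge 0 X"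
  using t_structure shO_0 unfolding t_structure_def le_def ge_def by auto

lemma t_le_iff: "X \<in> t_le D t n \<longleftrightarrow> le n X"
proof
  assume "X \<in> t_le D t n"
  then obtain Y where Y: "Y \<in> fst t" "X = shO D (- n) Y" by (auto simp: t_le_def)
  then have "Y \<in> Obj D" using le_obj fst_t_iff by blast
  then show "le n X" using Y by (simp add: le_def shO_closed shift_shift_obj shO_0)
next
  assume "le n X"
  then have "X = shO D (- n) (shO D n X)" "shO D n X \<in> fst t"
    by (simp_all add: le_def shift_shift_obj shO_0)
  then show "X \<in> t_le D t n" unfolding t_le_def by blast
qed

lemma t_ge_iff: "X \<in> t_ge D t n \<longleftrightarrow> ge n X"
proof
  assume "X \<in> t_ge D t n"
  then obtain Y where Y: "Y \<in> snd t" "X = shO D (- n) Y" by (auto simp: t_ge_def)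
  then have "Y \<in> Obj D" using ge_obj snd_t_iff by blast
  then show "ge n X" using Y by (simp add: ge_def shO_closed shift_shift_obj shO_0)
next
  assume "ge n X"
  then have "X = shO D (- n) (shO D n X)" "shO D n X \<in> snd t"
    by (simp_all add: ge_def shift_shift_obj shO_0)
  then show "X \<in> t_ge D t n" unfolding t_ge_def by blast
qed

lemma le_shift: "X \<in> Obj D \<Longrightarrow> le m (shO D n X) \<longleftrightarrow> le (m + n) X"
  and ge_shift: "X \<in> Obj D \<Longrightarrow> ge m (shO D n X) \<longleftrightarrow> ge (m + n) X"
  by (auto simp: le_def ge_def shO_closed shift_shift_obj)

lemma le_mono: assumes "le m X" "m \<le> n" shows "le n X"
  using assms(2)
proof (induction n rule: int_ge_induct)
  case base then show ?case using assms by simp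
next
  case (step n)
  have X: "X \<in> Obj D" using assms le_obj by blast
  have "shO D 1 (shO D n X) \<in> fst t"
    using step t_structure unfolding t_structure_def le_def by blast
  then show ?case using X by (simp add: le_def shift_shift_obj add.commute)
qed

lemma ge_mono: assumes "ge m X" "n \<le> m" shows "ge n X"
  using assms(2)
proof (induction n rule: int_le_induct)
  case base then show ?case using assms by simp
next
  case (step n)
  have X: "X \<in> Obj D" using assms ge_obj by blast
  have "shO D (- 1) (shO D n X) \<in> snd t"
    using step t_structure unfolding t_structure_def ge_def by blast
  then show ?case using X by (simp add: ge_def shift_shift_obj add.commute)
qed

lemma t_vanish:
  assumes "le n X" "ge m Y" "n < m"
  shows "hom_vanishes D X Y"
proof -
  have o: "X \<in> Obj D" "Y \<in> Obj D" using assms le_obj ge_obj by auto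
  have "ge (1 + n) Y" using assms by (intro ge_mono[OF assms(2)]) auto
  then have "shO D 1 (shO D n Y) \<in> snd t" using o by (simp add: ge_def shift_shift_obj)
  moreover have "shO D n Y = shO D (- 1) (shO D 1 (shO D n Y))"
    using o by (simp add: shift_shift_obj)
  ultimately have "shO D n Y \<in> shO D (- 1) ` snd t" by blast
  moreover have "shO D n X \<in> fst t" using assms by (simp add: le_def)
  ultimately have "hom_vanishes D (shO D n X) (shO D n Y)"
    using t_structure unfolding t_structure_def by blast
  then show ?thesis using vanish_shift o by blast
qed

lemma truncation:
  assumes "X \<in> Obj D"
  obtains A B i p h where "le n A" "ge (n + 1) B" "tri D A X B i p h"
proof -
  have sX: "shO D n X \<in> Obj D" using assms shO_closed by blast
  have tr: "\<forall>X\<in>Obj D. \<exists>A B i p h. A \<in> fst t \<and> B \<in> shO D (- 1) ` snd t \<and> tri D A X B i p h"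
    using t_structure unfolding t_structure_def by (elim conjE)
  from bspec[OF tr sX]
  obtain A B i p h where *: "A \<in> fst t" "B \<in> shO D (- 1) ` snd t" "tri D A (shO D n X) B i p h"
    by (elim exE conjE) (rule that)
  obtain B' where B': "B = shO D (- 1) B'" "ge 0 B'" using * snd_t_iff by blast
  have A: "le 0 A" using * fst_t_iff by blast
  have o: "A \<in> Obj D" "B' \<in> Obj D" "B \<in> Obj D" using A B' le_obj ge_obj shO_closed by auto
  have B: "ge 1 B" using B' ge_shift[OF o(2), of 1 "-1"] by simp
  obtain f g h where "tri D (shO D (- n) A) (shO D (- n) (shO D n X)) (shO D (- n) B) f g h"
    using tri_shift_exists[OF *(3)] by blast
  moreover have "shO D (- n) (shO D n X) = X" using assms by (simp add: shift_shift_obj shO_0)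
  moreover have "le n (shO D (- n) A)" "ge (n + 1) (shO D (- n) B)"
    using A B le_shift[OF o(1)] ge_shift[OF o(3)] by simp_all
  ultimately show ?thesis using that by simp
qed

lemma le_iso: "le n X \<Longrightarrow> isomorphic D X Y \<Longrightarrow> le n Y"
proof -
  assume X: "le n X" "isomorphic D X Y"
  have "\<forall>X\<in>fst t. \<forall>Y\<in>Obj D. isomorphic D X Y \<longrightarrow> Y \<in> fst t"
    using t_structure unfolding t_structure_def iso_closed_def by (elim conjE)
  moreover have "isomorphic D (shO D n X) (shO D n Y)" using X isomorphic_shift by blast
  moreover have "Y \<in> Obj D" "shO D n Y \<in> Obj D" using X isomorphic_objs shO_closed by blast+
  ultimately show ?thesis using X(1) unfolding le_def by blast
qed

lemma ge_iso: "ge n X \<Longrightarrow> isomorphic D X Y \<Longrightarrow> ge n Y"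
proof -
  assume X: "ge n X" "isomorphic D X Y"
  have "\<forall>X\<in>snd t. \<forall>Y\<in>Obj D. isomorphic D X Y \<longrightarrow> Y \<in> snd t"
    using t_structure unfolding t_structure_def iso_closed_def by (elim conjE)
  moreover have "isomorphic D (shO D n X) (shO D n Y)" using X isomorphic_shift by blast
  moreover have "Y \<in> Obj D" "shO D n Y \<in> Obj D" using X isomorphic_objs shO_closed by blast+
  ultimately show ?thesis using X(1) unfolding ge_def by blast
qed

lemma vanish_self_zero: "X \<in> Obj D \<Longrightarrow> hom_vanishes D X X \<Longrightarrow> zero_object D X"
  using vanishD[OF _ arr_id] by (intro zero_objectI) auto

lemma leI:
  assumes X: "X \<in> Obj D" and v: "\<And>Y. ge (n + 1) Y \<Longrightarrow> hom_vanishes D X Y"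
  shows "le n X"
proof -
  obtain A B i p h where *: "le n A" "ge (n + 1) B" "tri D A X B i p h"
    using truncation[OF X] .
  note a = tri_arr[OF *(3)]
  have o: "A \<in> Obj D" "B \<in> Obj D" using a arr_objs by blast+
  have "Idn D B \<cdot> p = zero_mor D X B" using vanishD[OF v[OF *(2)] a(2)] id_left[OF a(2)] by simp
  from factor_shift[OF *(3) arr_id[OF o(2)] this]
  obtain w where w: "arr w (shO D 1 A) B" "w \<cdot> h = Idn D B" by metis
  have "hom_vanishes D (shO D 1 A) B"
    using * le_shift[OF o(1), of "n - 1" 1] by (intro t_vanish[of "n - 1" _ "n + 1"]) auto
  then have "Idn D B = zero_mor D B B" using w vanishD zero_comp[OF a(3) o(2)] by metis
  then have "zero_object D B" using o zero_objectI by blast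
  then show ?thesis using tri_zero_third_iso[OF *(3)] le_iso * by blast
qed

lemma geI:
  assumes X: "X \<in> Obj D" and v: "\<And>Y. le (n - 1) Y \<Longrightarrow> hom_vanishes D Y X"
  shows "ge n X"
proof -
  obtain A B i p h where *: "le (n - 1) A" "ge (n - 1 + 1) B" "tri D A X B i p h"
    using truncation[OF X] .
  obtain w where t: "tri D (shO D (- 1) B) A X w i p" using tri_rotate_back[OF *(3)] .
  note a = tri_arr[OF t]
  have o: "A \<in> Obj D" "B \<in> Obj D" using * le_obj ge_obj by blast+
  have "i \<cdot> Idn D A = zero_mor D A X" using vanishD[OF v[OF *(1)] a(2)] id_right[OF a(2)] by simp
  from factor_first[OF t arr_id[OF o(1)] this]
  obtain s where s: "arr s A (shO D (- 1) B)" "w \<cdot> s = Idn D A" by metis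
  have "hom_vanishes D A (shO D (- 1) B)"
    using * ge_shift[OF o(2), of "n + 1" "- 1"] by (intro t_vanish[of "n - 1" _ "n + 1"]) auto
  then have "Idn D A = zero_mor D A A" using s vanishD comp_zero[OF a(1) o(1)] by metis
  then have "zero_object D A" using o zero_objectI by blast
  then show ?thesis using tri_zero_first_iso[OF *(3)] isomorphic_sym ge_iso * by fastforce
qed

lemma le_ext:
  assumes t: "tri D X Y Z f g h" and "le n X" "le n Z"
  shows "le n Y"
proof (rule leI)
  show "Y \<in> Obj D" using tri_closed[OF t] by blast
  fix W assume "ge (n + 1) W"
  then show "hom_vanishes D Y W"
    using assms t_vanish ge_obj by (intro tri_vanish_from[OF t]) auto
qed

lemma ge_ext:
  assumes t: "tri D X Y Z f g h" and "ge n X" "ge n Z"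
  shows "ge n Y"
proof (rule geI)
  show "Y \<in> Obj D" using tri_closed[OF t] by blast
  fix W assume "le (n - 1) W"
  then show "hom_vanishes D W Y"
    using assms t_vanish le_obj by (intro tri_vanish_into[OF t]) auto
qed

lemma le_retract: assumes "retract X Y" "le n Y" shows "le n X"
proof (rule leI)
  show "X \<in> Obj D" using assms arr_objs unfolding retract_def by blast
  fix W assume "ge (n + 1) W"
  then show "hom_vanishes D X W" using assms t_vanish ge_obj by (intro retract_vanish(1)[OF assms(1)]) auto
qed

lemma ge_retract: assumes "retract X Y" "ge n Y" shows "ge n X"
proof (rule geI)
  show "X \<in> Obj D" using assms arr_objs unfolding retract_def by blast
  fix W assume "le (n - 1) W"
  then show "hom_vanishes D W X" using assms t_vanish le_obj by (intro retract_vanish(2)[OF assms(1)]) auto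
qed

lemma le_ge_zero: "le n X \<Longrightarrow> ge m X \<Longrightarrow> n < m \<Longrightarrow> zero_object D X"
  using t_vanish vanish_self_zero le_obj by blast

definition hrt :: "'o \<Rightarrow> bool" where
  "hrt X \<longleftrightarrow> le 0 X \<and> ge 0 X"

lemma heart_simps [simp]:
  "Hom (heart D t) = Hom D" "Idn (heart D t) = Idn D" "Comp (heart D t) = Comp D"
  "X \<in> Obj (heart D t) \<longleftrightarrow> hrt X"
  by (auto simp: heart_def hrt_def fst_t_iff snd_t_iff)

lemma hrt_obj: "hrt X \<Longrightarrow> X \<in> Obj D" and hrt_le: "hrt X \<Longrightarrow> le 0 X" and hrt_ge: "hrt X \<Longrightarrow> ge 0 X"
  using le_obj by (auto simp: hrt_def)

lemma hrt_retract: "retract X Y \<Longrightarrow> hrt Y \<Longrightarrow> hrt X"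
  using le_retract ge_retract by (auto simp: hrt_def)

lemma heart_zero_object: "hrt X \<Longrightarrow> zero_object (heart D t) X \<longleftrightarrow> zero_object D X"
proof
  assume X: "hrt X" and "zero_object (heart D t) X"
  then have "hom_vanishes D X X" by (auto simp: zero_object_def hom_vanishes_def)
  then show "zero_object D X" using vanish_self_zero X hrt_obj by blast
next
  assume "hrt X" "zero_object D X"
  then show "zero_object (heart D t) X"
    using hrt_obj by (auto simp: zero_object_def hom_vanishes_def)
qed

lemma heart_iso: "is_iso (heart D t) X Y f \<longleftrightarrow> hrt X \<and> hrt Y \<and> is_iso D X Y f"
  using hrt_obj by (auto simp: is_iso_def)

lemma heart_isomorphic: "isomorphic (heart D t) X Y \<longleftrightarrow> hrt X \<and> hrt Y \<and> isomorphic D X Y"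
  using heart_iso by (auto simp: isomorphic_def)

lemma heart_monoI:
  assumes "hrt X" "hrt Y" "arr f X Y"
    and "\<And>Z k. hrt Z \<Longrightarrow> arr k Z X \<Longrightarrow> f \<cdot> k = zero_mor D Z Y \<Longrightarrow> k = zero_mor D Z X"
  shows "is_mono (heart D t) X Y f"
  unfolding is_mono_def heart_simps
proof (intro conjI ballI impI)
  show "f \<in> hom_set D X Y" using assms arr_def by blast
  fix Z g h assume *: "Z \<in> Obj (heart D t)" "g \<in> hom_set D Z X" "h \<in> hom_set D Z X" "f \<cdot> g = f \<cdot> h"
  then have Z: "hrt Z" "arr g Z X" "arr h Z X" using assms(1) hrt_obj by (auto simp: arr_def)
  show "g = h" by (rule mono_of_zero[OF assms(3) Z(2,3) *(4)]) (rule assms(4)[OF Z(1)])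
qed (use assms in auto)

lemma heart_epiI:
  assumes "hrt X" "hrt Y" "arr f X Y"
    and "\<And>Z k. hrt Z \<Longrightarrow> arr k Y Z \<Longrightarrow> k \<cdot> f = zero_mor D X Z \<Longrightarrow> k = zero_mor D Y Z"
  shows "is_epi (heart D t) X Y f"
  unfolding is_epi_def heart_simps
proof (intro conjI ballI impI)
  show "f \<in> hom_set D X Y" using assms arr_def by blast
  fix Z g h assume *: "Z \<in> Obj (heart D t)" "g \<in> hom_set D Y Z" "h \<in> hom_set D Y Z" "g \<cdot> f = h \<cdot> f"
  then have Z: "hrt Z" "arr g Y Z" "arr h Y Z" using assms(2) hrt_obj by (auto simp: arr_def)
  show "g = h" by (rule epi_of_zero[OF assms(3) Z(2,3) *(4)]) (rule assms(4)[OF Z(1)])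
qed (use assms in auto)

lemma heart_epiD:
  assumes "is_epi (heart D t) X Y f"
  shows "hrt X" "hrt Y" "arr f X Y"
    and "hrt Z \<Longrightarrow> arr g Y Z \<Longrightarrow> arr h Y Z \<Longrightarrow> g \<cdot> f = h \<cdot> f \<Longrightarrow> g = h"
  using assms hrt_obj unfolding is_epi_def heart_simps arr_def by auto

definition cov :: "'m \<Rightarrow> 'o \<Rightarrow> 'o \<Rightarrow> bool" where
  "cov f X Y \<longleftrightarrow> arr f X Y \<and> (\<exists>Z g h. tri D X Y Z f g h \<and> le (- 1) Z)"

lemma cov_arr: "cov f X Y \<Longrightarrow> arr f X Y"
  by (simp add: cov_def)

lemma cov_cancel:
  assumes "cov f X Y" "ge 0 Z" "arr k Y Z" "k \<cdot> f = zero_mor D X Z"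
  shows "k = zero_mor D Y Z"
proof -
  obtain C g h where t: "tri D X Y C f g h" "le (- 1) C" using assms unfolding cov_def by blast
  from factor_third[OF t(1) assms(3,4)] obtain v where v: "arr v C Z" "v \<cdot> g = k" by metis
  have "v = zero_mor D C Z" using v(1) vanishD t_vanish[OF t(2) assms(2)] by simp
  then show ?thesis using v zero_comp[OF tri_arr(2)[OF t(1)] ge_obj[OF assms(2)]] by simp
qed

lemma cov_cancel_eq:
  assumes "cov f X Y" "ge 0 Z" "arr k Y Z" "arr l Y Z" "k \<cdot> f = l \<cdot> f"
  shows "k = l"
  by (rule epi_of_zero[OF cov_arr[OF assms(1)] assms(3-5)]) (rule cov_cancel[OF assms(1,2)])

lemma cov_of_epi:
  assumes X: "le 0 X" and Y: "le 0 Y" and f: "arr f X Y"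
    and epi: "\<And>Z k. hrt Z \<Longrightarrow> arr k Y Z \<Longrightarrow> k \<cdot> f = zero_mor D X Z \<Longrightarrow> k = zero_mor D Y Z"
  shows "cov f X Y"
proof -
  obtain C g h where t: "tri D X Y C f g h" using cone_exists[OF f] .
  note a = tri_arr[OF t]
  have o: "X \<in> Obj D" "Y \<in> Obj D" "C \<in> Obj D" using a arr_objs by blast+
  have X1: "le (- 1) (shO D 1 X)" using X le_shift[OF o(1)] by simp
  have C: "le 0 C" using le_ext[OF tri_rotate[OF t] Y] le_mono[OF X1] by simp
  obtain A B i p q where u: "le (- 1) A" "ge (- 1 + 1) B" "tri D A C B i p q"
    using truncation[OF o(3)] .
  note b = tri_arr[OF u(3)]
  have oB: "A \<in> Obj D" "B \<in> Obj D" using b arr_objs by blast+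
  have B: "ge 0 B" using u by simp
  have "le (- 1 - 1) (shO D 1 A)" using u le_shift[OF oB(1)] by simp
  then have A1: "le 0 (shO D 1 A)" by (rule le_mono) simp
  have hB: "hrt B" unfolding hrt_def using B le_ext[OF tri_rotate[OF u(3)] C A1] by blast
  have pg: "arr (p \<cdot> g) Y B" using a(2) b(2) by (rule arr_comp)
  have "p \<cdot> g \<cdot> f = zero_mor D X B"
    using assoc[OF a(1,2) b(2)] tri_comp_zero(1)[OF t] comp_zero[OF b(2) o(1)] by simp
  from epi[OF hB pg this] have "p \<cdot> g = zero_mor D Y B" .
  from factor_shift[OF t b(2) this] obtain v where v: "arr v (shO D 1 X) B" "v \<cdot> h = p" by metis
  have "v = zero_mor D (shO D 1 X) B" using vanishD[OF t_vanish[OF X1 B] v(1)] by simp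
  then have p0: "p = zero_mor D C B" using v zero_comp[OF a(3) oB(2)] by simp
  have "le (- 1) C"
  proof (rule leI[OF o(3)])
    fix W assume "ge (- 1 + 1) W"
    then have W: "ge 0 W" by simp
    then have Wo: "W \<in> Obj D" using ge_obj by blast
    show "hom_vanishes D C W"
    proof (rule vanishI[OF o(3) Wo])
      fix w assume w: "arr w C W"
      have "w \<cdot> i = zero_mor D A W" using vanishD[OF t_vanish[OF u(1) W]] arr_comp[OF b(1) w] by simp
      from factor_third[OF u(3) w this] obtain s where s: "arr s B W" "s \<cdot> p = w" by metis
      then show "w = zero_mor D C W" using p0 comp_zero[OF s(1) o(3)] by simp
    qed
  qed
  then show ?thesis using t f unfolding cov_def by blast
qed

lemma heart_epi_cov: "is_epi (heart D t) X Y f \<Longrightarrow> cov f X Y"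
proof (rule cov_of_epi)
  assume e: "is_epi (heart D t) X Y f"
  note d = heart_epiD[OF e]
  show "le 0 X" "le 0 Y" "arr f X Y" using d hrt_le by auto
  show "k = zero_mor D Y Z" if "hrt Z" "arr k Y Z" "k \<cdot> f = zero_mor D X Z" for Z k
    using that d(4)[of Z k "zero_mor D Y Z"] zero_comp[OF d(3)] arr_zero hrt_obj d(2) by simp
qed

lemma cov_heart_epi: "hrt X \<Longrightarrow> hrt Y \<Longrightarrow> cov f X Y \<Longrightarrow> is_epi (heart D t) X Y f"
  using hrt_ge cov_cancel by (intro heart_epiI) (auto intro: cov_arr)

lemma simple_hrt: "simple_object (heart D t) L \<Longrightarrow> hrt L"
  and simple_nonzero: "simple_object (heart D t) L \<Longrightarrow> \<not> zero_object D L"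
  using heart_zero_object by (auto simp: simple_object_def)

lemma simple_ge: "simple_object (heart D t) L \<Longrightarrow> ge 0 L"
  and simple_le: "simple_object (heart D t) L \<Longrightarrow> le 0 L"
  using simple_hrt hrt_ge hrt_le by auto

text \<open>Every morphism out of \<open>L\<close> that kills \<open>f\<close> has a nonzero kernel in the heart, so it is zero.\<close>

lemma simple_cov:
  assumes L: "simple_object (heart D t) L" and X: "le 0 X"
    and f: "arr f X L" "f \<noteq> zero_mor D X L"
  shows "cov f X L"
proof (rule cov_of_epi[OF X simple_le[OF L] f(1)])
  fix Z k assume Z: "hrt Z" and k: "arr k L Z" "k \<cdot> f = zero_mor D X Z"
  obtain N m q where t: "tri D N L Z m k q" using cocone_exists[OF k(1)] .
  note a = tri_arr[OF t]
  have o: "N \<in> Obj D" "L \<in> Obj D" "Z \<in> Obj D" "X \<in> Obj D" using a f arr_objs by blast+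
  obtain w where t': "tri D (shO D (- 1) Z) N L w m k" using tri_rotate_back[OF t] .
  have Z1: "ge 1 (shO D (- 1) Z)" using ge_shift[OF o(3), of 1 "-1"] Z hrt_ge by simp
  have N: "ge 0 N" using ge_ext[OF t' _ simple_ge[OF L]] ge_mono[OF Z1] by simp
  obtain A B i p h where u: "le 0 A" "ge (0 + 1) B" "tri D A N B i p h"
    using truncation[OF o(1)] .
  have oB: "A \<in> Obj D" "B \<in> Obj D" using u le_obj ge_obj by blast+
  have B1: "ge 1 B" using u by simp
  obtain b where u': "tri D (shO D (- 1) B) A N b i p" using tri_rotate_back[OF u(3)] .
  have B2: "ge 2 (shO D (- 1) B)" using ge_shift[OF oB(2), of 2 "-1"] B1 by simp
  have A: "hrt A" unfolding hrt_def using u(1) ge_ext[OF u' _ N] ge_mono[OF B2] by simp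
  note c = tri_arr[OF u']
  have mi: "arr (m \<cdot> i) A L" using c(2) a(1) by (rule arr_comp)
  have "is_mono (heart D t) A L (m \<cdot> i)"
  proof (rule heart_monoI[OF A simple_hrt[OF L] mi])
    fix W s assume W: "hrt W" and s: "arr s W A" "m \<cdot> i \<cdot> s = zero_mor D W L"
    have is': "arr (i \<cdot> s) W N" using s(1) c(2) by (rule arr_comp)
    have "m \<cdot> (i \<cdot> s) = zero_mor D W L" using assoc[OF s(1) c(2) a(1)] s(2) by simp
    from factor_first[OF t' is' this] obtain v where v: "arr v W (shO D (- 1) Z)" "w \<cdot> v = i \<cdot> s" by metis
    have "v = zero_mor D W (shO D (- 1) Z)" using vanishD[OF t_vanish[OF hrt_le[OF W] Z1] v(1)] by simp
    then have "i \<cdot> s = zero_mor D W N" using v comp_zero[OF tri_arr(1)[OF t'] hrt_obj[OF W]] by simp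
    from factor_first[OF u' s(1) this] obtain r where r: "arr r W (shO D (- 1) B)" "b \<cdot> r = s" by metis
    have "r = zero_mor D W (shO D (- 1) B)" using vanishD[OF t_vanish[OF hrt_le[OF W] B2] r(1)] by simp
    then show "s = zero_mor D W A" using r comp_zero[OF c(1) hrt_obj[OF W]] by simp
  qed
  then have "zero_object (heart D t) A \<or> is_iso (heart D t) A L (m \<cdot> i)"
    using L unfolding simple_object_def by blast
  moreover have "\<not> zero_object (heart D t) A"
  proof
    assume "zero_object (heart D t) A"
    then have zA: "zero_object D A" using heart_zero_object A by blast
    from factor_first[OF t f(1) k(2)] obtain f' where f': "arr f' X N" "m \<cdot> f' = f" by metis
    have "p \<cdot> f' = zero_mor D X B"
      using vanishD[OF t_vanish[OF X B1] arr_comp[OF f'(1) tri_arr(2)[OF u(3)]]] by simp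
    from factor_first[OF u(3) f'(1) this] obtain f'' where f'': "arr f'' X A" "i \<cdot> f'' = f'" by metis
    have "f'' = zero_mor D X A" using vanishD[OF zero_object_vanish(2)[OF zA o(4)] f''(1)] .
    then have "f = zero_mor D X L" using f' f'' comp_zero[OF c(2) o(4)] comp_zero[OF a(1) o(4)] by simp
    then show False using f by blast
  qed
  ultimately obtain j where j: "arr j L A" "m \<cdot> i \<cdot> j = Idn D L"
    unfolding heart_iso iso_iff by blast
  have "k = k \<cdot> (m \<cdot> i \<cdot> j)" using j id_right[OF k(1)] by simp
  also have "\<dots> = (k \<cdot> m) \<cdot> (i \<cdot> j)"
    using assoc[OF j(1) c(2) a(1)] assoc[OF arr_comp[OF j(1) c(2)] a(1) k(1)] by simp
  also have "\<dots> = zero_mor D L Z"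
    using tri_comp_zero(1)[OF t] zero_comp[OF arr_comp[OF j(1) c(2)] o(3)] by simp
  finally show "k = zero_mor D L Z" .
qed

lemma simple_iso:
  assumes "simple_object (heart D t) L" "simple_object (heart D t) L'"
    and u: "arr u L L'" "u \<noteq> zero_mor D L L'"
  shows "is_iso D L L' u"
proof -
  have "is_mono (heart D t) L L' u"
  proof (rule heart_monoI[OF simple_hrt[OF assms(1)] simple_hrt[OF assms(2)] u(1)])
    fix W s assume W: "hrt W" and s: "arr s W L" "u \<cdot> s = zero_mor D W L'"
    show "s = zero_mor D W L"
    proof (rule ccontr)
      assume "s \<noteq> zero_mor D W L"
      then have "cov s W L" using simple_cov[OF assms(1) hrt_le[OF W] s(1)] by blast
      from cov_cancel[OF this simple_ge[OF assms(2)] u(1) s(2)] show False using u by blast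
    qed
  qed
  then have "zero_object (heart D t) L \<or> is_iso (heart D t) L L' u"
    using assms(2) unfolding simple_object_def by blast
  then show ?thesis
    using heart_iso heart_zero_object simple_nonzero[OF assms(1)] simple_hrt[OF assms(1)] by blast
qed

end

section \<open>Derived projectives\<close>

context t_category
begin

lemma dp_le: "derived_projective D t P \<Longrightarrow> le 0 P"
  by (simp add: derived_projective_def fst_t_iff)

lemma dp_obj: "derived_projective D t P \<Longrightarrow> P \<in> Obj D"
  using dp_le le_obj by blast

lemma dp_vanish:
  assumes "derived_projective D t P" "le (- 1) X"
  shows "hom_vanishes D P X"
proof -
  have X: "X \<in> Obj D" using assms le_obj by blast
  have "shO D (- 1) X \<in> fst t" using assms(2) le_shift[OF X, of 0 "- 1"] by (simp add: fst_t_iff)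
  then have "hom_vanishes D P (shO D 1 (shO D (- 1) X))"
    using assms(1) by (simp add: derived_projective_def)
  then show ?thesis using X by (simp add: shift_shift_obj shO_0)
qed

lemma dpI:
  assumes "le 0 P" "\<And>X. le (- 1) X \<Longrightarrow> hom_vanishes D P X"
  shows "derived_projective D t P"
  unfolding derived_projective_def fst_t_iff
proof (intro conjI ballI assms)
  fix X assume "X \<in> fst t"
  then show "le (- 1) (shO D 1 X)" using le_shift[of X "- 1" 1] le_obj by (simp add: fst_t_iff)
qed

lemma dp_retract:
  assumes "retract X Y" "derived_projective D t Y"
  shows "derived_projective D t X"
  using le_retract[OF assms(1) dp_le[OF assms(2)]]
    retract_vanish(1)[OF assms(1) dp_vanish[OF assms(2)] le_obj] by (rule dpI)

lemma dp_coproduct: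
  assumes c: "is_coproduct D I X Y \<iota>" and dp: "\<And>j. j \<in> I \<Longrightarrow> derived_projective D t (X j)"
  shows "derived_projective D t Y"
proof (rule dpI)
  show "le 0 Y"
  proof (rule leI)
    show "Y \<in> Obj D" using c by (simp add: coproduct_iff)
    fix Z assume "ge (0 + 1) Z"
    then have "ge 1 Z" by simp
    then show "hom_vanishes D Y Z"
      using t_vanish[OF dp_le[OF dp] _ zero_less_one] ge_obj by (intro coproduct_vanish[OF c]) auto
  qed
  show "hom_vanishes D Y X'" if "le (- 1) X'" for X'
    using dp_vanish[OF dp that] le_obj[OF that] by (rule coproduct_vanish[OF c, rotated])
qed

lemma dp_direct_sum:
  assumes "is_direct_sum D A B Y" "derived_projective D t A" "derived_projective D t B"
  shows "derived_projective D t Y"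
proof -
  obtain \<iota> where "is_coproduct D (UNIV :: bool set) (case_bool A B) Y \<iota>"
    using assms(1) unfolding is_direct_sum_def by blast
  then show ?thesis by (rule dp_coproduct) (use assms in \<open>auto split: bool.split\<close>)
qed

lemma cov_lift:
  assumes P: "derived_projective D t P" and c: "cov f X Y" and u: "arr u P Y"
  obtains v where "arr v P X" "f \<cdot> v = u"
proof -
  obtain C g h where t: "tri D X Y C f g h" "le (- 1) C" using c unfolding cov_def by blast
  have "g \<cdot> u = zero_mor D P C"
    using vanishD[OF dp_vanish[OF P t(2)] arr_comp[OF u tri_arr(2)[OF t(1)]]] .
  then show ?thesis using factor_first[OF t(1) u] that by metis
qed

text \<open>If \<open>f\<close> were nonzero on the cocone of \<open>f'\<close>, it would lift through it along an automorphism
  of \<open>P\<close>, forcing \<open>f' = 0\<close>.\<close>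

lemma dp_hom_factor:
  assumes P: "derived_projective D t P" and loc: "loc P"
    and L: "simple_object (heart D t) L" and L': "simple_object (heart D t) L'"
    and f: "arr f P L" and f': "arr f' P L'" "f' \<noteq> zero_mor D P L'"
  obtains u where "arr u L' L" "u \<cdot> f' = f"
proof -
  have o: "P \<in> Obj D" "L \<in> Obj D" "L' \<in> Obj D" using f f' arr_objs by auto
  have "cov f' P L'" using simple_cov[OF L' dp_le[OF P] f'] .
  then obtain C g h where t: "tri D P L' C f' g h" "le (- 1) C" unfolding cov_def by blast
  have C: "C \<in> Obj D" using t le_obj by blast
  obtain w where w: "tri D (shO D (- 1) C) P L' w f' g" using tri_rotate_back[OF t(1)] .
  let ?N = "shO D (- 1) C"
  note wa = tri_arr(1)[OF w]
  have N: "le 0 ?N" using le_shift[OF C, of 0 "- 1"] t(2) by simp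
  have fw: "arr (f \<cdot> w) ?N L" using wa f by (rule arr_comp)
  have "f \<cdot> w = zero_mor D ?N L"
  proof (rule ccontr)
    assume "f \<cdot> w \<noteq> zero_mor D ?N L"
    with simple_cov[OF L N fw] have "cov (f \<cdot> w) ?N L" .
    from cov_lift[OF P this f] obtain s where s: "arr s P ?N" "f \<cdot> w \<cdot> s = f" .
    have ws: "arr (w \<cdot> s) P P" using s(1) wa by (rule arr_comp)
    have fws: "f \<cdot> (w \<cdot> s) = f" using assoc[OF s(1) wa f] s(2) by simp
    have f0: "f \<noteq> zero_mor D P L"
      using \<open>f \<cdot> w \<noteq> zero_mor D ?N L\<close> zero_comp[OF wa o(2)] by metis
    obtain v where v: "arr v P P" "w \<cdot> s \<cdot> v = Idn D P"
      using locD[OF loc f f0 ws fws] unfolding iso_iff by blast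
    have "f' \<cdot> (w \<cdot> s) = zero_mor D P L'"
      using assoc[OF s(1) wa f'(1)] tri_comp_zero(1)[OF w] zero_comp[OF s(1) o(3)] by simp
    then have "f' = zero_mor D P L'"
      using assoc[OF v(1) ws f'(1)] v(2) id_right[OF f'(1)] zero_comp[OF v(1) o(3)] by simp
    then show False using f' by blast
  qed
  from factor_third[OF w f this] show ?thesis using that by metis
qed

lemma dp_unique:
  assumes P: "derived_projective D t P" "loc P"
    and P': "derived_projective D t P'" "loc P'"
    and L: "simple_object (heart D t) L"
    and f: "arr f P L" "f \<noteq> zero_mor D P L" and f': "arr f' P' L" "f' \<noteq> zero_mor D P' L"
  shows "isomorphic D P P'"
proof -
  obtain a where a: "arr a P P'" "f' \<cdot> a = f"
    using cov_lift[OF P(1) simple_cov[OF L dp_le[OF P'(1)] f'] f(1)] .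
  obtain b where b: "arr b P' P" "f \<cdot> b = f'"
    using cov_lift[OF P'(1) simple_cov[OF L dp_le[OF P(1)] f] f'(1)] .
  have ba: "arr (b \<cdot> a) P P" "f \<cdot> (b \<cdot> a) = f" using arr_comp a b assoc[OF a(1) b(1) f(1)] by auto
  have ab: "arr (a \<cdot> b) P' P'" "f' \<cdot> (a \<cdot> b) = f'" using arr_comp a b assoc[OF b(1) a(1) f'(1)] by auto
  obtain v where v: "arr v P P" "v \<cdot> (b \<cdot> a) = Idn D P"
    using locD[OF P(2) f ba] unfolding iso_iff by blast
  obtain w where w: "arr w P' P'" "a \<cdot> b \<cdot> w = Idn D P'"
    using locD[OF P'(2) f' ab] unfolding iso_iff by blast
  have "v \<cdot> b \<cdot> a = Idn D P" "a \<cdot> (b \<cdot> w) = Idn D P'"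
    using assoc[OF a(1) b(1) v(1)] assoc[OF w(1) b(1) a(1)] v w by auto
  from isoI_sections[OF a(1) arr_comp[OF b(1) v(1)] arr_comp[OF w(1) b(1)] this]
  show ?thesis unfolding isomorphic_def by blast
qed

section \<open>The cohomology functor on connective objects\<close>

definition reflection :: "'m \<Rightarrow> 'o \<Rightarrow> 'o \<Rightarrow> bool" where
  "reflection p X H \<longleftrightarrow> hrt H \<and> cov p X H \<and>
     (\<forall>Z g. hrt Z \<longrightarrow> arr g X Z \<longrightarrow> (\<exists>u. arr u H Z \<and> u \<cdot> p = g))"

lemma reflection_hrt: "reflection p X H \<Longrightarrow> hrt H"
  and reflection_cov: "reflection p X H \<Longrightarrow> cov p X H"
  and reflection_arr: "reflection p X H \<Longrightarrow> arr p X H"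
  by (auto simp: reflection_def cov_def)

lemma reflection_factor:
  assumes "reflection p X H" "hrt Z" "arr g X Z"
  obtains u where "arr u H Z" "u \<cdot> p = g"
  using assms unfolding reflection_def by blast

lemma reflection_unique:
  assumes p: "reflection p X H" and q: "reflection q X H'"
  shows "isomorphic D H H'"
proof -
  note ap = reflection_arr[OF p] and aq = reflection_arr[OF q]
  have o: "H \<in> Obj D" "H' \<in> Obj D" using ap aq arr_objs by auto
  obtain u where u: "arr u H H'" "u \<cdot> p = q" using reflection_factor[OF p reflection_hrt[OF q] aq] .
  obtain v where v: "arr v H' H" "v \<cdot> q = p" using reflection_factor[OF q reflection_hrt[OF p] ap] .
  have "v \<cdot> u = Idn D H"
    by (rule cov_cancel_eq[OF reflection_cov[OF p] hrt_ge[OF reflection_hrt[OF p]]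
          arr_comp[OF u(1) v(1)] arr_id[OF o(1)]])
       (simp add: assoc[OF ap u(1) v(1)] u v id_left[OF ap])
  moreover have "u \<cdot> v = Idn D H'"
    by (rule cov_cancel_eq[OF reflection_cov[OF q] hrt_ge[OF reflection_hrt[OF q]]
          arr_comp[OF v(1) u(1)] arr_id[OF o(2)]])
       (simp add: assoc[OF aq v(1) u(1)] u v id_left[OF aq])
  ultimately show ?thesis unfolding isomorphic_def iso_iff using u v by blast
qed

lemma trunc_triangle_spec:
  assumes "X \<in> Obj D"
  shows "case trunc_triangle D t n X of (A, B, i, p, h) \<Rightarrow> le n A \<and> ge (n + 1) B \<and> tri D A X B i p h"
proof -
  obtain A B i p h where "le n A" "ge (n + 1) B" "tri D A X B i p h" using truncation[OF assms] .
  then show ?thesis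
    unfolding trunc_triangle_def t_le_iff t_ge_iff
    by (intro someI[of "\<lambda>(A, B, i, p, h). le n A \<and> ge (n + 1) B \<and> tri D A X B i p h" "(A, B, i, p, h)"]) simp
qed

lemma trunc_le_triangle:
  assumes "X \<in> Obj D"
  obtains B p h where "le n (trunc_le D t n X)" "ge (n + 1) B"
    "tri D (trunc_le D t n X) X B (trunc_le_incl D t n X) p h"
  using trunc_triangle_spec[OF assms, of n] that
  unfolding trunc_le_def trunc_le_incl_def by (auto split: prod.splits)

lemma trunc_ge_triangle:
  assumes "X \<in> Obj D"
  obtains A i h where "le (n - 1) A" "ge n (trunc_ge D t n X)"
    "tri D A X (trunc_ge D t n X) i (trunc_ge_proj D t n X) h"
  using trunc_triangle_spec[OF assms, of "n - 1"] that
  unfolding trunc_ge_def trunc_ge_proj_def by (auto split: prod.splits)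

lemma trunc_le_mor:
  assumes f: "arr f X Y"
  shows "arr (trunc_le_mor D t n X Y f) (trunc_le D t n X) (trunc_le D t n Y)"
    and "trunc_le_incl D t n Y \<cdot> trunc_le_mor D t n X Y f = f \<cdot> trunc_le_incl D t n X"
proof -
  let ?A = "trunc_le D t n X" and ?A' = "trunc_le D t n Y"
  let ?i = "trunc_le_incl D t n X" and ?j = "trunc_le_incl D t n Y"
  obtain B p h where x: "le n ?A" "ge (n + 1) B" "tri D ?A X B ?i p h"
    using trunc_le_triangle arr_objs(1)[OF f] by blast
  obtain B' p' h' where y: "le n ?A'" "ge (n + 1) B'" "tri D ?A' Y B' ?j p' h'"
    using trunc_le_triangle arr_objs(2)[OF f] by blast
  note i = tri_arr(1)[OF x(3)] and j = tri_arr(1)[OF y(3)]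
  have o: "?A \<in> Obj D" "?A' \<in> Obj D" "B' \<in> Obj D" using x y le_obj ge_obj by auto
  have fi: "arr (f \<cdot> ?i) ?A Y" using i f by (rule arr_comp)
  have "p' \<cdot> (f \<cdot> ?i) = zero_mor D ?A B'"
    using vanishD[OF t_vanish[OF x(1) y(2)] arr_comp[OF fi tri_arr(2)[OF y(3)]]] by simp
  from factor_first[OF y(3) fi this] obtain g where g: "arr g ?A ?A'" "?j \<cdot> g = f \<cdot> ?i" .
  have uniq: "g' = g" if g': "arr g' ?A ?A'" "?j \<cdot> g' = f \<cdot> ?i" for g'
  proof (rule mono_of_zero[OF j g'(1) g(1)])
    show "?j \<cdot> g' = ?j \<cdot> g" using g g' by simp
    fix k assume k: "arr k ?A ?A'" "?j \<cdot> k = zero_mor D ?A Y"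
    obtain w where w: "tri D (shO D (- 1) B') ?A' Y w ?j p'" using tri_rotate_back[OF y(3)] .
    obtain v where v: "arr v ?A (shO D (- 1) B')" "w \<cdot> v = k" using factor_first[OF w k] .
    have "ge (n + 2) (shO D (- 1) B')" using ge_shift[OF o(3), of "n + 2" "- 1"] y(2) by (simp add: add.commute)
    then have "v = zero_mor D ?A (shO D (- 1) B')" using vanishD[OF t_vanish[OF x(1)] v(1)] by simp
    then show "k = zero_mor D ?A ?A'" using v comp_zero[OF tri_arr(1)[OF w] o(1)] by simp
  qed
  have *: "trunc_le_mor D t n X Y f = g"
    unfolding trunc_le_mor_def
  proof (rule the_equality)
    show "g \<in> hom_set D ?A ?A' \<and> ?j \<cdot> g = f \<cdot> ?i" using g by (simp add: arr_def)
    show "g' = g" if "g' \<in> hom_set D ?A ?A' \<and> ?j \<cdot> g' = f \<cdot> ?i" for g'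
      using that o by (intro uniq) (simp_all add: arr_def)
  qed
  show "arr (trunc_le_mor D t n X Y f) ?A ?A'" "?j \<cdot> trunc_le_mor D t n X Y f = f \<cdot> ?i"
    unfolding * using g by auto
qed

lemma trunc_ge_mor:
  assumes f: "arr f X Y"
  shows "arr (trunc_ge_mor D t n X Y f) (trunc_ge D t n X) (trunc_ge D t n Y)"
    and "trunc_ge_mor D t n X Y f \<cdot> trunc_ge_proj D t n X = trunc_ge_proj D t n Y \<cdot> f"
proof -
  let ?B = "trunc_ge D t n X" and ?B' = "trunc_ge D t n Y"
  let ?p = "trunc_ge_proj D t n X" and ?q = "trunc_ge_proj D t n Y"
  obtain A i h where x: "le (n - 1) A" "ge n ?B" "tri D A X ?B i ?p h"
    using trunc_ge_triangle arr_objs(1)[OF f] by blast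
  obtain A' i' h' where y: "le (n - 1) A'" "ge n ?B'" "tri D A' Y ?B' i' ?q h'"
    using trunc_ge_triangle arr_objs(2)[OF f] by blast
  note p = tri_arr(2)[OF x(3)] and q = tri_arr(2)[OF y(3)]
  have o: "?B \<in> Obj D" "?B' \<in> Obj D" "A \<in> Obj D" using x y le_obj ge_obj by auto
  have qf: "arr (?q \<cdot> f) X ?B'" using f q by (rule arr_comp)
  have "?q \<cdot> f \<cdot> i = zero_mor D A ?B'"
    using vanishD[OF t_vanish[OF x(1) y(2)] arr_comp[OF tri_arr(1)[OF x(3)] qf]] by simp
  from factor_third[OF x(3) qf this] obtain g where g: "arr g ?B ?B'" "g \<cdot> ?p = ?q \<cdot> f" .
  have uniq: "g' = g" if g': "arr g' ?B ?B'" "g' \<cdot> ?p = ?q \<cdot> f" for g'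
  proof (rule epi_of_zero[OF p g'(1) g(1)])
    show "g' \<cdot> ?p = g \<cdot> ?p" using g g' by simp
    fix k assume k: "arr k ?B ?B'" "k \<cdot> ?p = zero_mor D X ?B'"
    obtain v where v: "arr v (shO D 1 A) ?B'" "v \<cdot> h = k" using factor_shift[OF x(3) k] .
    have "le (n - 2) (shO D 1 A)" using le_shift[OF o(3), of "n - 2" 1] x(1) by simp
    then have "v = zero_mor D (shO D 1 A) ?B'" using vanishD[OF t_vanish[OF _ y(2)] v(1)] by simp
    then show "k = zero_mor D ?B ?B'" using v zero_comp[OF tri_arr(3)[OF x(3)] o(2)] by simp
  qed
  have *: "trunc_ge_mor D t n X Y f = g"
    unfolding trunc_ge_mor_def
  proof (rule the_equality)
    show "g \<in> hom_set D ?B ?B' \<and> g \<cdot> ?p = ?q \<cdot> f" using g by (simp add: arr_def)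
    show "g' = g" if "g' \<in> hom_set D ?B ?B' \<and> g' \<cdot> ?p = ?q \<cdot> f" for g'
      using that o by (intro uniq) (simp_all add: arr_def)
  qed
  show "arr (trunc_ge_mor D t n X Y f) ?B ?B'" "trunc_ge_mor D t n X Y f \<cdot> ?p = ?q \<cdot> f"
    unfolding * using g by auto
qed

definition trunc_le_inv :: "'o \<Rightarrow> 'm" where
  "trunc_le_inv X = (SOME j. arr j X (trunc_le D t 0 X) \<and>
     trunc_le_incl D t 0 X \<cdot> j = Idn D X \<and> j \<cdot> trunc_le_incl D t 0 X = Idn D (trunc_le D t 0 X))"

lemma trunc_le_inv:
  assumes X: "le 0 X"
  shows "arr (trunc_le_inv X) X (trunc_le D t 0 X)"
    "trunc_le_incl D t 0 X \<cdot> trunc_le_inv X = Idn D X"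
    "trunc_le_inv X \<cdot> trunc_le_incl D t 0 X = Idn D (trunc_le D t 0 X)"
    "arr (trunc_le_incl D t 0 X) (trunc_le D t 0 X) X"
    "le 0 (trunc_le D t 0 X)"
proof -
  let ?A = "trunc_le D t 0 X" and ?i = "trunc_le_incl D t 0 X"
  obtain B p h where x: "le 0 ?A" "ge (0 + 1) B" "tri D ?A X B ?i p h"
    using trunc_le_triangle[OF le_obj[OF X]] .
  show "arr ?i ?A X" "le 0 ?A" using x tri_arr by auto
  have A1: "le (- 1) (shO D 1 ?A)" using x(1) le_shift[OF le_obj[OF x(1)]] by simp
  have "le 0 B" using le_ext[OF tri_rotate[OF x(3)] X le_mono[OF A1]] by simp
  then have "zero_object D B" using x(2) le_ge_zero by simp
  from tri_zero_third_is_iso[OF x(3) this]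
  have "\<exists>j. arr j X ?A \<and> ?i \<cdot> j = Idn D X \<and> j \<cdot> ?i = Idn D ?A"
    unfolding iso_iff by blast
  from someI_ex[OF this]
  show "arr (trunc_le_inv X) X ?A" "?i \<cdot> trunc_le_inv X = Idn D X" "trunc_le_inv X \<cdot> ?i = Idn D ?A"
    unfolding trunc_le_inv_def by auto
qed

definition eta :: "'o \<Rightarrow> 'm" where
  "eta X = trunc_ge_proj D t 0 (trunc_le D t 0 X) \<cdot> trunc_le_inv X"

lemma eta_reflection:
  assumes X: "le 0 X"
  shows "reflection (eta X) X (H0 D t X)"
proof -
  let ?A = "trunc_le D t 0 X" and ?i = "trunc_le_incl D t 0 X" and ?j = "trunc_le_inv X"
  let ?H = "H0 D t X" and ?r = "trunc_ge_proj D t 0 (trunc_le D t 0 X)"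
  note j = trunc_le_inv[OF X]
  obtain N m h where y: "le (0 - 1) N" "ge 0 (trunc_ge D t 0 ?A)"
      "tri D N ?A (trunc_ge D t 0 ?A) m ?r h"
    using trunc_ge_triangle[OF le_obj[OF j(5)]] .
  then have y: "le (- 1) N" "ge 0 ?H" "tri D N ?A ?H m ?r h" by (simp_all add: H0_def)
  have oN: "N \<in> Obj D" using y le_obj by blast
  have "le (- 2) (shO D 1 N)" using y(1) le_shift[OF oN] by simp
  then have N1: "le (- 1) (shO D 1 N)" by (rule le_mono) simp
  have H: "hrt ?H" unfolding hrt_def using y(2) le_ext[OF tri_rotate[OF y(3)] j(5) le_mono[OF N1]] by simp
  note r = tri_arr(2)[OF y(3)]
  have cr: "cov ?r ?A ?H" unfolding cov_def using r tri_rotate[OF y(3)] N1 by blast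
  have e: "arr (eta X) X ?H" unfolding eta_def using j(1) r by (rule arr_comp)
  have ei: "eta X \<cdot> ?i = ?r" unfolding eta_def using assoc[OF j(4,1) r] j(3) id_right[OF r] by simp
  have "cov (eta X) X ?H"
  proof (rule cov_of_epi[OF X hrt_le[OF H] e])
    fix Z k assume Z: "hrt Z" and k: "arr k ?H Z" "k \<cdot> eta X = zero_mor D X Z"
    have "k \<cdot> ?r = zero_mor D ?A Z"
      using ei assoc[OF j(4) e k(1)] k(2) zero_comp[OF j(4) hrt_obj[OF Z]] by simp
    from cov_cancel[OF cr hrt_ge[OF Z] k(1) this] show "k = zero_mor D ?H Z" .
  qed
  moreover have "\<exists>u. arr u ?H Z \<and> u \<cdot> eta X = g" if Z: "hrt Z" and g: "arr g X Z" for Z g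
  proof -
    have gi: "arr (g \<cdot> ?i) ?A Z" using j(4) g by (rule arr_comp)
    have "g \<cdot> ?i \<cdot> m = zero_mor D N Z"
      using vanishD[OF t_vanish[OF y(1) hrt_ge[OF Z]] arr_comp[OF tri_arr(1)[OF y(3)] gi]] by simp
    from factor_third[OF y(3) gi this] obtain u where u: "arr u ?H Z" "u \<cdot> ?r = g \<cdot> ?i" .
    have "u \<cdot> eta X = g"
      unfolding eta_def using assoc[OF j(1) r u(1)] u(2) assoc[OF j(1,4) g] j(2) id_right[OF g] by simp
    then show ?thesis using u by blast
  qed
  ultimately show ?thesis unfolding reflection_def using H by blast
qed

lemma H0_mor_natural:
  assumes X: "le 0 X" and Y: "le 0 Y" and f: "arr f X Y"
  shows "arr (H0_mor D t X Y f) (H0 D t X) (H0 D t Y)"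
    and "H0_mor D t X Y f \<cdot> eta X = eta Y \<cdot> f"
proof -
  let ?m = "trunc_le_mor D t 0 X Y f" and ?M = "H0_mor D t X Y f"
  let ?r = "trunc_ge_proj D t 0 (trunc_le D t 0 X)" and ?s = "trunc_ge_proj D t 0 (trunc_le D t 0 Y)"
  note j = trunc_le_inv[OF X] and k = trunc_le_inv[OF Y]
  note m = trunc_le_mor[OF f, of 0]
  have M: "arr ?M (H0 D t X) (H0 D t Y)" "?M \<cdot> ?r = ?s \<cdot> ?m"
    using trunc_ge_mor[OF m(1), of 0] unfolding H0_def H0_mor_def by auto
  show "arr ?M (H0 D t X) (H0 D t Y)" using M(1) .
  obtain N n h where "tri D N (trunc_le D t 0 X) (trunc_ge D t 0 (trunc_le D t 0 X)) n ?r h"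
    using trunc_ge_triangle[OF le_obj[OF j(5)]] .
  then have r: "arr ?r (trunc_le D t 0 X) (H0 D t X)" using tri_arr unfolding H0_def by blast
  obtain N' n' h' where "tri D N' (trunc_le D t 0 Y) (trunc_ge D t 0 (trunc_le D t 0 Y)) n' ?s h'"
    using trunc_ge_triangle[OF le_obj[OF k(5)]] .
  then have s: "arr ?s (trunc_le D t 0 Y) (H0 D t Y)" using tri_arr unfolding H0_def by blast
  have mj: "arr (?m \<cdot> trunc_le_inv X) X (trunc_le D t 0 Y)" using j(1) m(1) by (rule arr_comp)
  have "trunc_le_incl D t 0 Y \<cdot> (?m \<cdot> trunc_le_inv X) = f"
    using assoc[OF j(1) m(1) k(4)] m(2) assoc[OF j(1,4) f] j(2) id_right[OF f] by simp
  then have "?m \<cdot> trunc_le_inv X = trunc_le_inv Y \<cdot> f"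
    using comp_cancel[OF mj k(4,1,3)] by simp
  then show "?M \<cdot> eta X = eta Y \<cdot> f"
    unfolding eta_def using assoc[OF j(1) r M(1)] M(2) assoc[OF j(1) m(1) s] assoc[OF f k(1) s] by simp
qed

section \<open>Derived projective covers of simple objects\<close>

lemma dp_reflection_projective:
  assumes P: "derived_projective D t P" and p: "reflection p P H"
  shows "projective_object (heart D t) H"
  unfolding projective_object_def
proof (intro conjI allI impI ballI)
  show "H \<in> Obj (heart D t)" using reflection_hrt[OF p] by simp
  fix X Y e f assume e: "is_epi (heart D t) X Y e" and "f \<in> hom_set (heart D t) H Y"
  note d = heart_epiD[OF e]
  note pa = reflection_arr[OF p]
  have f: "arr f H Y" using \<open>f \<in> _\<close> d hrt_obj reflection_hrt[OF p] by (simp add: arr_def)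
  obtain v where v: "arr v P X" "e \<cdot> v = f \<cdot> p"
    using cov_lift[OF P heart_epi_cov[OF e] arr_comp[OF pa f]] .
  obtain g where g: "arr g H X" "g \<cdot> p = v" using reflection_factor[OF p d(1) v(1)] .
  have "e \<cdot> g = f"
    by (rule cov_cancel_eq[OF reflection_cov[OF p] hrt_ge[OF d(2)] arr_comp[OF g(1) d(3)] f])
       (simp add: assoc[OF pa g(1) d(3)] g v)
  then show "\<exists>g\<in>hom_set (heart D t) H X. e \<cdot>\<^bsub>heart D t\<^esub> g = f" using g(1) by (auto simp: arr_def)
qed

lemma simple_dp_cover:
  assumes P: "derived_projective D t P" and loc: "loc P"
    and L: "simple_object (heart D t) L" and f: "arr f P L" "f \<noteq> zero_mor D P L"
  shows "derived_projective_cover D t P L f"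
proof -
  note Ple = dp_le[OF P] and Lle = simple_le[OF L]
  let ?H = "H0 D t P" and ?G = "H0 D t L" and ?F = "H0_mor D t P L f"
  note eP = eta_reflection[OF Ple] and eL = eta_reflection[OF Lle]
  note p = reflection_arr[OF eP] and l = reflection_arr[OF eL]
  note F = H0_mor_natural[OF Ple Lle f(1)]
  note cf = simple_cov[OF L Ple f]
  have o: "L \<in> Obj D" "P \<in> Obj D" using f arr_objs by auto
  obtain l' where l': "arr l' ?G L" "l' \<cdot> eta L = Idn D L"
    using reflection_factor[OF eL simple_hrt[OF L] arr_id[OF o(1)]] .
  have epi: "is_epi (heart D t) ?H ?G ?F"
  proof (rule heart_epiI[OF reflection_hrt[OF eP] reflection_hrt[OF eL] F(1)])
    fix Z k assume Z: "hrt Z" and k: "arr k ?G Z" "k \<cdot> ?F = zero_mor D ?H Z"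
    have "k \<cdot> eta L \<cdot> f = zero_mor D P Z"
      using assoc[OF f(1) l k(1)] F(2) assoc[OF p F(1) k(1)] k(2) zero_comp[OF p hrt_obj[OF Z]] by simp
    from cov_cancel[OF cf hrt_ge[OF Z] arr_comp[OF l k(1)] this]
    show "k = zero_mor D ?G Z" using cov_cancel[OF reflection_cov[OF eL] hrt_ge[OF Z] k(1)] by blast
  qed
  have proj: "projective_object (heart D t) ?H" using dp_reflection_projective[OF P eP] .
  have ess: "is_epi (heart D t) Y ?H g"
    if Y: "Y \<in> Obj (heart D t)" and g': "g \<in> hom_set (heart D t) Y ?H"
      and e: "is_epi (heart D t) Y ?G (?F \<cdot>\<^bsub>heart D t\<^esub> g)" for Y g
  proof -
    have Yh: "hrt Y" using Y by simp
    have g: "arr g Y ?H" using g' hrt_obj[OF Yh] arr_objs(2)[OF p] by (simp add: arr_def)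
    have "?F \<in> hom_set (heart D t) ?H ?G" using F(1) by (simp add: arr_def)
    then obtain s where s: "s \<in> hom_set (heart D t) ?H Y" "?F \<cdot> g \<cdot> s = ?F"
      using proj[unfolded projective_object_def, THEN conjunct2, rule_format, OF e] by auto
    have sa: "arr s ?H Y" using s(1) hrt_obj[OF Yh] arr_objs(2)[OF p] by (simp add: arr_def)
    have gs: "arr (g \<cdot> s) ?H ?H" using sa g by (rule arr_comp)
    obtain a where a: "arr a P P" "eta P \<cdot> a = g \<cdot> s \<cdot> eta P"
      using cov_lift[OF P reflection_cov[OF eP] arr_comp[OF p gs]] .
    have fa: "arr (f \<cdot> a) P L" using a(1) f(1) by (rule arr_comp)
    have "eta L \<cdot> (f \<cdot> a) = eta L \<cdot> f"
    proof -
      have "eta L \<cdot> (f \<cdot> a) = ?F \<cdot> (eta P \<cdot> a)"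
        using assoc[OF a(1) f(1) l] F(2) assoc[OF a(1) p F(1)] by simp
      also have "\<dots> = ?F \<cdot> (g \<cdot> s) \<cdot> eta P" using a(2) assoc[OF p gs F(1)] by simp
      also have "\<dots> = ?F \<cdot> eta P" using assoc[OF sa g F(1)] s(2) by simp
      finally show ?thesis using F(2) by simp
    qed
    then have "f \<cdot> a = f"
      using comp_cancel[OF fa l l'] comp_cancel[OF f(1) l l'] by simp
    from locD[OF loc f a(1) this]
    obtain w where w: "arr w P P" "a \<cdot> w = Idn D P" unfolding iso_iff by blast
    have key: "g \<cdot> (s \<cdot> (eta P \<cdot> w)) = eta P"
    proof -
      have pw: "arr (eta P \<cdot> w) P ?H" using w(1) p by (rule arr_comp)
      have "g \<cdot> (s \<cdot> (eta P \<cdot> w)) = g \<cdot> s \<cdot> eta P \<cdot> w"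
        using assoc[OF pw sa g] assoc[OF w(1) p gs] by simp
      also have "\<dots> = eta P \<cdot> (a \<cdot> w)" using a(2) assoc[OF w(1) a(1) p] by simp
      finally show ?thesis using w(2) id_right[OF p] by simp
    qed
    show ?thesis
    proof (rule heart_epiI[OF Yh reflection_hrt[OF eP] g])
      fix Z k assume Z: "hrt Z" and k: "arr k ?H Z" "k \<cdot> g = zero_mor D Y Z"
      have spw: "arr (s \<cdot> (eta P \<cdot> w)) P Y" using arr_comp[OF arr_comp[OF w(1) p] sa] .
      have "k \<cdot> eta P = zero_mor D P Z"
        using key assoc[OF spw g k(1)] k(2) zero_comp[OF spw hrt_obj[OF Z]] by simp
      then show "k = zero_mor D ?H Z"
        using cov_cancel[OF reflection_cov[OF eP] hrt_ge[OF Z] k(1)] by blast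
    qed
  qed
  show ?thesis
    unfolding derived_projective_cover_def projective_cover_def
    using o P f(1) proj epi ess by (auto simp: arr_def)
qed

lemma dp_coverD:
  assumes c: "derived_projective_cover D t P L q" and L: "simple_object (heart D t) L"
  shows "derived_projective D t P" "arr q P L" "q \<noteq> zero_mor D P L"
proof -
  show P: "derived_projective D t P" using c by (simp add: derived_projective_cover_def)
  show q: "arr q P L"
    using c dp_obj[OF P] by (auto simp: derived_projective_cover_def arr_def)
  note Ple = dp_le[OF P] and Lle = simple_le[OF L]
  note eP = eta_reflection[OF Ple] and eL = eta_reflection[OF Lle]
  note p = reflection_arr[OF eP] and l = reflection_arr[OF eL]
  note F = H0_mor_natural[OF Ple Lle q]
  have o: "L \<in> Obj D" "H0 D t L \<in> Obj D" "H0 D t P \<in> Obj D" using q l p arr_objs by auto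
  have e: "is_epi (heart D t) (H0 D t P) (H0 D t L) (H0_mor D t P L q)"
    using c by (simp add: derived_projective_cover_def projective_cover_def)
  show "q \<noteq> zero_mor D P L"
  proof
    assume q0: "q = zero_mor D P L"
    have "H0_mor D t P L q \<cdot> eta P = zero_mor D P (H0 D t L)"
      using F(2) q0 comp_zero[OF l dp_obj[OF P]] by simp
    then have "H0_mor D t P L q = zero_mor D (H0 D t P) (H0 D t L)"
      using cov_cancel[OF reflection_cov[OF eP] hrt_ge[OF reflection_hrt[OF eL]] F(1)] by simp
    then have "Idn D (H0 D t L) \<cdot> H0_mor D t P L q = zero_mor D (H0 D t L) (H0 D t L) \<cdot> H0_mor D t P L q"
      using id_left[OF F(1)] zero_comp[OF F(1) o(2)] by simp
    from heart_epiD(4)[OF e reflection_hrt[OF eL] arr_id[OF o(2)] arr_zero[OF o(2,2)] this]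
    have "eta L = zero_mor D L (H0 D t L)" using id_left[OF l] zero_comp[OF l o(2)] by simp
    moreover obtain l' where "arr l' (H0 D t L) L" "l' \<cdot> eta L = Idn D L"
      using reflection_factor[OF eL simple_hrt[OF L] arr_id[OF o(1)]] .
    ultimately have "Idn D L = zero_mor D L L" using comp_zero o(1) by metis
    then show False using zero_objectI[OF o(1)] simple_nonzero[OF L] by blast
  qed
qed

lemma dp_cover_unique:
  assumes c: "derived_projective_cover D t P L q" and L: "simple_object (heart D t) L"
    and P': "derived_projective D t P'" and loc: "loc P'"
    and f: "arr f P' L" "f \<noteq> zero_mor D P' L"
  shows "isomorphic D P' P"
proof -
  note q = dp_coverD[OF c L]
  note Ple = dp_le[OF q(1)] and Ple' = dp_le[OF P'] and Lle = simple_le[OF L]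
  let ?H = "H0 D t P" and ?H' = "H0 D t P'" and ?G = "H0 D t L"
  let ?F = "H0_mor D t P L q"
  obtain a where a: "arr a P P'" "f \<cdot> a = q"
    using cov_lift[OF q(1) simple_cov[OF L Ple' f] q(2)] .
  obtain b where b: "arr b P' P" "q \<cdot> b = f"
    using cov_lift[OF P' simple_cov[OF L Ple q(2,3)] f(1)] .
  let ?B = "H0_mor D t P' P b"
  note eP = eta_reflection[OF Ple] and eP' = eta_reflection[OF Ple'] and eL = eta_reflection[OF Lle]
  note p = reflection_arr[OF eP] and p' = reflection_arr[OF eP'] and l = reflection_arr[OF eL]
  note F = H0_mor_natural[OF Ple Lle q(2)] and B = H0_mor_natural[OF Ple' Ple b(1)]
  have FB: "arr (?F \<cdot> ?B) ?H' ?G" using B(1) F(1) by (rule arr_comp)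
  have nat: "?F \<cdot> ?B \<cdot> eta P' = eta L \<cdot> f"
    using assoc[OF p' B(1) F(1)] B(2) assoc[OF b(1) p F(1)] F(2) assoc[OF b(1) q(2) l] b(2) by simp
  have "is_epi (heart D t) ?H' ?G (?F \<cdot> ?B)"
  proof (rule heart_epiI[OF reflection_hrt[OF eP'] reflection_hrt[OF eL] FB])
    fix Z k assume Z: "hrt Z" and k: "arr k ?G Z" "k \<cdot> (?F \<cdot> ?B) = zero_mor D ?H' Z"
    have "k \<cdot> eta L \<cdot> f = zero_mor D P' Z"
      using assoc[OF f(1) l k(1)] nat assoc[OF p' FB k(1)] k(2) zero_comp[OF p' hrt_obj[OF Z]] by simp
    from cov_cancel[OF simple_cov[OF L Ple' f] hrt_ge[OF Z] arr_comp[OF l k(1)] this]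
    show "k = zero_mor D ?G Z" using cov_cancel[OF reflection_cov[OF eL] hrt_ge[OF Z] k(1)] by blast
  qed
  moreover have "?B \<in> hom_set (heart D t) ?H' ?H" using B(1) by (simp add: arr_def)
  ultimately have Be: "is_epi (heart D t) ?H' ?H ?B"
    using c reflection_hrt[OF eP'] unfolding derived_projective_cover_def projective_cover_def by auto
  have "cov b P' P"
  proof (rule cov_of_epi[OF Ple' Ple b(1)])
    fix Z k assume Z: "hrt Z" and k: "arr k P Z" "k \<cdot> b = zero_mor D P' Z"
    obtain u where u: "arr u ?H Z" "u \<cdot> eta P = k" using reflection_factor[OF eP Z k(1)] .
    have "u \<cdot> ?B \<cdot> eta P' = zero_mor D P' Z"
      using assoc[OF p' B(1) u(1)] B(2) assoc[OF b(1) p u(1)] u(2) k(2) by simp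
    from cov_cancel[OF reflection_cov[OF eP'] hrt_ge[OF Z] arr_comp[OF B(1) u(1)] this]
    have "u \<cdot> ?B = zero_mor D ?H' Z" .
    then have "u = zero_mor D ?H Z"
      using cov_cancel[OF heart_epi_cov[OF Be] hrt_ge[OF Z] u(1)] by blast
    then show "k = zero_mor D P Z" using u(2) zero_comp[OF p hrt_obj[OF Z]] by simp
  qed
  from cov_lift[OF q(1) this arr_id[OF dp_obj[OF q(1)]]]
  obtain s where s: "arr s P P'" "b \<cdot> s = Idn D P" .
  have "f \<cdot> (a \<cdot> b) = f" using assoc[OF b(1) a(1) f(1)] a b by simp
  from locD[OF loc f arr_comp[OF b(1) a(1)] this]
  obtain w where w: "arr w P' P'" "w \<cdot> (a \<cdot> b) = Idn D P'" unfolding iso_iff by blast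
  have "w \<cdot> a \<cdot> b = Idn D P'" using assoc[OF b(1) a(1) w(1)] w(2) by simp
  from isoI_sections[OF b(1) arr_comp[OF a(1) w(1)] s(1) this s(2)]
  show ?thesis unfolding isomorphic_def by blast
qed

end

section \<open>Krull--Schmidt categories\<close>

lemma (in linear_category) full_linear_category:
  assumes "T \<subseteq> Obj C"
  shows "linear_category K (full_subcategory C T)"
proof -
  have d: "X \<in> T \<Longrightarrow> X \<in> Obj C" for X using assms by blast
  show ?thesis
  proof (intro linear_category.intro linear_category_axioms.intro K.field_axioms,
      unfold full_subcategory_simps, goal_cases)
    case 1 then show ?case by (rule hom_module[OF d d])
  next
    case 2 then show ?case by (rule Idn_closed[OF d])
  next
    case 3 then show ?case by (rule comp_closed[OF d d d])
  next
    case 4 then show ?case by (rule comp_assoc[OF d d d d])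
  next
    case 5 then show ?case by (rule comp_Idn_left[OF d d])
  next
    case 6 then show ?case by (rule comp_Idn_right[OF d d])
  next
    case 7 then show ?case by (rule comp_add_left[OF d d d])
  next
    case 8 then show ?case by (rule comp_add_right[OF d d d])
  next
    case 9 then show ?case by (rule comp_smult_left[OF d d d])
  next
    case 10 then show ?case by (rule comp_smult_right[OF d d d])
  qed
qed

lemma (in linear_category) full_coproduct:
  assumes "is_coproduct C I X Y \<iota>" "T \<subseteq> Obj C" "Y \<in> T" "\<And>j. j \<in> I \<Longrightarrow> X j \<in> T"
  shows "is_coproduct (full_subcategory C T) I X Y \<iota>"
  using assms unfolding is_coproduct_def full_subcategory_simps by blast

lemma endo_ring_full [simp]: "endo_ring (full_subcategory C T) X = endo_ring C X"
  by (simp add: endo_ring_def)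

context triangulated_category
begin

lemma Kar_iff:
  "X \<in> Kar D S \<longleftrightarrow> (\<exists>(n::nat) Y Z \<iota>. (\<forall>j<n. Y j \<in> S) \<and> is_coproduct D {..<n} Y Z \<iota> \<and> retract X Z)"
  unfolding Kar_def retract_direct_summand retract_def using arr_objs by blast

lemma Kar_retract: "retract X Y \<Longrightarrow> Y \<in> Kar D S \<Longrightarrow> X \<in> Kar D S"
  unfolding Kar_iff using retract_trans by blast

lemma zero_object_Kar:
  assumes "zero_object D Z"
  shows "Z \<in> Kar D S"
  unfolding Kar_iff
proof (rule exI[of _ 0], rule exI[of _ undefined], rule exI[of _ Z], rule exI[of _ undefined], intro conjI)
  show "is_coproduct D {..<0::nat} undefined Z undefined" using coproduct_empty[OF assms] by simp
  show "retract Z Z" using assms retract_refl by (simp add: zero_object_def)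
qed simp

lemma direct_sum_Kar:
  assumes A: "A \<in> Kar D S" and B: "B \<in> Kar D S" and Y: "is_direct_sum D A B Y"
  shows "Y \<in> Kar D S"
proof -
  obtain m X1 Z1 \<iota>1 where 1: "\<forall>j<m. X1 j \<in> S" "is_coproduct D {..<m::nat} X1 Z1 \<iota>1" "retract A Z1"
    using A unfolding Kar_iff by blast
  obtain n X2 Z2 \<iota>2 where 2: "\<forall>j<n. X2 j \<in> S" "is_coproduct D {..<n::nat} X2 Z2 \<iota>2" "retract B Z2"
    using B unfolding Kar_iff by blast
  have "Z1 \<in> Obj D" "Z2 \<in> Obj D" using 1 2 by (auto simp: coproduct_iff)
  then obtain W where W: "is_direct_sum D Z1 Z2 W" using ex_direct_sum by blast
  obtain \<kappa> where k: "is_coproduct D {..<m + n} (\<lambda>j. if j < m then X1 j else X2 (j - m)) W \<kappa>"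
    using coproduct_append[OF 1(2) 2(2) W] .
  have S: "\<forall>j<m + n. (if j < m then X1 j else X2 (j - m)) \<in> S"
    using 1(1) 2(1) by (simp add: less_diff_conv2 add.commute)
  obtain i1 r1 where r1: "arr i1 A Z1" "arr r1 Z1 A" "r1 \<cdot> i1 = Idn D A" using 1(3) unfolding retract_def by blast
  obtain i2 r2 where r2: "arr i2 B Z2" "arr r2 Z2 B" "r2 \<cdot> i2 = Idn D B" using 2(3) unfolding retract_def by blast
  obtain a b where a: "arr a A Y" "arr b B Y"
    and am: "\<And>Z f g. arr f A Z \<Longrightarrow> arr g B Z \<Longrightarrow> \<exists>h. arr h Y Z \<and> h \<cdot> a = f \<and> h \<cdot> b = g"
    and ae: "\<And>Z g h. arr g Y Z \<Longrightarrow> arr h Y Z \<Longrightarrow> g \<cdot> a = h \<cdot> a \<Longrightarrow> g \<cdot> b = h \<cdot> b \<Longrightarrow> g = h"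
    using Y unfolding direct_sum_iff by blast
  obtain c d where c: "arr c Z1 W" "arr d Z2 W"
    and cm: "\<And>Z f g. arr f Z1 Z \<Longrightarrow> arr g Z2 Z \<Longrightarrow> \<exists>h. arr h W Z \<and> h \<cdot> c = f \<and> h \<cdot> d = g"
    using W unfolding direct_sum_iff by blast
  obtain i where i: "arr i Y W" "i \<cdot> a = c \<cdot> i1" "i \<cdot> b = d \<cdot> i2"
    using am[OF arr_comp[OF r1(1) c(1)] arr_comp[OF r2(1) c(2)]] by blast
  obtain r where r: "arr r W Y" "r \<cdot> c = a \<cdot> r1" "r \<cdot> d = b \<cdot> r2"
    using cm[OF arr_comp[OF r1(2) a(1)] arr_comp[OF r2(2) a(2)]] by blast
  have Yo: "Y \<in> Obj D" using a arr_objs by blast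
  have "r \<cdot> i = Idn D Y"
  proof (rule ae[OF arr_comp[OF i(1) r(1)] arr_id[OF Yo]])
    have "r \<cdot> i \<cdot> a = r \<cdot> c \<cdot> i1" using assoc[OF a(1) i(1) r(1)] i(2) assoc[OF r1(1) c(1) r(1)] by simp
    also have "\<dots> = a" using r(2) assoc[OF r1(1,2) a(1)] r1(3) id_right[OF a(1)] by simp
    finally show "r \<cdot> i \<cdot> a = Idn D Y \<cdot> a" using id_left[OF a(1)] by simp
    have "r \<cdot> i \<cdot> b = r \<cdot> d \<cdot> i2" using assoc[OF a(2) i(1) r(1)] i(3) assoc[OF r2(1) c(2) r(1)] by simp
    also have "\<dots> = b" using r(3) assoc[OF r2(1,2) a(2)] r2(3) id_right[OF a(2)] by simp
    finally show "r \<cdot> i \<cdot> b = Idn D Y \<cdot> b" using id_left[OF a(2)] by simp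
  qed
  then have "retract Y W" unfolding retract_def using i(1) r(1) by blast
  then show ?thesis unfolding Kar_iff
    by (intro exI[of _ "m + n"] exI[of _ "\<lambda>j. if j < m then X1 j else X2 (j - m)"] exI[of _ W]
        exI[of _ \<kappa>] conjI S k)
qed

lemma krull_schmidt_Kar:
  assumes ks: "krull_schmidt K D"
  shows "krull_schmidt K (full_subcategory D (Kar D S))"
  unfolding krull_schmidt_def
proof (intro conjI ballI)
  let ?E = "full_subcategory D (Kar D S)"
  have sub: "Kar D S \<subseteq> Obj D" unfolding Kar_def by blast
  interpret E: linear_category K ?E using full_linear_category[OF sub] .
  show "additive_category K ?E"
  proof unfold_locales
    obtain Z where Z: "zero_object D Z" using ex_zero_object by blast
    have "zero_object ?E Z"
      using Z zero_object_Kar[OF Z] sub unfolding zero_object_def hom_vanishes_def full_subcategory_simps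
      by blast
    then show "\<exists>Z. zero_object ?E Z" by blast
    fix A B assume "A \<in> Obj ?E" "B \<in> Obj ?E"
    then have AB: "A \<in> Kar D S" "B \<in> Kar D S" by auto
    then obtain Y where Y: "is_direct_sum D A B Y" using ex_direct_sum sub by blast
    then obtain \<iota> where "is_coproduct D (UNIV :: bool set) (case_bool A B) Y \<iota>"
      unfolding is_direct_sum_def by blast
    then have "is_coproduct ?E (UNIV :: bool set) (case_bool A B) Y \<iota>"
      by (rule full_coproduct[OF _ sub direct_sum_Kar[OF AB Y]]) (use AB in \<open>auto split: bool.split\<close>)
    then show "\<exists>Y. is_direct_sum ?E A B Y" unfolding is_direct_sum_def by blast
  qed
  fix X assume "X \<in> Obj ?E"
  then have X: "X \<in> Kar D S" by simp
  then have "X \<in> Obj D" using sub by blast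
  then obtain n Y \<iota> where c: "is_coproduct D {..<n::nat} Y X \<iota>" and l: "\<forall>j<n. local_ring (endo_ring D (Y j))"
    using ks unfolding krull_schmidt_def by blast
  have "is_coproduct ?E {..<n} Y X \<iota>"
    using Kar_retract[OF coproduct_component_retract[OF c] X] by (rule full_coproduct[OF c sub X])
  then show "\<exists>(n::nat) Y \<iota>. is_coproduct ?E {..<n} Y X \<iota> \<and> (\<forall>j<n. local_ring (endo_ring ?E (Y j)))"
    using l unfolding endo_ring_full by blast
qed

lemma krull_schmidt_decomposition:
  assumes "krull_schmidt K D" "X \<in> Obj D"
  obtains n Y \<iota> where "is_coproduct D {..<n::nat} Y X \<iota>"
    "\<And>j. j < n \<Longrightarrow> loc (Y j)" "\<And>j. j < n \<Longrightarrow> \<not> zero_object D (Y j)"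
proof -
  obtain n Y \<iota> where c: "is_coproduct D {..<n::nat} Y X \<iota>" and l: "\<forall>j<n. local_ring (endo_ring D (Y j))"
    using assms unfolding krull_schmidt_def by blast
  have "Y j \<in> Obj D" if "j < n" for j using coproduct_arr[OF c, of j] arr_objs that by auto
  then show ?thesis using that[OF c] l local_ring_loc local_nonzero by blast
qed

lemma indecomposable_loc:
  assumes ks: "krull_schmidt K D" and X: "indecomposable D X"
  shows "loc X"
proof -
  have Xo: "X \<in> Obj D" "\<not> zero_object D X" using X by (auto simp: indecomposable_def)
  obtain n Y \<iota> where c: "is_coproduct D {..<n::nat} Y X \<iota>"
    and l: "\<And>j. j < n \<Longrightarrow> loc (Y j)" and z: "\<And>j. j < n \<Longrightarrow> \<not> zero_object D (Y j)"
    using krull_schmidt_decomposition[OF ks Xo(1)] by metis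
  have "n \<noteq> 0"
  proof
    assume "n = 0"
    then have "Idn D X = zero_mor D X X"
      by (intro coproduct_eq[OF c arr_id[OF Xo(1)] arr_zero[OF Xo(1,1)]]) simp
    then show False using zero_objectI Xo by blast
  qed
  then have n: "0 < n" "0 \<in> {..<n}" by auto
  have "direct_summand D (Y 0) X"
    unfolding retract_direct_summand using coproduct_component_retract[OF c n(2)] .
  then obtain X' where s: "is_direct_sum D (Y 0) X' X" unfolding direct_summand_def by blast
  then have "zero_object D X'" using X z[OF n(1)] unfolding indecomposable_def by blast
  from direct_sum_zero_iso[OF s this] show ?thesis using loc_iso l[OF n(1)] by blast
qed

end

section \<open>Detecting simple objects by derived projectives\<close>

locale ks_t_category = t_category K D t
  for K :: "'k ring" and D :: "('k, 'o, 'm, 'z) tri_cat_scheme" (structure) and t +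
  assumes ks: "krull_schmidt K D"
    and nondeg: "nondegenerate D t"
    and finlen: "finite_length_category (heart D t)"
begin

abbreviation "dp \<equiv> derived_projective D t"
abbreviation "simple \<equiv> simple_object (heart D t)"

definition detects :: "bool" where
  "detects \<longleftrightarrow> (\<forall>L. simple L \<longrightarrow> (\<exists>P. dp P \<and> \<not> hom_vanishes D P L))"

lemma not_vanish:
  assumes "\<not> hom_vanishes D X Y" "X \<in> Obj D" "Y \<in> Obj D"
  obtains f where "arr f X Y" "f \<noteq> zero_mor D X Y"
  using assms vanishI by blast

lemma not_vanishI: "arr f X Y \<Longrightarrow> f \<noteq> zero_mor D X Y \<Longrightarrow> \<not> hom_vanishes D X Y"
  using vanishD by blast

lemma vanish_iso:
  assumes "isomorphic D X X'" "isomorphic D Y Y'"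
  shows "hom_vanishes D X Y \<longleftrightarrow> hom_vanishes D X' Y'"
proof -
  have o: "X \<in> Obj D" "X' \<in> Obj D" "Y \<in> Obj D" "Y' \<in> Obj D" using assms isomorphic_objs by auto
  have "hom_vanishes D X Y \<longleftrightarrow> hom_vanishes D X' Y"
    using retract_vanish(1) iso_retract isomorphic_sym assms(1) o by meson
  also have "\<dots> \<longleftrightarrow> hom_vanishes D X' Y'"
    using retract_vanish(2) iso_retract isomorphic_sym assms(2) o by meson
  finally show ?thesis .
qed

lemma simple_obj: "simple L \<Longrightarrow> L \<in> Obj D"
  using simple_hrt hrt_obj by blast

lemma heart_cokernel:
  assumes "is_cokernel (heart D t) A Y i Q q"
  shows "hrt A" "hrt Y" "hrt Q" "arr i A Y" "arr q Y Q"
    and "hrt Z \<Longrightarrow> arr k Y Z \<Longrightarrow> k \<cdot> i = zero_mor D A Z \<Longrightarrow> \<exists>u. arr u Q Z \<and> u \<cdot> q = k"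
    and "\<not> zero_object D Q \<Longrightarrow> q \<noteq> zero_mor D Y Q"
proof -
  show h: "hrt A" "hrt Y" "hrt Q" using assms unfolding is_cokernel_def by simp_all
  note o = hrt_obj[OF h(1)] hrt_obj[OF h(2)] hrt_obj[OF h(3)]
  show i: "arr i A Y" and q: "arr q Y Q" using assms o unfolding is_cokernel_def by (simp_all add: arr_def)
  have u: "\<exists>!u. u \<in> hom_set D Q Z \<and> u \<cdot> q = k"
    if "hrt Z" "arr k Y Z" "k \<cdot> i = zero_mor D A Z" for Z k
    using assms that unfolding is_cokernel_def by (simp add: arr_def)
  show "\<exists>u. arr u Q Z \<and> u \<cdot> q = k" if "hrt Z" "arr k Y Z" "k \<cdot> i = zero_mor D A Z"
    using u[OF that] o(3) hrt_obj[OF that(1)] unfolding arr_def by blast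
  show "q \<noteq> zero_mor D Y Q" if "\<not> zero_object D Q"
  proof
    assume q0: "q = zero_mor D Y Q"
    have "Idn D Q \<in> hom_set D Q Q \<and> Idn D Q \<cdot> q = zero_mor D Y Q"
      using q0 id_left[OF q] arr_id[OF o(3)] by (simp add: arr_def)
    moreover have "zero_mor D Q Q \<in> hom_set D Q Q \<and> zero_mor D Q Q \<cdot> q = zero_mor D Y Q"
      using zero_comp[OF q o(3)] arr_zero[OF o(3,3)] by (simp add: arr_def)
    ultimately have "Idn D Q = zero_mor D Q Q"
      using u[OF h(3) arr_zero[OF o(2,3)] zero_comp[OF i o(3)]] by blast
    then show False using zero_objectI[OF o(3)] that by blast
  qed
qed

lemma simple_quotient:
  assumes X: "hrt X" and nz: "\<not> zero_object D X"
  obtains L q where "simple L" "arr q X L" "q \<noteq> zero_mor D X L"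
proof -
  have "finite_length (heart D t) X" using finlen X unfolding finite_length_category_def by simp
  then obtain n F i where F: "zero_object (heart D t) (F 0)" "F n = X"
    and c: "\<forall>k<n. is_mono (heart D t) (F k) (F (Suc k)) (i k) \<and>
        (\<exists>Q q. is_cokernel (heart D t) (F k) (F (Suc k)) (i k) Q q \<and> simple Q)"
    unfolding finite_length_def by blast
  have "n \<noteq> 0" using F nz heart_zero_object X by metis
  then obtain k where n: "n = Suc k" by (cases n) auto
  obtain Q q where Q: "is_cokernel (heart D t) (F k) X (i k) Q q" "simple Q"
    using c[rule_format, of k] n F(2) by auto
  show ?thesis
    using that[OF Q(2) heart_cokernel(5,7)[OF Q(1)]] simple_nonzero[OF Q(2)] by blast
qed

lemma dp_component:
  assumes P: "dp P" and nv: "\<not> hom_vanishes D P L" and L: "L \<in> Obj D"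
  obtains Q where "dp Q" "indecomposable D Q" "\<not> hom_vanishes D Q L"
proof -
  obtain n Y \<iota> where c: "is_coproduct D {..<n::nat} Y P \<iota>"
    and l: "\<And>j. j < n \<Longrightarrow> loc (Y j)" and z: "\<And>j. j < n \<Longrightarrow> \<not> zero_object D (Y j)"
    using krull_schmidt_decomposition[OF ks dp_obj[OF P]] by metis
  have "\<exists>j\<in>{..<n}. \<not> hom_vanishes D (Y j) L" using coproduct_vanish[OF c L] nv by blast
  then obtain j where j: "j < n" "\<not> hom_vanishes D (Y j) L" by auto
  have "retract (Y j) P" using coproduct_component_retract[OF c] j by simp
  then have d: "dp (Y j)" using dp_retract P by blast
  show ?thesis using that[OF d loc_indecomposable[OF l[OF j(1)] dp_obj[OF d] z[OF j(1)]] j(2)] .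
qed

lemma indecomposable_dp_loc: "indecomposable D P \<Longrightarrow> loc P"
  using indecomposable_loc ks by blast

lemma detecting_dp:
  assumes detects "simple L"
  obtains P f where "dp P" "indecomposable D P" "loc P" "arr f P L" "f \<noteq> zero_mor D P L"
proof -
  obtain P where "dp P" "\<not> hom_vanishes D P L" using assms unfolding detects_def by blast
  then obtain Q where Q: "dp Q" "indecomposable D Q" "\<not> hom_vanishes D Q L"
    using dp_component simple_obj[OF assms(2)] by metis
  obtain f where "arr f Q L" "f \<noteq> zero_mor D Q L"
    using not_vanish[OF Q(3) dp_obj[OF Q(1)] simple_obj[OF assms(2)]] .
  then show ?thesis using that Q indecomposable_dp_loc by blast
qed

lemma hom_simple_lift:
  assumes X: "le 0 X" and q: "arr q X L" "q \<noteq> zero_mor D X L" and L: "simple L"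
    and P: "dp P" and f: "arr f P L"
  obtains g where "arr g P X" "q \<cdot> g = f"
  using cov_lift[OF P simple_cov[OF L X q] f] by metis

lemma heart_zero_if_vanish:
  assumes d: detects and X: "hrt X" and v: "\<And>P. dp P \<Longrightarrow> indecomposable D P \<Longrightarrow> hom_vanishes D P X"
  shows "zero_object D X"
proof (rule ccontr)
  assume "\<not> zero_object D X"
  then obtain L q where L: "simple L" "arr q X L" "q \<noteq> zero_mor D X L" using simple_quotient X by metis
  obtain P f where P: "dp P" "indecomposable D P" "arr f P L" "f \<noteq> zero_mor D P L"
    using detecting_dp[OF d L(1)] by metis
  obtain g where g: "arr g P X" "q \<cdot> g = f"
    using hom_simple_lift[OF hrt_le[OF X] L(2,3,1) P(1,3)] .
  have "g = zero_mor D P X" using vanishD[OF v[OF P(1,2)] g(1)] .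
  then show False using g(2) P(4) comp_zero[OF L(2) dp_obj[OF P(1)]] by simp
qed

lemma dp_hits_simple:
  assumes P: "dp P" and nz: "\<not> zero_object D P"
  obtains L f where "simple L" "arr f P L" "f \<noteq> zero_mor D P L"
proof -
  have Po: "P \<in> Obj D" using dp_obj[OF P] .
  obtain A B i p h where t: "le (- 1) A" "ge (- 1 + 1) B" "tri D A P B i p h"
    using truncation[OF Po] .
  note a = tri_arr[OF t(3)]
  have oA: "A \<in> Obj D" using t le_obj by blast
  have A1: "le (- 1 - 1) (shO D 1 A)" using le_shift[OF oA] t(1) by simp
  have A1': "le (- 1) (shO D 1 A)" using A1 by (rule le_mono) simp
  have B: "hrt B" unfolding hrt_def
    using t(2) le_ext[OF tri_rotate[OF t(3)] dp_le[OF P] le_mono[OF A1']] by simp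
  have "\<not> zero_object D B"
  proof
    assume "zero_object D B"
    then have "le (- 1) P" using tri_zero_third_iso[OF t(3)] le_iso t(1) by blast
    then show False using dp_vanish[OF P] vanish_self_zero[OF Po] nz by blast
  qed
  then obtain L q where L: "simple L" "arr q B L" "q \<noteq> zero_mor D B L" using simple_quotient B by metis
  have "q \<cdot> p \<noteq> zero_mor D P L"
  proof
    assume "q \<cdot> p = zero_mor D P L"
    from factor_shift[OF t(3) L(2) this] obtain v where v: "arr v (shO D 1 A) L" "v \<cdot> h = q" .
    have "v = zero_mor D (shO D 1 A) L" using vanishD[OF t_vanish[OF A1' simple_ge[OF L(1)]] v(1)] by simp
    then show False using v(2) zero_comp[OF a(3) simple_obj[OF L(1)]] L(3) by simp
  qed
  then show ?thesis using that L(1) arr_comp[OF a(2) L(2)] by blast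
qed

lemma vanish_all_ge:
  assumes d: detects and X: "ge m X" and v: "\<And>P k. dp P \<Longrightarrow> indecomposable D P \<Longrightarrow> hom_vanishes D P (shO D k X)"
  shows "zero_object D X"
proof -
  have Xo: "X \<in> Obj D" using X ge_obj by blast
  have step: "ge (n + 1) X" if n: "ge n X" for n
  proof -
    let ?W = "shO D n X"
    have Wo: "?W \<in> Obj D" using Xo shO_closed by blast
    have W: "ge 0 ?W" using n ge_shift[OF Xo] by simp
    obtain A B i p h where t: "le 0 A" "ge (0 + 1) B" "tri D A ?W B i p h" using truncation[OF Wo] .
    obtain w where t': "tri D (shO D (- 1) B) A ?W w i p" using tri_rotate_back[OF t(3)] .
    have oB: "B \<in> Obj D" using t ge_obj by blast
    have B2: "ge 2 (shO D (- 1) B)" using ge_shift[OF oB] t(2) by simp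
    have A: "hrt A" unfolding hrt_def using t(1) ge_ext[OF t' ge_mono[OF B2] W] by simp
    have "hom_vanishes D P A" if P: "dp P" "indecomposable D P" for P
      using tri_vanish_into[OF t' dp_obj[OF P(1)] t_vanish[OF dp_le[OF P(1)] B2] v[OF P]] by simp
    then have "zero_object D A" using heart_zero_if_vanish[OF d A] by blast
    then have "isomorphic D B ?W" using tri_zero_first_iso[OF t(3)] isomorphic_sym by blast
    then have "ge 1 ?W" using ge_iso t(2) by simp
    then show ?thesis using ge_shift[OF Xo] by (simp add: add.commute)
  qed
  have "ge n X" for n
  proof (cases "m \<le> n")
    case True
    then show ?thesis by (induction n rule: int_ge_induct) (use X step in auto)
  next
    case False
    then show ?thesis using ge_mono[OF X] by simp
  qed
  then have "X \<in> (\<Inter>n. t_ge D t n)" using t_ge_iff by blast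
  then show ?thesis using nondeg unfolding nondegenerate_def by blast
qed

lemma vanish_all_le:
  assumes d: detects and X: "le m X" and v: "\<And>P k. dp P \<Longrightarrow> indecomposable D P \<Longrightarrow> hom_vanishes D P (shO D k X)"
  shows "zero_object D X"
proof -
  have Xo: "X \<in> Obj D" using X le_obj by blast
  have step: "le (n - 1) X" if n: "le n X" for n
  proof -
    let ?W = "shO D n X"
    have Wo: "?W \<in> Obj D" using Xo shO_closed by blast
    have W: "le 0 ?W" using n le_shift[OF Xo] by simp
    obtain A B i p h where t: "le (- 1) A" "ge (- 1 + 1) B" "tri D A ?W B i p h" using truncation[OF Wo] .
    note t' = tri_rotate[OF t(3)]
    have oA: "A \<in> Obj D" using t le_obj by blast
    have "le (- 1 - 1) (shO D 1 A)" using le_shift[OF oA] t(1) by simp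
    then have A1: "le (- 1) (shO D 1 A)" by (rule le_mono) simp
    have B: "hrt B" unfolding hrt_def using t(2) le_ext[OF t' W le_mono[OF A1]] by simp
    have "hom_vanishes D P B" if P: "dp P" "indecomposable D P" for P
      using tri_vanish_into[OF t' dp_obj[OF P(1)] v[OF P] dp_vanish[OF P(1) A1]] .
    then have "zero_object D B" using heart_zero_if_vanish[OF d B] by blast
    then have "isomorphic D A ?W" using tri_zero_third_iso[OF t(3)] by blast
    then have "le (- 1) ?W" using le_iso t(1) by blast
    then show ?thesis using le_shift[OF Xo] by simp
  qed
  have "le n X" for n
  proof (cases "n \<le> m")
    case True
    then show ?thesis by (induction n rule: int_le_induct) (use X step in auto)
  next
    case False
    then show ?thesis using le_mono[OF X] by simp
  qed
  then have "X \<in> (\<Inter>n. t_le D t n)" using t_le_iff by blast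
  then show ?thesis using nondeg unfolding nondegenerate_def by blast
qed

lemma dp_vanish_off_degree:
  assumes P: "dp P" and X: "hrt X" and m: "m \<noteq> 0"
  shows "hom_vanishes D P (shO D m X)"
proof (cases "m > 0")
  case True
  then have "le (- m) (shO D m X)" using hrt_le[OF X] le_shift[OF hrt_obj[OF X]] by simp
  then have "le (- 1) (shO D m X)" by (rule le_mono) (use True in simp)
  then show ?thesis by (rule dp_vanish[OF P])
next
  case False
  then have "ge (- m) (shO D m X)" using hrt_ge[OF X] ge_shift[OF hrt_obj[OF X]] by simp
  then show ?thesis by (rule t_vanish[OF dp_le[OF P]]) (use False m in simp)
qed

section \<open>Silting collections\<close>

lemma silting_members_dp:
  assumes S: "S \<subseteq> Obj D" and t: "t = silting_t D S" and P: "P \<in> S"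
  shows "dp P"
proof -
  have f: "fst t = perp_pos D S" "snd t = perp_neg D S" using t by (auto simp: silting_t_def)
  have Po: "P \<in> Obj D" using S P by blast
  have 1: "le 0 P"
  proof (rule leI[OF Po])
    fix Y assume Y: "ge (0 + 1) Y"
    have Yo: "Y \<in> Obj D" using Y ge_obj by blast
    have "shO D 1 Y \<in> snd t" using Y by (simp add: ge_def)
    then have "hom_vanishes D P (shO D (- 1) (shO D 1 Y))"
      using P unfolding f perp_neg_def by simp
    then show "hom_vanishes D P Y" using Yo by (simp add: shift_shift_obj shO_0)
  qed
  have "hom_vanishes D P (shO D 1 X)" if "X \<in> fst t" for X
    using that P unfolding f perp_pos_def by simp
  then show ?thesis unfolding derived_projective_def using 1 fst_t_iff by simp
qed

lemma silting_detects_simple: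
  assumes S: "S \<subseteq> Obj D" and t: "t = silting_t D S" and L: "simple L"
  obtains P where "P \<in> S" "\<not> hom_vanishes D P L"
proof -
  have "\<exists>P\<in>S. \<not> hom_vanishes D P L"
  proof (rule ccontr)
    assume "\<not> ?thesis"
    then have v: "hom_vanishes D P L" if "P \<in> S" for P using that by blast
    have Lo: "L \<in> Obj D" using simple_obj[OF L] .
    have "shO D (- 1) L \<in> perp_pos D S"
      unfolding perp_pos_def
    proof (intro CollectI conjI allI impI ballI shO_closed Lo)
      fix m :: int and P assume m: "0 < m" and P: "P \<in> S"
      have e: "shO D m (shO D (- 1) L) = shO D (m - 1) L" using Lo by (simp add: shift_shift_obj)
      show "hom_vanishes D P (shO D m (shO D (- 1) L))"
      proof (cases "m = 1")
        case True
        then show ?thesis using v[OF P] e shO_0[OF Lo] by simp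
      next
        case False
        then show ?thesis
          unfolding e by (intro dp_vanish_off_degree silting_members_dp[OF S t P] simple_hrt[OF L]) simp
      qed
    qed
    then have "le 0 (shO D (- 1) L)" using t fst_t_iff by (simp add: silting_t_def)
    then have "le (- 1) L" using le_shift[OF Lo] by simp
    then have "zero_object D L" using le_ge_zero[OF _ simple_ge[OF L]] by simp
    then show False using simple_nonzero[OF L] by blast
  qed
  then show ?thesis using that by blast
qed

lemma silting_detects:
  assumes S: "S \<subseteq> Obj D" and t: "t = silting_t D S"
  shows detects
  unfolding detects_def
proof (intro allI impI)
  fix L assume "simple L"
  then obtain P where "P \<in> S" "\<not> hom_vanishes D P L" using silting_detects_simple[OF S t] by blast
  then show "\<exists>P. dp P \<and> \<not> hom_vanishes D P L" using silting_members_dp[OF S t] by blast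
qed

text \<open>The truncation that ought to vanish receives no maps from any shift of a derived projective,
  hence is zero by nondegeneracy.\<close>

lemma t_eq_silting_t:
  assumes d: detects and S: "\<And>P. P \<in> S \<Longrightarrow> dp P"
    and reps: "\<And>P. dp P \<Longrightarrow> indecomposable D P \<Longrightarrow> \<exists>Q\<in>S. isomorphic D P Q"
  shows "t = silting_t D S"
proof -
  have to_all: "hom_vanishes D P Z"
    if "\<And>Q. Q \<in> S \<Longrightarrow> hom_vanishes D Q Z" "Z \<in> Obj D" "dp P" "indecomposable D P" for P Z
    using reps[OF that(3,4)] that(1,2) retract_vanish(1)[OF iso_retract] by blast
  have "fst t = perp_pos D S"
  proof (intro equalityI subsetI)
    fix X assume "X \<in> fst t"
    then have X: "le 0 X" by (simp add: fst_t_iff)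
    note Xo = le_obj[OF X]
    show "X \<in> perp_pos D S"
      unfolding perp_pos_def
    proof (intro CollectI conjI allI impI ballI Xo)
      fix m :: int and P assume m: "0 < m" and P: "P \<in> S"
      have "le (- m) (shO D m X)" using X le_shift[OF Xo] by simp
      then have "le (- 1) (shO D m X)" by (rule le_mono) (use m in simp)
      then show "hom_vanishes D P (shO D m X)" by (rule dp_vanish[OF S[OF P]])
    qed
  next
    fix Y assume "Y \<in> perp_pos D S"
    then have Yo: "Y \<in> Obj D" and v: "\<And>m P. 0 < m \<Longrightarrow> P \<in> S \<Longrightarrow> hom_vanishes D P (shO D m Y)"
      unfolding perp_pos_def by auto
    obtain A Z i p h where t: "le 0 A" "ge (0 + 1) Z" "tri D A Y Z i p h" using truncation[OF Yo] .
    have Zo: "Z \<in> Obj D" and Ao: "A \<in> Obj D" using t ge_obj le_obj by auto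
    have v_all: "hom_vanishes D P (shO D m Z)" if P: "P \<in> S" for P m
    proof (cases "0 < m")
      case True
      obtain f g h where s: "tri D (shO D m A) (shO D m Y) (shO D m Z) f g h"
        using tri_shift_exists[OF t(3)] by blast
      have "le (- 1 - m) (shO D 1 (shO D m A))"
        using t(1) le_shift[OF Ao, of "- m" m] le_shift[OF shO_closed[OF Ao], of "- 1 - m" 1 m] by simp
      then have "le (- 1) (shO D 1 (shO D m A))" by (rule le_mono) (use True in simp)
      then show ?thesis
        using tri_vanish_into[OF tri_rotate[OF s] dp_obj[OF S[OF P]] v[OF True P]] dp_vanish[OF S[OF P]]
        by blast
    next
      case False
      have "ge (1 - m) (shO D m Z)" using t(2) ge_shift[OF Zo] by simp
      then show ?thesis by (rule t_vanish[OF dp_le[OF S[OF P]]]) (use False in simp)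
    qed
    have "zero_object D Z"
      by (rule vanish_all_ge[OF d t(2) to_all[OF v_all shO_closed[OF Zo]]])
    then show "Y \<in> fst t" using tri_zero_third_iso[OF t(3)] le_iso t(1) fst_t_iff by blast
  qed
  moreover have "snd t = perp_neg D S"
  proof (intro equalityI subsetI)
    fix X assume "X \<in> snd t"
    then have X: "ge 0 X" by (simp add: snd_t_iff)
    note Xo = ge_obj[OF X]
    show "X \<in> perp_neg D S"
      unfolding perp_neg_def
    proof (intro CollectI conjI allI impI ballI Xo)
      fix m :: int and P assume m: "m < 0" and P: "P \<in> S"
      have "ge (- m) (shO D m X)" using X ge_shift[OF Xo] by simp
      then show "hom_vanishes D P (shO D m X)" by (rule t_vanish[OF dp_le[OF S[OF P]]]) (use m in simp)
    qed
  next
    fix Y assume "Y \<in> perp_neg D S"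
    then have Yo: "Y \<in> Obj D" and v: "\<And>m P. m < 0 \<Longrightarrow> P \<in> S \<Longrightarrow> hom_vanishes D P (shO D m Y)"
      unfolding perp_neg_def by auto
    obtain Z B i p h where t: "le (- 1) Z" "ge (- 1 + 1) B" "tri D Z Y B i p h" using truncation[OF Yo] .
    have Zo: "Z \<in> Obj D" and Bo: "B \<in> Obj D" using t ge_obj le_obj by auto
    have v_all: "hom_vanishes D P (shO D m Z)" if P: "P \<in> S" for P m
    proof (cases "m < 0")
      case True
      obtain f g h where "tri D (shO D m Z) (shO D m Y) (shO D m B) f g h"
        using tri_shift_exists[OF t(3)] by blast
      then obtain w where s: "tri D (shO D (- 1) (shO D m B)) (shO D m Z) (shO D m Y) w f g"
        using tri_rotate_back by metis
      have "ge (1 - m) (shO D (- 1) (shO D m B))"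
        using t(2) ge_shift[OF Bo, of "- m" m] ge_shift[OF shO_closed[OF Bo], of "1 - m" "- 1" m] by simp
      then have "hom_vanishes D P (shO D (- 1) (shO D m B))"
        by (rule t_vanish[OF dp_le[OF S[OF P]]]) (use True in simp)
      then show ?thesis
        using tri_vanish_into[OF s dp_obj[OF S[OF P]]] v[OF True P] by blast
    next
      case False
      have "le (- 1 - m) (shO D m Z)" using t(1) le_shift[OF Zo] by simp
      then have "le (- 1) (shO D m Z)" by (rule le_mono) (use False in simp)
      then show ?thesis by (rule dp_vanish[OF S[OF P]])
    qed
    have "zero_object D Z"
      by (rule vanish_all_le[OF d t(1) to_all[OF v_all shO_closed[OF Zo]]])
    then have "isomorphic D B Y" using tri_zero_first_iso[OF t(3)] isomorphic_sym by blast
    then show "Y \<in> snd t" using ge_iso t(2) by (simp add: snd_t_iff)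
  qed
  ultimately show ?thesis unfolding silting_t_def by (simp add: prod_eq_iff)
qed

section \<open>Enough derived projectives\<close>

lemma zero_dp:
  assumes "zero_object D Z"
  shows "dp Z"
proof (rule dpI)
  show "le 0 Z"
  proof (rule leI)
    show "Z \<in> Obj D" using assms by (simp add: zero_object_def)
    show "hom_vanishes D Z Y" if "ge (0 + 1) Y" for Y
      using zero_object_vanish(1)[OF assms ge_obj[OF that]] .
  qed
  show "hom_vanishes D Z X" if "le (- 1) X" for X
    using zero_object_vanish(1)[OF assms le_obj[OF that]] .
qed

lemma heart_cover:
  assumes d: detects and X: "hrt X"
  obtains P p where "dp P" "arr p P X"
    "\<And>Z k. hrt Z \<Longrightarrow> arr k X Z \<Longrightarrow> k \<cdot> p = zero_mor D P Z \<Longrightarrow> k = zero_mor D X Z"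
proof -
  have "finite_length (heart D t) X" using finlen X unfolding finite_length_category_def by simp
  then obtain n F i where F: "zero_object (heart D t) (F 0)" "F n = X"
    and c: "\<forall>k<n. is_mono (heart D t) (F k) (F (Suc k)) (i k) \<and>
        (\<exists>Q q. is_cokernel (heart D t) (F k) (F (Suc k)) (i k) Q q \<and> simple Q)"
    unfolding finite_length_def by blast
  have "m \<le> n \<Longrightarrow> \<exists>P p. dp P \<and> arr p P (F m) \<and>
      (\<forall>Z k. hrt Z \<longrightarrow> arr k (F m) Z \<longrightarrow> k \<cdot> p = zero_mor D P Z \<longrightarrow> k = zero_mor D (F m) Z)" for m
  proof (induction m)
    case 0
    have h: "hrt (F 0)" using F(1) unfolding zero_object_def by simp
    have z: "zero_object D (F 0)" using heart_zero_object[OF h] F(1) by simp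
    show ?case
      using zero_dp[OF z] arr_id[OF hrt_obj[OF h]] vanishD[OF zero_object_vanish(1)[OF z hrt_obj]] by blast
  next
    case (Suc m)
    then obtain P1 p1 where P1: "dp P1" "arr p1 P1 (F m)"
      and e1: "\<And>Z k. hrt Z \<Longrightarrow> arr k (F m) Z \<Longrightarrow> k \<cdot> p1 = zero_mor D P1 Z \<Longrightarrow> k = zero_mor D (F m) Z"
      by auto
    let ?Y = "F (Suc m)"
    obtain Q q where Q: "is_cokernel (heart D t) (F m) ?Y (i m) Q q" "simple Q"
      using c[rule_format, of m] Suc.prems by auto
    note o = heart_cokernel(1-3)[OF Q(1)] and im = heart_cokernel(4)[OF Q(1)] and q = heart_cokernel(5)[OF Q(1)]
    note fac = heart_cokernel(6)[OF Q(1)]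
    obtain P2 f2 where P2: "dp P2" "arr f2 P2 Q" "f2 \<noteq> zero_mor D P2 Q"
      using detecting_dp[OF d Q(2)] by metis
    have cf: "cov f2 P2 Q" using simple_cov[OF Q(2) dp_le[OF P2(1)] P2(2,3)] .
    have qn: "q \<noteq> zero_mor D ?Y Q" using heart_cokernel(7)[OF Q(1)] simple_nonzero[OF Q(2)] .
    obtain p2 where p2: "arr p2 P2 ?Y" "q \<cdot> p2 = f2"
      using hom_simple_lift[OF hrt_le[OF o(2)] q qn Q(2) P2(1,2)] .
    obtain P where P: "is_direct_sum D P1 P2 P" using ex_direct_sum dp_obj P1(1) P2(1) by blast
    obtain a b where a: "arr a P1 P" "arr b P2 P"
      and am: "\<And>Z f g. arr f P1 Z \<Longrightarrow> arr g P2 Z \<Longrightarrow> \<exists>h. arr h P Z \<and> h \<cdot> a = f \<and> h \<cdot> b = g"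
      using P unfolding direct_sum_iff by blast
    obtain p where p: "arr p P ?Y" "p \<cdot> a = i m \<cdot> p1" "p \<cdot> b = p2"
      using am[OF arr_comp[OF P1(2) im] p2(1)] by blast
    have "k = zero_mor D ?Y Z" if Z: "hrt Z" and k: "arr k ?Y Z" "k \<cdot> p = zero_mor D P Z" for Z k
    proof -
      have "k \<cdot> i m \<cdot> p1 = zero_mor D P1 Z"
        using assoc[OF P1(2) im k(1)] p(2) assoc[OF a(1) p(1) k(1)] k(2) zero_comp[OF a(1) hrt_obj[OF Z]] by simp
      from e1[OF Z arr_comp[OF im k(1)] this] obtain u where u: "arr u Q Z" "u \<cdot> q = k"
        using fac[OF Z k(1)] by blast
      have "u \<cdot> f2 = zero_mor D P2 Z"
        using assoc[OF p2(1) q u(1)] u(2) p2(2) p(3) assoc[OF a(2) p(1) k(1)] k(2)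
          zero_comp[OF a(2) hrt_obj[OF Z]] by simp
      then have "u = zero_mor D Q Z" using cov_cancel[OF cf hrt_ge[OF Z] u(1)] by blast
      then show ?thesis using u(2) zero_comp[OF q hrt_obj[OF Z]] by simp
    qed
    then show ?case using dp_direct_sum[OF P P1(1) P2(1)] p(1) by blast
  qed
  from this[of n] F(2) show ?thesis using that by auto
qed

lemma reflection_iso:
  assumes p: "reflection p X H" and H': "hrt H'" and b: "is_iso D H H' b" and X: "le 0 X"
  shows "reflection (b \<cdot> p) X H'"
proof -
  obtain c where c: "arr b H H'" "arr c H' H" "c \<cdot> b = Idn D H" "b \<cdot> c = Idn D H'"
    using b unfolding iso_iff by blast
  note pa = reflection_arr[OF p]
  note bp = arr_comp[OF pa c(1)]
  have "cov (b \<cdot> p) X H'"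
  proof (rule cov_of_epi[OF X hrt_le[OF H'] bp])
    fix Z k assume Z: "hrt Z" and k: "arr k H' Z" "k \<cdot> (b \<cdot> p) = zero_mor D X Z"
    have kb: "arr (k \<cdot> b) H Z" using c(1) k(1) by (rule arr_comp)
    have "k \<cdot> b = zero_mor D H Z"
      using cov_cancel[OF reflection_cov[OF p] hrt_ge[OF Z] kb] assoc[OF pa c(1) k(1)] k(2) by simp
    then show "k = zero_mor D H' Z"
      using assoc[OF c(2,1) k(1)] c(4) id_right[OF k(1)] zero_comp[OF c(2) hrt_obj[OF Z]] by simp
  qed
  moreover have "\<exists>u. arr u H' Z \<and> u \<cdot> (b \<cdot> p) = g" if Z: "hrt Z" and g: "arr g X Z" for Z g
  proof -
    obtain u where u: "arr u H Z" "u \<cdot> p = g" using reflection_factor[OF p Z g] .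
    have "u \<cdot> c \<cdot> (b \<cdot> p) = g" using sandwich[OF pa c(1,2) u(1) c(3)] u(2) by simp
    then show ?thesis using arr_comp[OF c(2) u(1)] by blast
  qed
  ultimately show ?thesis unfolding reflection_def using H' by blast
qed

lemma projective_lift:
  assumes Q: "projective_object (heart D t) Q" and e: "cov e X Y" "hrt X" "hrt Y" and f: "arr f Q Y"
  obtains g where "arr g Q X" "e \<cdot> g = f"
proof -
  have "is_epi (heart D t) X Y e" using cov_heart_epi[OF e(2,3,1)] .
  from Q[unfolded projective_object_def, THEN conjunct2, rule_format, OF this, of f] f
  obtain g where "g \<in> hom_set (heart D t) Q X" "e \<cdot> g = f" by (auto simp: arr_def)
  then show ?thesis using that arr_objs(1)[OF f] hrt_obj[OF e(2)] by (simp add: arr_def)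
qed

lemma local_projective_lift:
  assumes d: detects and Q: "projective_object (heart D t) Q" and lQ: "loc Q" and nz: "\<not> zero_object D Q"
  obtains P p where "dp P" "reflection p P Q"
proof -
  have hQ: "hrt Q" using Q by (simp add: projective_object_def)
  obtain L q where L: "simple L" "arr q Q L" "q \<noteq> zero_mor D Q L" using simple_quotient[OF hQ nz] .
  obtain P f where P: "dp P" "loc P" "arr f P L" "f \<noteq> zero_mor D P L" using detecting_dp[OF d L(1)] by metis
  let ?H = "H0 D t P"
  note r = eta_reflection[OF dp_le[OF P(1)]]
  note e = reflection_arr[OF r] and hH = reflection_hrt[OF r]
  have Po: "P \<in> Obj D" and Lo: "L \<in> Obj D" and Ho: "?H \<in> Obj D"
    using dp_obj[OF P(1)] simple_obj[OF L(1)] hrt_obj[OF hH] by auto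
  obtain p where p: "arr p P Q" "q \<cdot> p = f"
    using hom_simple_lift[OF hrt_le[OF hQ] L(2,3,1) P(1,3)] .
  obtain b where b: "arr b ?H Q" "b \<cdot> eta P = p" using reflection_factor[OF r hQ p(1)] .
  have qb: "arr (q \<cdot> b) ?H L" using b(1) L(2) by (rule arr_comp)
  have qbe: "q \<cdot> b \<cdot> eta P = f" using assoc[OF e b(1) L(2)] b(2) p(2) by simp
  then have "q \<cdot> b \<noteq> zero_mor D ?H L" using zero_comp[OF e Lo] P(4) by metis
  then have cqb: "cov (q \<cdot> b) ?H L" using simple_cov[OF L(1) hrt_le[OF hH] qb] by blast
  obtain a where a: "arr a Q ?H" "q \<cdot> b \<cdot> a = q"
    using projective_lift[OF Q cqb hH simple_hrt[OF L(1)] L(2)] .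
  have ba: "arr (b \<cdot> a) Q Q" and ab: "arr (a \<cdot> b) ?H ?H" using a b arr_comp by auto
  have "q \<cdot> (b \<cdot> a) = q" using assoc[OF a(1) b(1) L(2)] a(2) by simp
  from locD[OF lQ L(2,3) ba this] obtain v where v: "arr v Q Q" "b \<cdot> a \<cdot> v = Idn D Q"
    unfolding iso_iff by blast
  have bav: "b \<cdot> (a \<cdot> v) = Idn D Q" using assoc[OF v(1) a(1) b(1)] v(2) by simp
  obtain c where c: "arr c P P" "eta P \<cdot> c = a \<cdot> b \<cdot> eta P"
    using cov_lift[OF P(1) reflection_cov[OF r] arr_comp[OF e ab]] .
  have "f \<cdot> c = f"
  proof -
    have "f \<cdot> c = q \<cdot> b \<cdot> (a \<cdot> b \<cdot> eta P)" using qbe assoc[OF c(1) e qb] c(2) by simp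
    also have "\<dots> = q \<cdot> b \<cdot> a \<cdot> b \<cdot> eta P" using assoc[OF e ab qb] assoc[OF b(1) a(1) qb] by simp
    finally show ?thesis using a(2) qbe by simp
  qed
  from locD[OF P(2,3,4) c(1) this] obtain w where w: "arr w P P" "w \<cdot> c = Idn D P"
    unfolding iso_iff by blast
  obtain s where s: "arr s ?H ?H" "s \<cdot> eta P = eta P \<cdot> w"
    using reflection_factor[OF r hH arr_comp[OF w(1) e]] .
  have sab: "arr (s \<cdot> (a \<cdot> b)) ?H ?H" using ab s(1) by (rule arr_comp)
  have "s \<cdot> (a \<cdot> b) = Idn D ?H"
  proof (rule cov_cancel_eq[OF reflection_cov[OF r] hrt_ge[OF hH] sab arr_id[OF Ho]])
    have "s \<cdot> (a \<cdot> b) \<cdot> eta P = s \<cdot> eta P \<cdot> c" using assoc[OF e ab s(1)] c(2) assoc[OF c(1) e s(1)] by simp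
    also have "\<dots> = eta P" using s(2) assoc[OF c(1) w(1) e] w(2) id_right[OF e] by simp
    finally show "s \<cdot> (a \<cdot> b) \<cdot> eta P = Idn D ?H \<cdot> eta P" using id_left[OF e] by simp
  qed
  then have "s \<cdot> a \<cdot> b = Idn D ?H" using assoc[OF b(1) a(1) s(1)] by simp
  then have "is_iso D ?H Q b"
    using isoI_sections[OF b(1) arr_comp[OF a(1) s(1)] arr_comp[OF v(1) a(1)] _ bav] by blast
  from reflection_iso[OF r hQ this dp_le[OF P(1)]] show ?thesis using that[OF P(1)] by blast
qed

lemma projective_retract:
  assumes r: "retract X Q" and Q: "projective_object (heart D t) Q"
  shows "projective_object (heart D t) X"
  unfolding projective_object_def
proof (intro conjI allI impI ballI)
  have hQ: "hrt Q" using Q by (simp add: projective_object_def)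
  have hX: "hrt X" using hrt_retract r hQ by blast
  then show "X \<in> Obj (heart D t)" by simp
  obtain i s where i: "arr i X Q" "arr s Q X" "s \<cdot> i = Idn D X" using r unfolding retract_def by blast
  fix A B e f assume e: "is_epi (heart D t) A B e" and "f \<in> hom_set (heart D t) X B"
  note ed = heart_epiD[OF e]
  have f: "arr f X B" using \<open>f \<in> _\<close> hrt_obj[OF hX] hrt_obj[OF ed(2)] by (simp add: arr_def)
  obtain g where g: "arr g Q A" "e \<cdot> g = f \<cdot> s"
    using projective_lift[OF Q heart_epi_cov[OF e] ed(1,2) arr_comp[OF i(2) f]] .
  have "e \<cdot> (g \<cdot> i) = f"
    using assoc[OF i(1) g(1) ed(3)] g(2) assoc[OF i(1,2) f] i(3) id_right[OF f] by simp
  then show "\<exists>g\<in>hom_set (heart D t) X A. e \<cdot>\<^bsub>heart D t\<^esub> g = f"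
    using arr_comp[OF i(1) g(1)] by (auto simp: arr_def)
qed

lemma projective_reflection:
  assumes d: detects and Q: "projective_object (heart D t) Q"
  obtains P p where "dp P" "reflection p P Q"
proof -
  have hQ: "hrt Q" using Q by (simp add: projective_object_def)
  note Qo = hrt_obj[OF hQ]
  obtain n Y \<iota> where c: "is_coproduct D {..<n::nat} Y Q \<iota>"
    and l: "\<And>j. j < n \<Longrightarrow> loc (Y j)" and z: "\<And>j. j < n \<Longrightarrow> \<not> zero_object D (Y j)"
    using krull_schmidt_decomposition[OF ks Qo] by metis
  have ca: "arr (\<iota> j) (Y j) Q" if "j < n" for j using coproduct_arr[OF c] that by simp
  have "\<exists>P p. dp P \<and> reflection p P (Y j)" if j: "j < n" for j
  proof -
    have "retract (Y j) Q" using coproduct_component_retract[OF c] j by simp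
    then have "projective_object (heart D t) (Y j)" using projective_retract Q by blast
    then show ?thesis using local_projective_lift[OF d _ l[OF j] z[OF j]] by metis
  qed
  then obtain P p where Pp: "\<And>j. j < n \<Longrightarrow> dp (P j)" "\<And>j. j < n \<Longrightarrow> reflection (p j) (P j) (Y j)" by metis
  obtain W \<kappa> where W: "is_coproduct D {..<n} P W \<kappa>" using finite_coproduct_exists[of n P] dp_obj[OF Pp(1)] by blast
  have ka: "arr (\<kappa> j) (P j) W" if "j < n" for j using coproduct_arr[OF W] that by simp
  have dW: "dp W" by (rule dp_coproduct[OF W]) (use Pp(1) in simp)
  have pj: "arr (p j) (P j) (Y j)" if "j < n" for j using reflection_arr Pp(2) that by blast
  have ipj: "arr (\<iota> j \<cdot> p j) (P j) Q" if "j \<in> {..<n}" for j using arr_comp[OF pj ca] that by simp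
  obtain e where e: "arr e W Q" "\<And>j. j \<in> {..<n} \<Longrightarrow> e \<cdot> \<kappa> j = \<iota> j \<cdot> p j"
    using coproduct_map[OF W Qo ipj] by metis
  have "cov e W Q"
  proof (rule cov_of_epi[OF dp_le[OF dW] hrt_le[OF hQ] e(1)])
    fix Z k assume Z: "hrt Z" and k: "arr k Q Z" "k \<cdot> e = zero_mor D W Z"
    note Zo = hrt_obj[OF Z]
    show "k = zero_mor D Q Z"
    proof (rule coproduct_eq[OF c k(1) arr_zero[OF Qo Zo]])
      fix j assume "j \<in> {..<n}"
      then have j: "j < n" by simp
      have "k \<cdot> \<iota> j \<cdot> p j = zero_mor D (P j) Z"
        using assoc[OF pj[OF j] ca[OF j] k(1)] e(2)[of j] j assoc[OF ka[OF j] e(1) k(1)] k(2)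
          zero_comp[OF ka[OF j] Zo] by simp
      then have "k \<cdot> \<iota> j = zero_mor D (Y j) Z"
        using cov_cancel[OF reflection_cov[OF Pp(2)[OF j]] hrt_ge[OF Z] arr_comp[OF ca[OF j] k(1)]] by blast
      then show "k \<cdot> \<iota> j = zero_mor D Q Z \<cdot> \<iota> j" using zero_comp[OF ca[OF j] Zo] by simp
    qed
  qed
  moreover have "\<exists>u. arr u Q Z \<and> u \<cdot> e = g" if Z: "hrt Z" and g: "arr g W Z" for Z g
  proof -
    have "\<exists>v. arr v (Y j) Z \<and> v \<cdot> p j = g \<cdot> \<kappa> j" if j: "j < n" for j
      using reflection_factor[OF Pp(2)[OF j] Z arr_comp[OF ka[OF j] g]] by metis
    then obtain v where v: "\<And>j. j < n \<Longrightarrow> arr (v j) (Y j) Z" "\<And>j. j < n \<Longrightarrow> v j \<cdot> p j = g \<cdot> \<kappa> j" by metis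
    have va: "arr (v j) (Y j) Z" if "j \<in> {..<n}" for j using v(1) that by simp
    obtain u where u: "arr u Q Z" "\<And>j. j \<in> {..<n} \<Longrightarrow> u \<cdot> \<iota> j = v j"
      using coproduct_map[OF c hrt_obj[OF Z] va] by metis
    have "u \<cdot> e = g"
    proof (rule coproduct_eq[OF W arr_comp[OF e(1) u(1)] g])
      fix j assume ji: "j \<in> {..<n}"
      then have j: "j < n" by simp
      show "u \<cdot> e \<cdot> \<kappa> j = g \<cdot> \<kappa> j"
        using assoc[OF ka[OF j] e(1) u(1)] e(2)[OF ji] assoc[OF pj[OF j] ca[OF j] u(1)] u(2)[OF ji] v(2)[OF j]
        by simp
    qed
    then show ?thesis using u(1) by blast
  qed
  ultimately have "reflection e W Q" unfolding reflection_def using hQ by blast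
  then show ?thesis using that dW by blast
qed

lemma detects_enough:
  assumes d: detects
  shows "enough_derived_projectives D t"
  unfolding enough_derived_projectives_def
proof
  show "has_derived_projectives D t"
    unfolding has_derived_projectives_def
  proof (intro allI impI)
    fix Q assume Q: "projective_object (heart D t) Q"
    obtain P p where P: "dp P" "reflection p P Q" using projective_reflection[OF d Q] .
    note r = eta_reflection[OF dp_le[OF P(1)]]
    have "isomorphic (heart D t) (H0 D t P) Q"
      using reflection_unique[OF r P(2)] reflection_hrt[OF r] reflection_hrt[OF P(2)]
      by (simp add: heart_isomorphic)
    then show "\<exists>P. dp P \<and> isomorphic (heart D t) (H0 D t P) Q" using P(1) by blast
  qed
  show "enough_projectives (heart D t)"
    unfolding enough_projectives_def
  proof
    fix X assume "X \<in> Obj (heart D t)"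
    then have X: "hrt X" by simp
    obtain P p where P: "dp P" "arr p P X"
      and e: "\<And>Z k. hrt Z \<Longrightarrow> arr k X Z \<Longrightarrow> k \<cdot> p = zero_mor D P Z \<Longrightarrow> k = zero_mor D X Z"
      using heart_cover[OF d X] by metis
    note r = eta_reflection[OF dp_le[OF P(1)]]
    note ea = reflection_arr[OF r]
    obtain u where u: "arr u (H0 D t P) X" "u \<cdot> eta P = p" using reflection_factor[OF r X P(2)] .
    have "is_epi (heart D t) (H0 D t P) X u"
    proof (rule heart_epiI[OF reflection_hrt[OF r] X u(1)])
      fix Z k assume Z: "hrt Z" and k: "arr k X Z" "k \<cdot> u = zero_mor D (H0 D t P) Z"
      have "k \<cdot> p = zero_mor D P Z" using assoc[OF ea u(1) k(1)] u(2) k(2) zero_comp[OF ea hrt_obj[OF Z]] by simp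
      then show "k = zero_mor D X Z" using e[OF Z k(1)] by blast
    qed
    then show "\<exists>P p. projective_object (heart D t) P \<and> is_epi (heart D t) P X p"
      using dp_reflection_projective[OF P(1) r] by blast
  qed
qed

lemma enough_detects:
  assumes "enough_derived_projectives D t"
  shows detects
  unfolding detects_def
proof (intro allI impI)
  fix L assume L: "simple L"
  have hL: "hrt L" using simple_hrt[OF L] .
  note Lo = hrt_obj[OF hL]
  have "L \<in> Obj (heart D t)" using hL by simp
  then obtain Q p where Q: "projective_object (heart D t) Q" "is_epi (heart D t) Q L p"
    using assms unfolding enough_derived_projectives_def enough_projectives_def by blast
  obtain P where P: "dp P" "isomorphic (heart D t) (H0 D t P) Q"
    using assms Q(1) unfolding enough_derived_projectives_def has_derived_projectives_def by blast
  note r = eta_reflection[OF dp_le[OF P(1)]]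
  note ea = reflection_arr[OF r]
  obtain v v' where v: "arr v (H0 D t P) Q" "arr v' Q (H0 D t P)" "v \<cdot> v' = Idn D Q"
    using P(2)[unfolded heart_isomorphic] unfolding isomorphic_def iso_iff by blast
  note pd = heart_epiD[OF Q(2)]
  have pv: "arr (p \<cdot> v) (H0 D t P) L" using v(1) pd(3) by (rule arr_comp)
  have f: "arr (p \<cdot> v \<cdot> eta P) P L" using ea pv by (rule arr_comp)
  have "p \<cdot> v \<cdot> eta P \<noteq> zero_mor D P L"
  proof
    assume "p \<cdot> v \<cdot> eta P = zero_mor D P L"
    then have "p \<cdot> v = zero_mor D (H0 D t P) L"
      using cov_cancel[OF reflection_cov[OF r] simple_ge[OF L] pv] by blast
    then have "p = zero_mor D Q L"
      using assoc[OF v(2,1) pd(3)] v(3) id_right[OF pd(3)] zero_comp[OF v(2) Lo] by simp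
    then have "Idn D L \<cdot> p = zero_mor D L L \<cdot> p" using id_left[OF pd(3)] zero_comp[OF pd(3) Lo] by simp
    then have "Idn D L = zero_mor D L L" by (rule pd(4)[OF hL arr_id[OF Lo] arr_zero[OF Lo Lo]])
    then show False using zero_objectI[OF Lo] simple_nonzero[OF L] by blast
  qed
  then show "\<exists>P. dp P \<and> \<not> hom_vanishes D P L" using P(1) not_vanishI[OF f] by blast
qed

end

section \<open>The equivalences\<close>

lemma bij_betw_of_unique_relation:
  assumes "\<And>a. a \<in> A \<Longrightarrow> \<exists>!b. b \<in> B \<and> R a b" "\<And>b. b \<in> B \<Longrightarrow> \<exists>!a. a \<in> A \<and> R a b"
  obtains f where "bij_betw f A B" "\<And>a b. a \<in> A \<Longrightarrow> b \<in> B \<Longrightarrow> R a b \<longleftrightarrow> b = f a"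
proof -
  define f where "f a = (THE b. b \<in> B \<and> R a b)" for a
  have f: "f a \<in> B \<and> R a (f a)" if "a \<in> A" for a
    unfolding f_def using theI'[OF assms(1)[OF that]] .
  have u: "R a b \<longleftrightarrow> b = f a" if "a \<in> A" "b \<in> B" for a b
    using f[OF that(1)] assms(1)[OF that(1)] that(2) by blast
  have "bij_betw f A B"
    unfolding bij_betw_def
  proof
    show "inj_on f A" using f assms(2) by (intro inj_onI) metis
    show "f ` A = B"
    proof (intro equalityI subsetI)
      fix b assume b: "b \<in> B"
      then obtain a where "a \<in> A" "R a b" using assms(2) by blast
      then show "b \<in> f ` A" using u b by blast
    qed (use f in blast)
  qed
  then show ?thesis using that u by blast
qed

lemma iso_representativesD:
  assumes "iso_representatives C S R"
  shows "\<And>X. X \<in> R \<Longrightarrow> X \<in> S" "\<And>X. X \<in> S \<Longrightarrow> \<exists>Y\<in>R. isomorphic C X Y"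
    "\<And>X Y Z. X \<in> S \<Longrightarrow> Y \<in> R \<Longrightarrow> Z \<in> R \<Longrightarrow> isomorphic C X Y \<Longrightarrow> isomorphic C X Z \<Longrightarrow> Y = Z"
  using assms unfolding iso_representatives_def by blast+

locale silting_setup = ks_t_category K D t
  for K :: "'k ring" and D :: "('k, 'o, 'm, 'z) tri_cat_scheme" (structure) and t +
  fixes \<L> \<P> :: "'o set"
  assumes L_reps: "iso_representatives (heart D t) {L. simple_object (heart D t) L} \<L>"
    and P_reps: "iso_representatives D {P. indecomposable D P \<and> derived_projective D t P} \<P>"
begin

lemma L_simple: "L \<in> \<L> \<Longrightarrow> simple L"
  using iso_representativesD(1)[OF L_reps] by simp

lemma P_dp: "P \<in> \<P> \<Longrightarrow> dp P" and P_indec: "P \<in> \<P> \<Longrightarrow> indecomposable D P"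
  using iso_representativesD(1)[OF P_reps] by auto

lemma P_loc: "P \<in> \<P> \<Longrightarrow> loc P"
  using P_indec indecomposable_dp_loc by blast

lemma L_ex:
  assumes "simple L"
  obtains L' where "L' \<in> \<L>" "isomorphic D L L'"
  using iso_representativesD(2)[OF L_reps, of L] assms heart_isomorphic by auto

lemma P_ex:
  assumes "dp P" "indecomposable D P"
  obtains P' where "P' \<in> \<P>" "isomorphic D P P'"
  using iso_representativesD(2)[OF P_reps, of P] assms by auto

lemma L_unique:
  assumes "L \<in> \<L>" "L' \<in> \<L>" "isomorphic D L L'"
  shows "L = L'"
  using iso_representativesD(3)[OF L_reps, of L L L'] L_simple simple_hrt heart_isomorphic
    isomorphic_refl hrt_obj assms by auto

lemma P_unique:
  assumes "P \<in> \<P>" "P' \<in> \<P>" "isomorphic D P P'"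
  shows "P = P'"
  using iso_representativesD(3)[OF P_reps, of P P P'] P_dp P_indec isomorphic_refl dp_obj assms by auto

lemma hom_nonzero_right_unique:
  assumes P: "P \<in> \<P>" and L: "L \<in> \<L>" "L' \<in> \<L>"
    and n: "\<not> hom_vanishes D P L" "\<not> hom_vanishes D P L'"
  shows "L = L'"
proof -
  note Po = dp_obj[OF P_dp[OF P]]
  note sL = L_simple[OF L(1)] L_simple[OF L(2)]
  obtain f where f: "arr f P L" "f \<noteq> zero_mor D P L" using not_vanish[OF n(1) Po simple_obj[OF sL(1)]] .
  obtain g where g: "arr g P L'" "g \<noteq> zero_mor D P L'" using not_vanish[OF n(2) Po simple_obj[OF sL(2)]] .
  obtain u where u: "arr u L L'" "u \<cdot> f = g"
    using dp_hom_factor[OF P_dp[OF P] P_loc[OF P] sL(2,1) g(1) f] .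
  then have "u \<noteq> zero_mor D L L'" using zero_comp[OF f(1) simple_obj[OF sL(2)]] g(2) by metis
  then have "isomorphic D L L'" using simple_iso[OF sL u(1)] unfolding isomorphic_def by blast
  then show ?thesis using L_unique L by blast
qed

lemma hom_nonzero_left_unique:
  assumes P: "P \<in> \<P>" "P' \<in> \<P>" and L: "L \<in> \<L>"
    and n: "\<not> hom_vanishes D P L" "\<not> hom_vanishes D P' L"
  shows "P = P'"
proof -
  note sL = L_simple[OF L]
  obtain f where f: "arr f P L" "f \<noteq> zero_mor D P L"
    using not_vanish[OF n(1) dp_obj[OF P_dp[OF P(1)]] simple_obj[OF sL]] .
  obtain g where g: "arr g P' L" "g \<noteq> zero_mor D P' L"
    using not_vanish[OF n(2) dp_obj[OF P_dp[OF P(2)]] simple_obj[OF sL]] .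
  show ?thesis
    using P_unique[OF P] dp_unique[OF P_dp[OF P(1)] P_loc[OF P(1)] P_dp[OF P(2)] P_loc[OF P(2)] sL f g] .
qed

lemma P_hits:
  assumes P: "P \<in> \<P>"
  obtains L where "L \<in> \<L>" "\<not> hom_vanishes D P L"
proof -
  have "\<not> zero_object D P" using P_indec[OF P] by (simp add: indecomposable_def)
  then obtain L f where L: "simple L" "arr f P L" "f \<noteq> zero_mor D P L"
    using dp_hits_simple[OF P_dp[OF P]] by metis
  obtain L' where L': "L' \<in> \<L>" "isomorphic D L L'" using L_ex[OF L(1)] .
  have "\<not> hom_vanishes D P L" using not_vanishI[OF L(2,3)] .
  then show ?thesis
    using that[OF L'(1)] vanish_iso[OF isomorphic_refl[OF dp_obj[OF P_dp[OF P]]] L'(2)] by simp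
qed

lemma L_hit:
  assumes d: detects and L: "simple L"
  obtains P where "P \<in> \<P>" "\<not> hom_vanishes D P L"
proof -
  obtain P f where P: "dp P" "indecomposable D P" "arr f P L" "f \<noteq> zero_mor D P L"
    using detecting_dp[OF d L] by metis
  obtain P' where P': "P' \<in> \<P>" "isomorphic D P P'" using P_ex[OF P(1,2)] .
  have "\<not> hom_vanishes D P L" using not_vanishI[OF P(3,4)] .
  then show ?thesis
    using that[OF P'(1)] vanish_iso[OF P'(2) isomorphic_refl[OF simple_obj[OF L]]] by simp
qed

abbreviation dual_bijection :: "('o \<Rightarrow> 'o) \<Rightarrow> bool" where
  "dual_bijection \<phi> \<equiv> bij_betw \<phi> \<P> \<L> \<and>
     (\<forall>P\<in>\<P>. \<forall>L\<in>\<L>. \<forall>m::int.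
        left_modules_isomorphic (endo_ring D L) (hom_left_module D P L m)
          (if L = \<phi> P \<and> m = 0 then regular_module (endo_ring D L)
           else zero_module (endo_ring D L)))"

lemma zero_module_iso:
  assumes v: "hom_vanishes D P (shO D m L)" and P: "P \<in> Obj D" and L: "L \<in> Obj D"
  shows "left_modules_isomorphic (endo_ring D L) (hom_left_module D P L m) (zero_module (endo_ring D L))"
  unfolding left_modules_isomorphic_def
proof (rule bexI[of _ "\<lambda>_. zero_mor D L L"], intro ballI)
  note z = arr_zero[OF L L]
  note zP = arr_zero[OF P shO_closed[OF L, of m]]
  have c: "hom_set D P (shO D m L) = {zero_mor D P (shO D m L)}" using v by (simp add: hom_vanishes_def)
  show "(\<lambda>_. zero_mor D L L) \<in> iso (add_monoid (hom_left_module D P L m)) (add_monoid (zero_module (endo_ring D L)))"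
    using add_zero(1)[OF z] add_zero(1)[OF zP]
    by (simp add: iso_def hom_def bij_betw_def hom_left_module_def zero_module_def endo_ring_def c)
  show "zero_mor D L L = r \<odot>\<^bsub>zero_module (endo_ring D L)\<^esub> zero_mor D L L"
    if "r \<in> carrier (endo_ring D L)" for r
  proof -
    have "arr r L L" using that L by (simp add: endo_ring_def arr_def)
    from comp_zero[OF this L] show ?thesis by (simp add: zero_module_def endo_ring_def)
  qed
qed

lemma regular_module_iso:
  assumes P: "dp P" "loc P" and L: "simple L" and f: "arr f P L" "f \<noteq> zero_mor D P L"
  shows "left_modules_isomorphic (endo_ring D L) (hom_left_module D P L 0) (regular_module (endo_ring D L))"
proof -
  note Lo = simple_obj[OF L] and Po = dp_obj[OF P(1)]
  have "\<exists>e. arr e L L \<and> e \<cdot> f = x" if "arr x P L" for x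
    using dp_hom_factor[OF P L L that f] by metis
  then obtain h where h: "\<And>x. arr x P L \<Longrightarrow> arr (h x) L L" "\<And>x. arr x P L \<Longrightarrow> h x \<cdot> f = x" by metis
  have inj: "e = e'" if "arr e L L" "arr e' L L" "e \<cdot> f = e' \<cdot> f" for e e'
    using cov_cancel_eq[OF simple_cov[OF L dp_le[OF P(1)] f] simple_ge[OF L] that] .
  have h_eq: "h x = e" if "arr e L L" "e \<cdot> f = x" for e x
  proof -
    have "arr x P L" using arr_comp[OF f(1) that(1)] that(2) by simp
    then show ?thesis using inj[OF h(1) that(1)] h(2) that(2) by simp
  qed
  have cP: "x \<in> hom_set D P L \<longleftrightarrow> arr x P L" for x using Po Lo by (simp add: arr_def)
  have cL: "x \<in> hom_set D L L \<longleftrightarrow> arr x L L" for x using Lo by (simp add: arr_def)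
  have add: "h (x \<oplus>\<^bsub>Hom D P L\<^esub> y) = h x \<oplus>\<^bsub>Hom D L L\<^esub> h y" if "arr x P L" "arr y P L" for x y
    using add_comp[OF f(1) h(1)[OF that(1)] h(1)[OF that(2)]] h(2) that
    by (intro h_eq arr_add h(1)) simp_all
  have "bij_betw h (hom_set D P L) (hom_set D L L)"
  proof (rule bij_betwI[where g = "\<lambda>e. e \<cdot> f"])
    show "h \<in> hom_set D P L \<rightarrow> hom_set D L L" using h(1) by (simp add: cP cL)
    show "(\<lambda>e. e \<cdot> f) \<in> hom_set D L L \<rightarrow> hom_set D P L" using arr_comp[OF f(1)] by (simp add: cP cL)
    show "h x \<cdot> f = x" if "x \<in> hom_set D P L" for x using h(2) that by (simp add: cP)
    show "h (e \<cdot> f) = e" if "e \<in> hom_set D L L" for e using h_eq that by (simp add: cL)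
  qed
  then have "h \<in> iso (add_monoid (hom_left_module D P L 0)) (add_monoid (regular_module (endo_ring D L)))"
    using h(1) add
    by (simp add: iso_def hom_def hom_left_module_def regular_module_def endo_ring_def shO_0[OF Lo] cP cL)
  moreover have "h (r \<odot>\<^bsub>hom_left_module D P L 0\<^esub> x) = r \<odot>\<^bsub>regular_module (endo_ring D L)\<^esub> h x"
    if "r \<in> carrier (endo_ring D L)" "x \<in> carrier (hom_left_module D P L 0)" for r x
  proof -
    have r: "arr r L L" using that(1) by (simp add: endo_ring_def cL)
    have x: "arr x P L" using that(2) by (simp add: hom_left_module_def shO_0[OF Lo] cP)
    have "r \<cdot> h x \<cdot> f = r \<cdot> x" using assoc[OF f(1) h(1)[OF x] r] h(2)[OF x] by simp
    then have "h (r \<cdot> x) = r \<cdot> h x" using h_eq[OF arr_comp[OF h(1)[OF x] r]] by simp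
    then show ?thesis by (simp add: hom_left_module_def regular_module_def endo_ring_def shift_0[OF r])
  qed
  ultimately show ?thesis unfolding left_modules_isomorphic_def by blast
qed

lemma detects_dual_bijection:
  assumes d: detects
  shows "\<exists>\<phi>. dual_bijection \<phi>"
proof -
  have 1: "\<exists>!L. L \<in> \<L> \<and> \<not> hom_vanishes D P L" if "P \<in> \<P>" for P
    using P_hits[OF that] hom_nonzero_right_unique[OF that] by metis
  have 2: "\<exists>!P. P \<in> \<P> \<and> \<not> hom_vanishes D P L" if "L \<in> \<L>" for L
    using L_hit[OF d L_simple[OF that]] hom_nonzero_left_unique[OF _ _ that] by metis
  obtain \<phi> where \<phi>: "bij_betw \<phi> \<P> \<L>"
    and r: "\<And>P L. P \<in> \<P> \<Longrightarrow> L \<in> \<L> \<Longrightarrow> \<not> hom_vanishes D P L \<longleftrightarrow> L = \<phi> P"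
    using bij_betw_of_unique_relation[of \<P> \<L> "\<lambda>P L. \<not> hom_vanishes D P L", OF 1 2] by blast
  have "left_modules_isomorphic (endo_ring D L) (hom_left_module D P L m)
          (if L = \<phi> P \<and> m = 0 then regular_module (endo_ring D L) else zero_module (endo_ring D L))"
    if P: "P \<in> \<P>" and L: "L \<in> \<L>" for P L m
  proof -
    note sL = L_simple[OF L] and dP = P_dp[OF P]
    note Lo = simple_obj[OF sL] and Po = dp_obj[OF dP]
    show ?thesis
    proof (cases "L = \<phi> P \<and> m = 0")
      case True
      then have "\<not> hom_vanishes D P L" using r[OF P L] by simp
      from not_vanish[OF this Po Lo] obtain f where "arr f P L" "f \<noteq> zero_mor D P L" .
      from regular_module_iso[OF dP P_loc[OF P] sL this] show ?thesis using True by simp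
    next
      case False
      have "hom_vanishes D P (shO D m L)"
      proof (cases "m = 0")
        case True
        then show ?thesis using False r[OF P L] shO_0[OF Lo] by simp
      next
        case False
        then show ?thesis using dp_vanish_off_degree[OF dP simple_hrt[OF sL]] by blast
      qed
      from zero_module_iso[OF this Po Lo] show ?thesis unfolding if_not_P[OF False] .
    qed
  qed
  then show ?thesis using \<phi> by blast
qed

lemma dual_bijection_detects:
  assumes "dual_bijection \<phi>"
  shows detects
  unfolding detects_def
proof (intro allI impI)
  fix L assume "simple L"
  then obtain L' where L': "L' \<in> \<L>" "isomorphic D L L'" using L_ex by metis
  note sL = L_simple[OF L'(1)]
  note Lo = simple_obj[OF sL]
  obtain P where P: "P \<in> \<P>" "L' = \<phi> P" using assms L'(1) unfolding bij_betw_def by blast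
  have "left_modules_isomorphic (endo_ring D L') (hom_left_module D P L' 0) (regular_module (endo_ring D L'))"
    using assms[THEN conjunct2, rule_format, OF P(1) L'(1), of 0] P(2) by simp
  then obtain h where "h \<in> iso (add_monoid (hom_left_module D P L' 0)) (add_monoid (regular_module (endo_ring D L')))"
    unfolding left_modules_isomorphic_def by blast
  then have b: "bij_betw h (hom_set D P L') (hom_set D L' L')"
    by (simp add: iso_def hom_left_module_def regular_module_def endo_ring_def shO_0[OF Lo])
  have "\<not> hom_vanishes D P L'"
  proof
    assume "hom_vanishes D P L'"
    then have "hom_set D L' L' = {h (zero_mor D P L')}"
      using b unfolding hom_vanishes_def bij_betw_def by auto
    then have "Idn D L' = zero_mor D L' L'"
      using arr_id[OF Lo] arr_zero[OF Lo Lo] unfolding arr_def by auto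
    then show False using zero_objectI[OF Lo] simple_nonzero[OF sL] by blast
  qed
  then have "\<not> hom_vanishes D P L"
    using vanish_iso[OF isomorphic_refl[OF dp_obj[OF P_dp[OF P(1)]]] L'(2)] by simp
  then show "\<exists>P. dp P \<and> \<not> hom_vanishes D P L" using P_dp[OF P(1)] by blast
qed

lemma detects_iff_covers: "detects \<longleftrightarrow> (\<forall>L\<in>\<L>. \<exists>P q. derived_projective_cover D t P L q)"
proof (intro iffI ballI)
  fix L assume d: detects and "L \<in> \<L>"
  then have L: "simple L" using L_simple by blast
  obtain P f where "dp P" "loc P" "arr f P L" "f \<noteq> zero_mor D P L" using detecting_dp[OF d L] by metis
  from simple_dp_cover[OF this(1,2) L this(3,4)] show "\<exists>P q. derived_projective_cover D t P L q" by blast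
next
  assume c: "\<forall>L\<in>\<L>. \<exists>P q. derived_projective_cover D t P L q"
  show detects
    unfolding detects_def
  proof (intro allI impI)
    fix L assume L: "simple L"
    obtain L' where L': "L' \<in> \<L>" "isomorphic D L L'" using L_ex[OF L] .
    obtain P q where P: "derived_projective_cover D t P L' q" using c L'(1) by blast
    note q = dp_coverD[OF P L_simple[OF L'(1)]]
    have "\<not> hom_vanishes D P L"
      using not_vanishI[OF q(2,3)] vanish_iso[OF isomorphic_refl[OF dp_obj[OF q(1)]] L'(2)] by simp
    then show "\<exists>P. dp P \<and> \<not> hom_vanishes D P L" using q(1) by blast
  qed
qed

lemma detects_iff_enough: "detects \<longleftrightarrow> enough_derived_projectives D t"
  using detects_enough enough_detects by blast

lemma detects_iff_dual_bijection: "detects \<longleftrightarrow> (\<exists>\<phi>. dual_bijection \<phi>)"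
  using detects_dual_bijection dual_bijection_detects by blast

lemma silting_members:
  assumes "silting_collection K D S"
  shows "S \<subseteq> Obj D" "P \<in> S \<Longrightarrow> indecomposable D P"
  using assms unfolding silting_collection_def indecomposable_def by auto

lemma detects_t_eq: "detects \<Longrightarrow> t = silting_t D \<P>"
  using P_ex by (intro t_eq_silting_t P_dp) (assumption | metis)+

lemma detects_silting_collection:
  assumes d: detects
  shows "silting_collection K D \<P>"
  unfolding silting_collection_def
proof (intro conjI ballI impI)
  show "t_structure D (silting_t D \<P>)" using t_structure detects_t_eq[OF d] by simp
  show "krull_schmidt K (full_subcategory D (Kar D \<P>))" using krull_schmidt_Kar[OF ks] .
qed (use P_indec P_unique in auto)

lemma is_silting_iff_detects: "is_silting K D t \<longleftrightarrow> detects"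
proof
  assume "is_silting K D t"
  then obtain S where S: "silting_collection K D S" "t = silting_t D S" unfolding is_silting_def by blast
  show detects using silting_detects[OF silting_members(1)[OF S(1)] S(2)] .
next
  assume d: detects
  show "is_silting K D t"
    unfolding is_silting_def using detects_silting_collection[OF d] detects_t_eq[OF d] by blast
qed

lemma silting_collection_unique:
  assumes S: "silting_collection K D S" and t: "t = silting_t D S"
  shows "same_up_to_iso D S \<P>"
  unfolding same_up_to_iso_def
proof (intro conjI ballI)
  note So = silting_members(1)[OF S]
  fix X assume X: "X \<in> S"
  show "\<exists>Y\<in>\<P>. isomorphic D X Y"
    using P_ex[OF silting_members_dp[OF So t X] silting_members(2)[OF S X]] by metis
next
  note So = silting_members(1)[OF S]
  fix Y assume Y: "Y \<in> \<P>"
  obtain L where L: "L \<in> \<L>" "\<not> hom_vanishes D Y L" using P_hits[OF Y] .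
  note sL = L_simple[OF L(1)]
  note Lo = simple_obj[OF sL]
  obtain X where X: "X \<in> S" "\<not> hom_vanishes D X L" using silting_detects_simple[OF So t sL] .
  note dX = silting_members_dp[OF So t X(1)]
  obtain f where f: "arr f X L" "f \<noteq> zero_mor D X L" using not_vanish[OF X(2) dp_obj[OF dX] Lo] .
  obtain g where g: "arr g Y L" "g \<noteq> zero_mor D Y L" using not_vanish[OF L(2) dp_obj[OF P_dp[OF Y]] Lo] .
  have "isomorphic D X Y"
    using dp_unique[OF dX indecomposable_dp_loc[OF silting_members(2)[OF S X(1)]] P_dp[OF Y] P_loc[OF Y] sL f g] .
  then show "\<exists>X\<in>S. isomorphic D X Y" using X(1) by blast
qed

lemma covers_same_up_to_iso:
  assumes d: detects
  shows "same_up_to_iso D \<P> {P. \<exists>L\<in>\<L>. \<exists>q. derived_projective_cover D t P L q}"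
  unfolding same_up_to_iso_def
proof (intro conjI ballI)
  fix P assume P: "P \<in> \<P>"
  note dP = P_dp[OF P]
  obtain L where L: "L \<in> \<L>" "\<not> hom_vanishes D P L" using P_hits[OF P] .
  note sL = L_simple[OF L(1)]
  obtain f where f: "arr f P L" "f \<noteq> zero_mor D P L" using not_vanish[OF L(2) dp_obj[OF dP] simple_obj[OF sL]] .
  show "\<exists>Y\<in>{P. \<exists>L\<in>\<L>. \<exists>q. derived_projective_cover D t P L q}. isomorphic D P Y"
    using simple_dp_cover[OF dP P_loc[OF P] sL f] L(1) isomorphic_refl[OF dp_obj[OF dP]] by blast
next
  fix Q assume "Q \<in> {P. \<exists>L\<in>\<L>. \<exists>q. derived_projective_cover D t P L q}"
  then obtain L q where L: "L \<in> \<L>" and q: "derived_projective_cover D t Q L q" by blast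
  note sL = L_simple[OF L]
  obtain P where P: "P \<in> \<P>" "\<not> hom_vanishes D P L" using L_hit[OF d sL] .
  note dP = P_dp[OF P(1)]
  obtain f where f: "arr f P L" "f \<noteq> zero_mor D P L" using not_vanish[OF P(2) dp_obj[OF dP] simple_obj[OF sL]] .
  show "\<exists>X\<in>\<P>. isomorphic D X Q" using dp_cover_unique[OF q sL dP P_loc[OF P(1)] f] P(1) by blast
qed

end

theorem theorem1:
  fixes K :: "'k ring"
    and D :: "('k, 'o, 'm, 'z) tri_cat_scheme"
    and t :: "'o set \<times> 'o set"
    and \<L> \<P> :: "'o set"
  assumes "triangulated_category K D"
    and "krull_schmidt K D"
    and "t_structure D t"
    and "nondegenerate D t"
    and "finite_length_category (heart D t)"
    and "iso_representatives (heart D t) {L. simple_object (heart D t) L} \<L>"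
    and "iso_representatives D {P. indecomposable D P \<and> derived_projective D t P} \<P>"
  shows
    "(is_silting K D t \<longleftrightarrow>
        (\<exists>\<phi>. bij_betw \<phi> \<P> \<L> \<and>
           (\<forall>P\<in>\<P>. \<forall>L\<in>\<L>. \<forall>m::int.
              left_modules_isomorphic (endo_ring D L) (hom_left_module D P L m)
                (if L = \<phi> P \<and> m = 0 then regular_module (endo_ring D L)
                 else zero_module (endo_ring D L))))) \<and>
     (is_silting K D t \<longleftrightarrow> (\<forall>L\<in>\<L>. \<exists>P \<pi>. derived_projective_cover D t P L \<pi>)) \<and>
     (is_silting K D t \<longleftrightarrow> enough_derived_projectives D t) \<and>
     (is_silting K D t \<longrightarrow>
        silting_collection K D \<P> \<and> t = silting_t D \<P> \<and>
        (\<forall>S. silting_collection K D S \<and> t = silting_t D S \<longrightarrow> same_up_to_iso D S \<P>) \<and>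
        same_up_to_iso D \<P> {P. \<exists>L\<in>\<L>. \<exists>\<pi>. derived_projective_cover D t P L \<pi>})"
proof -
  interpret triangulated_category K D by fact
  interpret silting_setup K D t \<L> \<P>
    by unfold_locales fact+
  show ?thesis
    unfolding is_silting_iff_detects
    using detects_iff_dual_bijection detects_iff_covers detects_iff_enough detects_silting_collection
      detects_t_eq silting_collection_unique covers_same_up_to_iso
    by (intro conjI) blast+
qed

end
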